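(* Let $G=\mathbb{Z}/p\mathbb{Z}$ with $p\geq 2$ prime, let $A,B\subseteq G$ be nonempty subsets with $A+B\neq G$, and set $C=-\,(G\setminus (A+B))$. Suppose $|A|\geq |B|$ and, defining the integer $r$ by $|A+B|=|A|+|B|+r$, $$|A+B|=|A|+|B|+r\leq \min\{|A|+1.01|B|-3,\; p-r-3\}.$$ Then there are arithmetic progressions $P_A,P_B,P_C\subseteq G$, all having a common difference, such that $X\subseteq P_X$ and $|P_X|\leq |X|+r+1$ for all $X\in\{A,B,C\}$.
   Context: $A+B=\{a+b: a\in A, b\in B\}$ and $-X=\{-x:x\in X\}$. An arithmetic progression in $G$ with difference $d\in G$ is a set of the form $\{a, a+d, \ldots, a+(n-1)d\}$ with $a\in G$, $n\ge 1$. *)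

theory Defs
  imports
    Complex_Main
    "HOL-Library.Set_Algebras"
    "Berlekamp_Zassenhaus.Finite_Field"
begin

(* The group Z/pZ is the library type 'p mod_ring with 'p :: prime_card, i.e. p = CARD('p) prime.
   The sumset A + B is the one of Set_Algebras. Unary minus on sets is the complement, so the
   set of negatives -X is written uminus ` X. *)

(* The n terms need not be distinct: d = 0 and n larger than the order of d are allowed. *)
definition arith_prog :: "'a::ring_1 \<Rightarrow> 'a set \<Rightarrow> bool" where
  "arith_prog d P \<longleftrightarrow> (\<exists>a n. n \<ge> 1 \<and> P = (\<lambda>k. a + of_nat k * d) ` {..<n})"

end

theory Submission
  imports Defs "HOL-Analysis.Convex"
begin

text \<open>
  Write \<open>X, Y, Z\<close> for \<open>A, B, C\<close> ordered by size, so that \<open>0 \<notin> X + Y + Z\<close> and \<open>p \<le> |X| + |Y| + |Z| + r\<close>; the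
  hypothesis says that \<open>r + 3 \<le> |X|\<close> and \<open>100 (r + 3) \<le> |Y|\<close>. Since the sum over all frequencies of
  the products of the three Fourier coefficients vanishes, \<open>X\<close> has a nontrivial coefficient
  of absolute value at least \<open>(1 - \<tau>) |X|\<close> with \<open>\<tau> = (|X| + r) / |Y|\<close>. Hence for some difference most of \<open>X\<close> lies
  in a short arc, where sums behave as in the integers; Petridis' lemma bounds the iterated sumsets
  of \<open>X\<close>, and Freiman's 3k-4 theorem then compresses the arc.

  If \<open>|X| < 0.035 |Y|\<close> this puts all of \<open>X\<close> into a short progression. A multiple of \<open>X\<close> contains a long
  interval, so that a large part of \<open>Y\<close>, and then \<open>Z\<close> and \<open>Y\<close>, must leave a gap and can be treated as sets of
  integers too. Otherwise \<open>X\<close> is replaced by a set \<open>V\<close> that minimises \<open>|V + Y| - |V|\<close> among the sets with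
  \<open>|V| \<ge> 0.035 |Y|\<close>. A smallest minimiser meets its translates in few points, which bounds the additive energy
  between \<open>V\<close> and \<open>Y\<close> and forces \<open>|V| < 0.21 |Y|\<close>. The same argument applied to \<open>V\<close> puts \<open>Y\<close> into a progression
  of length \<open>|Y| + r + 1\<close>, from which the other two sets are recovered.
\<close>

section \<open>Sumsets of finite sets of integers\<close>

text \<open>The Fourier bound is vacuous when \<open>|X|\<close> is about \<open>|Y|\<close>, for
  then \<open>\<tau>\<close> is about 1; hence the replacement by \<open>V\<close>. It is harmless,
  since \<open>V\<close>, \<open>Y\<close> and the negative of the complement of
  \<open>V + Y\<close> satisfy the same inequalities with the same \<open>r\<close>. The threshold
  0.035 is a compromise: it bounds the intersections of translates of \<open>V\<close>, so it must
  be small, but it must be large against 0.01, the bound for \<open>r / |Y|\<close>, so that the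
  estimate \<open>2 (|V| + r)\<close> for the doubling of \<open>V\<close> stays below
  \<open>3 |V|\<close>. For small \<open>X\<close> the number \<open>r\<close> may be almost
  \<open>|X|\<close>. The estimate for \<open>|X + X|\<close> is then close to \<open>4 |X|\<close>,
  out of reach of the 3k-4 theorem. But the fourfold sumset has about \<open>8 |X| < 9 |X|\<close>
  elements, so the theorem applies to \<open>X\<close> or to \<open>X + X\<close>. This calls for
  arcs of length \<open>p / 4\<close>, whereas \<open>p / 2\<close> suffices for \<open>V\<close>.
  Petridis' lemma controls sums with a subset \<open>Y0\<close> of \<open>Y\<close> only. A
  progression for \<open>Y\<close> is therefore reached by a detour: one for \<open>Y0\<close>
  yields one for the third set, and this one confines all of \<open>Y\<close>.\<close>

abbreviation residues_of :: "int \<Rightarrow> int set \<Rightarrow> int set" where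
  "residues_of m X \<equiv> (\<lambda>x. x mod m) ` X"

lemma set_plus_image: "A + B = (\<lambda>(a, b). a + b) ` (A \<times> B)"
  by (auto simp: set_plus_def image_iff)

lemma set_plus_memI: "a \<in> A \<Longrightarrow> b \<in> B \<Longrightarrow> a + b \<in> A + B"
  by (rule set_plus_intro)

lemma set_plus_memE:
  assumes "x \<in> A + B" obtains a b where "a \<in> A" "b \<in> B" "x = a + b"
  using assms by (auto simp: set_plus_def)

lemma card_image_plus [simp]: "card ((+) (c :: 'a::group_add) ` A) = card A"
  by (intro card_image) (auto simp: inj_on_def)

lemma card_plus_ge_left:
  fixes A B :: "'a::group_add set"
  assumes "finite A" "finite B" "A \<noteq> {}"
  shows "card B \<le> card (A + B)"
proof -
  obtain a where a: "a \<in> A" using assms(3) by auto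
  have "card B = card ((+) a ` B)" by simp
  also have "\<dots> \<le> card (A + B)"
    using a assms by (intro card_mono finite_set_plus) (auto intro: set_plus_memI)
  finally show ?thesis .
qed

text \<open>The translates \<open>Min B + A\<close> and \<open>Max A + B\<close> lie in the sumset.
  The first stays at or below \<open>Max A + Min B\<close>, the second at or above it, so they share
  one point only.\<close>

lemma card_plus_ge_int:
  fixes A B :: "int set"
  assumes "finite A" "finite B" "A \<noteq> {}" "B \<noteq> {}"
  shows "card A + card B \<le> card (A + B) + 1"
proof -
  define a where "a = Max A"
  define b where "b = Min B"
  have a: "a \<in> A" and b: "b \<in> B" using assms by (auto simp: a_def b_def)
  let ?P = "(+) b ` A" and ?Q = "(+) a ` B"
  have "?P \<inter> ?Q \<subseteq> {a + b}"
  proof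
    fix x assume "x \<in> ?P \<inter> ?Q"
    then obtain a' b' where "a' \<in> A" "b' \<in> B" "x = b + a'" "x = a + b'" by auto
    moreover have "a' \<le> a" "b \<le> b'" using \<open>a' \<in> A\<close> \<open>b' \<in> B\<close> assms by (auto simp: a_def b_def)
    ultimately show "x \<in> {a + b}" by auto
  qed
  then have "card (?P \<inter> ?Q) \<le> 1"
    using card_mono[of "{a+b}" "?P \<inter> ?Q"] by auto
  moreover have "card (?P \<union> ?Q) \<le> card (A + B)"
  proof (intro card_mono finite_set_plus)
    show "?P \<union> ?Q \<subseteq> A + B"
      using a b set_plus_memI[of _ A b B] set_plus_memI[of a A _ B] by (auto simp: add.commute[of b])
  qed (use assms in auto)
  moreover have "card ?P + card ?Q = card (?P \<union> ?Q) + card (?P \<inter> ?Q)"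
    using assms by (intro card_Un_Int) auto
  ultimately show ?thesis by simp
qed

section \<open>Reduction of integer sets modulo a positive integer\<close>

lemma card_residues_shift:
  assumes m: "m > 0" and C: "finite C" and P: "P \<subseteq> C" and Pm: "(+) m ` P \<subseteq> C"
  shows "card (residues_of m C) + card P \<le> card C"
proof -
  \<comment> \<open>\<open>f r\<close> is the least element of \<open>C\<close> in the class
    \<open>r\<close>. It cannot be \<open>m + x\<close> with \<open>x\<close> in \<open>P\<close>,
    since \<open>x\<close> lies in the same class and is smaller; so these representatives and
    \<open>m + P\<close> are disjoint parts of \<open>C\<close>.\<close>
  define f where "f = (\<lambda>r. Min {x \<in> C. x mod m = r})"
  have f: "f r \<in> C \<and> f r mod m = r" if "r \<in> residues_of m C" for r
  proof -
    have "Min {x \<in> C. x mod m = r} \<in> {x \<in> C. x mod m = r}"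
      using that C by (intro Min_in) auto
    then show ?thesis by (simp add: f_def)
  qed
  have inj: "inj_on f (residues_of m C)" using f by (metis inj_onI)
  have disj: "f ` residues_of m C \<inter> (+) m ` P = {}"
  proof (rule ccontr)
    assume "\<not> ?thesis"
    then obtain r x where r: "r \<in> residues_of m C" and x: "x \<in> P" and e: "f r = m + x" by auto
    have "x \<in> {y \<in> C. y mod m = r}"
      using f[OF r] e x P by auto
    then have "f r \<le> x" unfolding f_def using C by (intro Min_le) auto
    with e m show False by simp
  qed
  have "card (residues_of m C) + card P = card (f ` residues_of m C) + card ((+) m ` P)"
    using inj by (simp add: card_image)
  also have "\<dots> = card (f ` residues_of m C \<union> (+) m ` P)"
    using C disj P by (intro card_Un_disjoint[symmetric]) (auto intro: finite_subset)
  also have "\<dots> \<le> card C"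
    using f Pm C by (intro card_mono) auto
  finally show ?thesis .
qed

lemma residues_of_subset: "m > 0 \<Longrightarrow> residues_of m C \<subseteq> {0..<m}"
  by auto

text \<open>Pigeonhole: among \<open>m\<close> classes, \<open>t - P\<close> and \<open>Q\<close>
  must share one.\<close>

lemma residues_of_plus_UNIV:
  assumes m: "m > 0" and "finite P" "finite Q"
    and big: "int (card (residues_of m P)) + int (card (residues_of m Q)) > m"
  shows "residues_of m (P + Q) = {0..<m}"
proof
  show "residues_of m (P + Q) \<subseteq> {0..<m}" using residues_of_subset[OF m] .
  show "{0..<m} \<subseteq> residues_of m (P + Q)"
  proof
    fix t assume t: "t \<in> {0..<m}"
    let ?P = "(\<lambda>x. (t - x) mod m) ` residues_of m P"
    have inj: "inj_on (\<lambda>x. (t - x) mod m) (residues_of m P)"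
    proof (rule inj_onI)
      fix x y assume xy: "x \<in> residues_of m P" "y \<in> residues_of m P" "(t - x) mod m = (t - y) mod m"
      then have "m dvd (t - x) - (t - y)" by (simp add: mod_eq_dvd_iff)
      then have "m dvd x - y" by (metis diff_diff_eq2 diff_add_cancel minus_diff_eq dvd_minus_iff add_diff_cancel_left' diff_diff_add add.commute diff_diff_eq)
      then have "x mod m = y mod m" by (simp add: mod_eq_dvd_iff)
      then show "x = y" using xy m by auto
    qed
    have "?P \<inter> residues_of m Q \<noteq> {}"
    proof
      assume e: "?P \<inter> residues_of m Q = {}"
      have "card ?P + card (residues_of m Q) = card (?P \<union> residues_of m Q)"
        using e assms by (intro card_Un_disjoint[symmetric]) auto
      also have "\<dots> \<le> card {0..<m}" using m by (intro card_mono) auto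
      finally show False using big m by (simp add: card_image[OF inj])
    qed
    then obtain a b where ab: "a \<in> P" "b \<in> Q" "(t - a mod m) mod m = b mod m" by auto
    then have "(a + b) mod m = t"
    proof -
      have "(t - a) mod m = b mod m" using ab(3) by (simp add: mod_diff_right_eq)
      then have "m dvd t - a - b" by (simp add: mod_eq_dvd_iff)
      then have "m dvd t - (a + b)" by (simp add: algebra_simps)
      then have "t mod m = (a + b) mod m" by (simp add: mod_eq_dvd_iff)
      then show ?thesis using t by simp
    qed
    then show "t \<in> residues_of m (P + Q)" using ab by (metis image_eqI set_plus_memI)
  qed
qed

text \<open>As \<open>0\<close> and \<open>m\<close> belong to \<open>P\<close>, both
  \<open>Q\<close> and \<open>m + Q\<close> lie in \<open>P + Q\<close>: besides one representative
  of each class modulo \<open>m\<close> there is an extra element for each element of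
  \<open>Q\<close>.\<close>

lemma card_plus_ge_full_residues:
  assumes m: "m > 0" and "finite P" "finite Q" and "0 \<in> P" "m \<in> P"
    and full: "{0..<m} \<subseteq> residues_of m (P + Q)"
  shows "m + int (card Q) \<le> int (card (P + Q))"
proof -
  have "card (residues_of m (P + Q)) + card Q \<le> card (P + Q)"
  proof (intro card_residues_shift finite_set_plus)
    show "Q \<subseteq> P + Q" using set_plus_memI[OF \<open>0 \<in> P\<close>, of _ Q] by auto
    show "(+) m ` Q \<subseteq> P + Q" using set_plus_memI[OF \<open>m \<in> P\<close>, of _ Q] by auto
  qed (use assms in auto)
  moreover have "card {0..<m} \<le> card (residues_of m (P + Q))"
    using full assms by (intro card_mono) (auto intro: finite_set_plus)
  ultimately show ?thesis using m by simp
qed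

lemma card_plus_ge_short:
  assumes m: "m > 0" and "finite P" "finite Q" and "0 \<in> P" "m \<in> P"
    and "int (card (residues_of m P)) + int (card (residues_of m Q)) > m"
  shows "m + int (card Q) \<le> int (card (P + Q))"
  using assms residues_of_plus_UNIV[of m P Q] by (intro card_plus_ge_full_residues) auto

lemma card_residues_of_small:
  assumes "P \<subseteq> {a..<a + m}"
  shows "card (residues_of m P) = card P"
proof (rule card_image, rule inj_onI)
  fix x y assume xy: "x \<in> P" "y \<in> P" "x mod m = y mod m"
  then have "m dvd x - y" by (simp add: mod_eq_dvd_iff)
  moreover have "\<bar>x - y\<bar> < m"
  proof -
    have "x \<in> {a..<a + m}" "y \<in> {a..<a + m}" using xy assms by blast+
    then show ?thesis by auto
  qed
  ultimately show "x = y" using zdvd_not_zless[of "\<bar>x - y\<bar>" m] by (cases "x = y") auto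
qed

text \<open>The endpoints \<open>0\<close> and \<open>m\<close> are the only pair that the reduction
  identifies.\<close>

lemma card_residues_of_interval:
  assumes m: "m > 0" and P: "P \<subseteq> {0..m}" and "0 \<in> P" "m \<in> P"
  shows "int (card (residues_of m P)) = int (card P) - 1"
proof -
  have fin: "finite P" using P finite_subset by blast
  have "residues_of m P = residues_of m (P - {m})"
  proof -
    have "m mod m = 0 mod m" by simp
    moreover have "0 \<in> P - {m}" using \<open>0 \<in> P\<close> m by auto
    ultimately have "m mod m \<in> residues_of m (P - {m})" by blast
    moreover have "residues_of m P = insert (m mod m) (residues_of m (P - {m}))"
      using \<open>m \<in> P\<close> by (metis image_insert insert_Diff)
    ultimately show ?thesis by (metis insert_absorb)
  qed
  also have "card \<dots> = card (P - {m})"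
    using P by (intro card_residues_of_small[where a = 0]) force
  finally have "card (residues_of m P) = card P - 1" using assms by simp
  moreover have "card P > 0" using assms fin by (auto simp: card_gt_0_iff)
  ultimately show ?thesis by simp
qed

section \<open>Integer sumsets with one short summand\<close>

lemma card_plus_ge_separated:
  fixes D Sa Sb :: "int set"
  assumes "D \<subseteq> {0..l}" "D \<noteq> {}" "finite Sa" "finite Sb" "Sa \<union> Sb \<subseteq> S" "finite S"
    and "\<And>a. a \<in> Sa \<Longrightarrow> a + l < t" "\<And>b. b \<in> Sb \<Longrightarrow> t \<le> b"
  shows "card (D + Sa) + card (D + Sb) \<le> card (D + S)"
proof -
  have fin: "finite D" using assms(1) finite_subset by blast
  have "(D + Sa) \<inter> (D + Sb) = {}"
  proof (rule ccontr)
    assume "\<not> ?thesis"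
    then obtain x where x: "x \<in> D + Sa" "x \<in> D + Sb" by auto
    then obtain d a d' b where "d \<in> D" "a \<in> Sa" "x = d + a" "d' \<in> D" "b \<in> Sb" "x = d' + b"
      by (metis set_plus_memE)
    moreover have "d \<le> l" "0 \<le> d'" using \<open>d \<in> D\<close> \<open>d' \<in> D\<close> assms(1) by auto
    ultimately show False using assms(7)[of a] assms(8)[of b] by linarith
  qed
  then have "card (D + Sa) + card (D + Sb) = card ((D + Sa) \<union> (D + Sb))"
    using fin assms by (intro card_Un_disjoint[symmetric] finite_set_plus) auto
  also have "\<dots> \<le> card (D + S)"
  proof (intro card_mono finite_set_plus)
    show "D + Sa \<union> (D + Sb) \<subseteq> D + S"
      using assms(5) set_plus_mono2[OF order_refl, of Sa S D] set_plus_mono2[OF order_refl, of Sb S D] by blast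
  qed (use fin assms in auto)
  finally show ?thesis .
qed

lemma card_window_of_missing:
  fixes D S :: "int set"
  assumes "D \<subseteq> {0..l}" "l \<ge> 0" "t \<notin> D + S"
  shows "int (card (S \<inter> {t-l..t})) + int (card D) \<le> l + 1"
proof -
  have fin: "finite D" using assms(1) finite_subset by blast
  let ?D = "(\<lambda>d. t - d) ` D"
  have "?D \<inter> (S \<inter> {t-l..t}) = {}"
  proof (rule ccontr)
    assume "\<not> ?thesis"
    then obtain d where "d \<in> D" "t - d \<in> S" by auto
    then have "d + (t - d) \<in> D + S" by (rule set_plus_memI)
    with assms(3) show False by simp
  qed
  then have "card ?D + card (S \<inter> {t-l..t}) = card (?D \<union> (S \<inter> {t-l..t}))"
    using fin by (intro card_Un_disjoint[symmetric]) auto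
  also have "\<dots> \<le> card {t-l..t}"
    using assms(1) by (intro card_mono) auto
  finally have "card ?D + card (S \<inter> {t-l..t}) \<le> nat (l + 1)" by simp
  moreover have "card ?D = card D" by (intro card_image) (auto simp: inj_on_def)
  ultimately show ?thesis using assms(2) by linarith
qed

lemma card_split3:
  fixes S :: "int set"
  assumes "finite S" "a \<le> b + 1"
  shows "int (card S) = int (card {s \<in> S. s < a}) + int (card (S \<inter> {a..b})) + int (card {s \<in> S. s > b})"
proof -
  have "S = {s \<in> S. s < a} \<union> (S \<inter> {a..b}) \<union> {s \<in> S. s > b}" by auto
  then have "card S = card ({s \<in> S. s < a} \<union> (S \<inter> {a..b}) \<union> {s \<in> S. s > b})" by simp
  also have "\<dots> = card ({s \<in> S. s < a} \<union> (S \<inter> {a..b})) + card {s \<in> S. s > b}"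
    using assms by (intro card_Un_disjoint) auto
  also have "card ({s \<in> S. s < a} \<union> (S \<inter> {a..b})) = card {s \<in> S. s < a} + card (S \<inter> {a..b})"
    using assms by (intro card_Un_disjoint) auto
  finally show ?thesis by simp
qed

text \<open>A missing \<open>t\<close> forces a window of length \<open>l\<close> in which \<open>S\<close> has few elements, and on either side
  of that window the sumset grows separately.\<close>

lemma card_plus_ge_missing:
  fixes D S :: "int set"
  assumes "D \<subseteq> {0..l}" "D \<noteq> {}" "l \<ge> 0" "finite S" "t \<notin> D + S"
  shows "int (card (D + {s \<in> S. s < t - l})) + int (card (D + {s \<in> S. s > t})) \<le> int (card (D + S))"
    and "int (card S) + int (card D) \<le> int (card {s \<in> S. s < t - l}) + int (card {s \<in> S. s > t}) + l + 1"
proof -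
  show "int (card (D + {s \<in> S. s < t - l})) + int (card (D + {s \<in> S. s > t})) \<le> int (card (D + S))"
    using card_plus_ge_separated[of D l "{s \<in> S. s < t - l}" "{s \<in> S. s > t}" S t] assms by auto
  show "int (card S) + int (card D) \<le> int (card {s \<in> S. s < t - l}) + int (card {s \<in> S. s > t}) + l + 1"
    using card_window_of_missing[OF assms(1,3,5)] card_split3[OF assms(4), of "t - l" t] assms(3) by linarith
qed

lemma card_nonempty_pos: "finite A \<Longrightarrow> a \<in> A \<Longrightarrow> card A \<ge> 1"
  by (metis One_nat_def Suc_leI card_gt_0_iff empty_iff)

text \<open>A missing \<open>t\<close> with elements of \<open>S\<close> on both sides makes
  \<open>D\<close> contribute \<open>|D| - 1\<close> twice, while the window before \<open>t\<close>
  costs at most \<open>l + 1 - |D|\<close> elements of \<open>S\<close>. Together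
  \<open>|D + S| >= |S| + 3 |D| - l - 3\<close>, which \<open>h\<close> puts above the allowed
  size.\<close>

lemma dense_sumset_interval:
  fixes D S :: "int set"
  assumes D: "D \<subseteq> {0..l}" "0 \<in> D" and S: "finite S" "0 \<in> S" "M \<in> S"
    and N: "int (card (D + S)) \<le> int (card D) + int (card S) + r"
    and h: "l + 1 + r + 3 \<le> 2 * int (card D)"
    and t: "l + 1 \<le> t" "t \<le> M - 1"
  shows "t \<in> D + S"
proof (rule ccontr)
  assume nt: "t \<notin> D + S"
  have l: "l \<ge> 0" and ne: "D \<noteq> {}" using D by auto
  have fin: "finite D" using D finite_subset by blast
  have "0 \<in> {s \<in> S. s < t - l}" "M \<in> {s \<in> S. s > t}" using S t by auto
  then have "card D + card {s \<in> S. s < t - l} \<le> card (D + {s \<in> S. s < t - l}) + 1"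
    "card D + card {s \<in> S. s > t} \<le> card (D + {s \<in> S. s > t}) + 1"
    using fin ne S by (intro card_plus_ge_int; auto)+
  with card_plus_ge_missing[OF D(1) ne l S(1) nt] N h show False by linarith
qed

text \<open>The sharp bound comes from \<open>card_plus_ge_short\<close> modulo \<open>M\<close>,
  once the residues of \<open>S\<close> and \<open>D\<close> together outnumber \<open>M\<close>. If
  \<open>M <= l\<close>, at most \<open>l + 1 - M\<close> elements of \<open>D\<close> are cut off,
  and \<open>s\<close> suffices. Otherwise \<open>dense_sumset_interval\<close> fills the middle of
  \<open>D + S\<close>; this gives the weaker bound \<open>M <= |S| + |D| - 3\<close>, which is
  enough for the pigeonhole.\<close>

lemma dense_sumset_length:
  fixes D S :: "int set"
  assumes D: "D \<subseteq> {0..l}" "0 \<in> D" "l \<in> D" and S: "S \<subseteq> {0..M}" "0 \<in> S" "M \<in> S"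
    and N: "int (card (D + S)) \<le> int (card D) + int (card S) + r"
    and h: "l + 1 + r + 3 \<le> 2 * int (card D)"
    and s: "int (card S) + int (card D) \<ge> l + 3"
  shows "M \<le> int (card S) + r"
proof -
  have l: "l \<ge> 0" and ne: "D \<noteq> {}" using D by auto
  have fin: "finite D" "finite S" using D S finite_subset by blast+
  have dl: "int (card D) \<le> l + 1" using card_mono[OF _ D(1)] l by auto
  have M: "M > 0"
  proof (rule ccontr)
    assume "\<not> ?thesis"
    then have "S \<subseteq> {0}" using S by auto
    then have "card S \<le> 1" using card_mono[of "{0::int}" S] by simp
    with s dl show False by linarith
  qed
  have key: "M + int (card D) \<le> int (card (S + D))"
    if "int (card (residues_of M S)) + int (card (residues_of M D)) > M"
    using that M fin S by (intro card_plus_ge_short) auto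
  have rS: "int (card (residues_of M S)) = int (card S) - 1"
    using card_residues_of_interval[OF M S] .
  have comm: "S + D = D + S" by (rule add.commute)
  show ?thesis
  proof (cases "M \<le> l")
    case True
    have "D = (D \<inter> {0..<M}) \<union> (D \<inter> {M..l})" using D by auto
    then have "card D = card ((D \<inter> {0..<M}) \<union> (D \<inter> {M..l}))" by simp
    also have "\<dots> \<le> card (D \<inter> {0..<M}) + card (D \<inter> {M..l})" by (rule card_Un_le)
    also have "card (D \<inter> {M..l}) \<le> card {M..l}" by (intro card_mono) auto
    finally have "int (card D) \<le> int (card (D \<inter> {0..<M})) + (l + 1 - M)" using True by simp
    moreover have "card (D \<inter> {0..<M}) = card (residues_of M (D \<inter> {0..<M}))"
      using card_residues_of_small[of "D \<inter> {0..<M}" 0 M] by simp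
    moreover have "card (residues_of M (D \<inter> {0..<M})) \<le> card (residues_of M D)"
      using fin by (intro card_mono image_mono) auto
    ultimately have "int (card (residues_of M S)) + int (card (residues_of M D)) > M"
      using rS s by linarith
    then have "M + int (card D) \<le> int (card (D + S))" using key comm by simp
    then show ?thesis using N by linarith
  next
    case False
    have sub: "D \<union> {l+1..M-1} \<union> (+) M ` D \<subseteq> D + S"
    proof -
      have "D \<subseteq> D + S" using set_plus_memI[of _ D 0 S] S by auto
      moreover have "(+) M ` D \<subseteq> D + S" using set_plus_memI[of _ D M S] S by (auto simp: add.commute)
      moreover have "{l+1..M-1} \<subseteq> D + S"
        using dense_sumset_interval[OF D(1,2) fin(2) S(2,3) N h] by auto
      ultimately show ?thesis by auto
    qed
    have d1: "card (D \<union> {l+1..M-1} \<union> (+) M ` D) = card (D \<union> {l+1..M-1}) + card ((+) M ` D)"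
    proof (intro card_Un_disjoint)
      have "x < M" if "x \<in> D \<union> {l+1..M-1}" for x using that D(1) False by force
      moreover have "M \<le> x" if "x \<in> (+) M ` D" for x using that D(1) by force
      ultimately show "(D \<union> {l+1..M-1}) \<inter> (+) M ` D = {}" by force
    qed (use fin in auto)
    have d2: "card (D \<union> {l+1..M-1}) = card D + card {l+1..M-1}"
      using fin D(1) by (intro card_Un_disjoint) force+
    have "card (D \<union> {l+1..M-1} \<union> (+) M ` D) \<le> card (D + S)"
      using sub fin by (intro card_mono finite_set_plus) auto
    then have "2 * int (card D) + (M - 1 - l) \<le> int (card (D + S))"
      using d1 d2 False by simp
    then have Ms: "M \<le> int (card S) + int (card D) - 3" using N h by linarith
    have "card (residues_of M D) = card D"
      using D(1) False by (intro card_residues_of_small[where a = 0]) force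
    then have "M + int (card D) \<le> int (card (D + S))" using key comm rS Ms by simp
    then show ?thesis using N by linarith
  qed
qed

text \<open>If the class of \<open>\<rho>\<close> is missed, \<open>S\<close> must avoid all points
  congruent to some \<open>\<rho> - d\<close> with \<open>d\<close> in \<open>D\<close>. These form
  \<open>|D| - 1\<close> classes modulo \<open>l\<close>, and each of \<open>q\<close> disjoint
  blocks of length \<open>l\<close> contains one point of each class.\<close>

lemma full_residues_of_few_holes:
  fixes D S :: "int set" and q :: nat
  assumes D: "D \<subseteq> {0..l}" "0 \<in> D" "l \<in> D" and l: "l > 0"
    and S: "S \<subseteq> {b..<b + len}" and q: "int q * l \<le> len"
    and holes: "len - int (card S) < (int (card D) - 1) * int q"
  shows "{0..<l} \<subseteq> residues_of l (D + S)"
proof (rule ccontr)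
  assume "\<not> ?thesis"
  then obtain \<rho> where \<rho>: "\<rho> \<in> {0..<l}" "\<rho> \<notin> residues_of l (D + S)" by blast
  define \<Omega> where "\<Omega> = (\<lambda>x. (\<rho> - b - x) mod l) ` residues_of l D"
  have inj: "inj_on (\<lambda>x. (\<rho> - b - x) mod l) (residues_of l D)"
  proof (rule inj_onI)
    fix x y assume xy: "x \<in> residues_of l D" "y \<in> residues_of l D" "(\<rho> - b - x) mod l = (\<rho> - b - y) mod l"
    then have "l dvd (\<rho> - b - y) - (\<rho> - b - x)" using mod_eq_dvd_iff by metis
    then have "l dvd x - y" by simp
    then have "x mod l = y mod l" by (simp add: mod_eq_dvd_iff)
    then show "x = y" using xy l by auto
  qed
  have c\<Omega>: "int (card \<Omega>) = int (card D) - 1"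
    unfolding \<Omega>_def card_image[OF inj] using card_residues_of_interval[OF l D] .
  have \<Omega>l: "\<Omega> \<subseteq> {0..<l}" using l by (auto simp: \<Omega>_def)
  let ?f = "\<lambda>(i, \<omega>). b + int i * l + \<omega>"
  have injf: "inj_on ?f ({..<q} \<times> \<Omega>)"
  proof (rule inj_onI, clarsimp)
    fix i \<omega> j \<omega>' assume a: "\<omega> \<in> \<Omega>" "\<omega>' \<in> \<Omega>" "int i * l + \<omega> = int j * l + \<omega>'"
    then have "\<omega> mod l = \<omega>' mod l" by (metis mod_mult_self3)
    then have "\<omega> = \<omega>'" using a \<Omega>l l by (metis atLeastLessThan_iff mod_pos_pos_trivial subsetD)
    then show "i = j \<and> \<omega> = \<omega>'" using a l by simp
  qed
  have sub: "?f ` ({..<q} \<times> \<Omega>) \<subseteq> {b..<b+len} - S"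
  proof
    fix x assume "x \<in> ?f ` ({..<q} \<times> \<Omega>)"
    then obtain i \<omega> where x: "i < q" "\<omega> \<in> \<Omega>" "x = b + int i * l + \<omega>" by auto
    have \<omega>: "0 \<le> \<omega>" "\<omega> < l" using x \<Omega>l by auto
    have "int i * l + l \<le> int q * l"
    proof -
      have "int i + 1 \<le> int q" using x(1) by simp
      then have "(int i + 1) * l \<le> int q * l" using l by (intro mult_right_mono) auto
      then show ?thesis by (simp add: algebra_simps)
    qed
    then have "x < b + len" using x \<omega> q by linarith
    moreover have "0 \<le> int i * l" using l by simp
    then have "b \<le> x" using x \<omega> by linarith
    moreover have "x \<notin> S"
    proof
      assume "x \<in> S"
      obtain d where d: "d \<in> D" "\<omega> = (\<rho> - b - d mod l) mod l" using x by (auto simp: \<Omega>_def)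
      have "\<omega> = (\<rho> - b - d) mod l" using d by (simp add: mod_diff_right_eq)
      then have "\<omega> mod l = (\<rho> - b - d) mod l" by simp
      then have "l dvd \<omega> - (\<rho> - b - d)" by (simp add: mod_eq_dvd_iff)
      then have "l dvd (\<omega> - (\<rho> - b - d)) + int i * l" by simp
      then have "l dvd (d + x) - \<rho>" using x by (simp add: algebra_simps)
      then have "(d + x) mod l = \<rho> mod l" by (simp add: mod_eq_dvd_iff)
      then have "(d + x) mod l = \<rho>" using \<rho> by simp
      moreover have "d + x \<in> D + S" using d \<open>x \<in> S\<close> by (intro set_plus_memI)
      ultimately show False using \<rho> by blast
    qed
    ultimately show "x \<in> {b..<b+len} - S" by simp
  qed
  have fS: "finite S" using S finite_subset by blast
  have "q * card \<Omega> = card (?f ` ({..<q} \<times> \<Omega>))" using injf by (simp add: card_image card_cartesian_product)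
  also have "\<dots> \<le> card ({b..<b+len} - S)" using sub by (intro card_mono) auto
  also have "\<dots> = card {b..<b+len} - card S" using S fS by (simp add: card_Diff_subset)
  finally have "q * card \<Omega> \<le> nat len - card S" by simp
  moreover have "card S \<le> nat len" using card_mono[OF _ S] by simp
  moreover have "len \<ge> 0" using q l by (metis mult_nonneg_nonneg of_nat_0_le_iff order_less_imp_le order_trans)
  ultimately have "int (q * card \<Omega>) \<le> len - int (card S)" by linarith
  then have "int q * (int (card D) - 1) \<le> len - int (card S)" using c\<Omega> by simp
  then show False using holes by (simp add: mult.commute)
qed

text \<open>The scheme of \<open>dense_sumset_interval\<close> with a condition on the holes of
  \<open>S\<close> in place of the density of \<open>D\<close>. On one side of the window before a
  missing \<open>t\<close> there is room for \<open>q\<close> blocks of length \<open>l\<close>, so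
  on that side all classes modulo \<open>l\<close> are hit and \<open>l\<close> is gained instead of
  \<open>|D| - 1\<close>. With the loss of at most \<open>l + 1 - |D|\<close> in the window this
  makes \<open>|S| + 2 |D| - 2\<close> elements, one more than allowed.\<close>

lemma sumset_interval_of_few_holes:
  fixes D S :: "int set" and q :: nat
  assumes D: "D \<subseteq> {0..l}" "0 \<in> D" "l \<in> D" and l: "l > 0"
    and S: "S \<subseteq> {0..M}" "0 \<in> S" "M \<in> S"
    and N: "int (card (D + S)) \<le> int (card S) + 2 * int (card D) - 3"
    and q: "2 * (int q * l) \<le> M - l"
    and holes: "M + 1 - int (card S) < (int (card D) - 1) * int q"
    and t: "l + 1 \<le> t" "t \<le> M - 1"
  shows "t \<in> D + S"
proof (rule ccontr)
  assume nt: "t \<notin> D + S"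
  have ne: "D \<noteq> {}" using D by auto
  have fin: "finite D" "finite S" using D S finite_subset by blast+
  let ?A = "{s \<in> S. s < t - l}" and ?B = "{s \<in> S. s > t}"
  have mem: "0 \<in> ?A" "M \<in> ?B" using S t by auto
  have finAB: "finite ?A" "finite ?B" using fin by auto
  have ge: "card D + card ?A \<le> card (D + ?A) + 1" "card D + card ?B \<le> card (D + ?B) + 1"
    using fin ne mem by (intro card_plus_ge_int; auto)+
  have spl: "int (card S) = int (card ?A) + int (card (S \<inter> {t-l..t})) + int (card ?B)"
    using card_split3[OF fin(2), of "t - l" t] l by simp
  have w: "int (card (S \<inter> {t-l..t})) \<le> l + 1"
    using card_mono[of "{t-l..t}" "S \<inter> {t-l..t}"] l by simp
  have cA: "int (card ?A) \<le> t - l"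
    using card_mono[of "{0..<t-l}" ?A] S t by fastforce
  have cB: "int (card ?B) \<le> M - t"
    using card_mono[of "{t+1..M}" ?B] S t by fastforce
  note mis = card_plus_ge_missing[OF D(1) ne order_less_imp_le[OF l] fin(2) nt]
  have "int q * l \<le> t - l \<or> int q * l \<le> M - t" using q by linarith
  then show False
  proof
    assume "int q * l \<le> t - l"
    then have "{0..<l} \<subseteq> residues_of l (D + ?A)"
      using S spl w cB holes by (intro full_residues_of_few_holes[OF D l, of _ 0 "t - l" q]) auto
    then have "l + int (card ?A) \<le> int (card (D + ?A))"
      using l fin finAB D by (intro card_plus_ge_full_residues) auto
    then show False using mis ge(2) N by linarith
  next
    assume "int q * l \<le> M - t"
    then have "{0..<l} \<subseteq> residues_of l (D + ?B)"
      using S spl w cA holes by (intro full_residues_of_few_holes[OF D l, of _ "t + 1" "M - t" q]) auto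
    then have "l + int (card ?B) \<le> int (card (D + ?B))"
      using l fin finAB D by (intro card_plus_ge_full_residues) auto
    then show False using mis ge(1) N by linarith
  qed
qed

lemma full_residues_of_interval:
  assumes "l > 0" "{b..<b+l} \<subseteq> C"
  shows "{0..<l} \<subseteq> residues_of l C"
proof
  fix x assume x: "x \<in> {0..<l}"
  let ?y = "b + (x - b) mod l"
  have "?y \<in> C" using assms by (auto intro!: subsetD[OF assms(2)])
  moreover have "?y mod l = x" using x by (simp add: mod_add_right_eq)
  ultimately show "x \<in> residues_of l C" by (metis image_eqI)
qed

text \<open>The bound for \<open>l\<close> is a count modulo \<open>l\<close>, where the interval
  hits every class. For the other bound let \<open>E\<close> be the classes modulo \<open>M\<close>
  missed by \<open>D + S\<close>; then \<open>E - D\<close> is disjoint from \<open>S\<close> modulo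
  \<open>M\<close>. A nonempty \<open>E\<close> would make \<open>E - D\<close> at least as large as
  \<open>|E| + |D| - 1\<close>, too much beside \<open>S\<close> when
  \<open>|D| >= r + 3\<close>.\<close>

lemma tight_lengths:
  fixes D S :: "int set"
  assumes D: "D \<subseteq> {0..l}" "0 \<in> D" "l \<in> D" and l: "l > 0"
    and S: "S \<subseteq> {0..M}" "0 \<in> S" "M \<in> S"
    and N: "int (card (D + S)) \<le> int (card D) + int (card S) + r"
    and r: "r + 3 \<le> int (card D)"
    and M: "2 * l + 2 \<le> M"
    and int: "{l+1..M-1} \<subseteq> D + S"
  shows "M \<le> int (card S) + r" "l \<le> int (card D) + r"
proof -
  have fin: "finite D" "finite S" using D S finite_subset by blast+
  have M0: "M > 0" using M l by simp
  have "{0..<l} \<subseteq> residues_of l (D + S)"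
  proof (rule full_residues_of_interval[where b = "l + 1", OF l])
    show "{l+1..<l+1+l} \<subseteq> D + S" using int M by (auto intro!: subsetD[OF int])
  qed
  then have "l + int (card S) \<le> int (card (D + S))"
    using l fin D by (intro card_plus_ge_full_residues) auto
  then show "l \<le> int (card D) + r" using N by linarith
  define E where "E = {0..<M} - residues_of M (D + S)"
  have E: "E \<subseteq> {0..l}"
  proof
    fix e assume e: "e \<in> E"
    show "e \<in> {0..l}"
    proof (rule ccontr)
      assume "e \<notin> {0..l}"
      then have "e \<in> D + S" "e mod M = e" using e int by (auto simp: E_def)
      then have "e \<in> residues_of M (D + S)" by (metis image_eqI)
      with e show False by (simp add: E_def)
    qed
  qed
  have card_res: "int (card (residues_of M (D + S))) = M - int (card E)"
  proof -
    have sub: "residues_of M (D + S) \<subseteq> {0..<M}" using M0 by auto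
    have "card E = card {0..<M} - card (residues_of M (D + S))"
      unfolding E_def using sub fin by (intro card_Diff_subset) (auto intro: finite_set_plus)
    moreover have "card (residues_of M (D + S)) \<le> card {0..<M}" using sub by (intro card_mono) auto
    ultimately show ?thesis using M0 by simp
  qed
  have "card (residues_of M (D + S)) + card D \<le> card (D + S)"
  proof (intro card_residues_shift finite_set_plus)
    show "D \<subseteq> D + S" using set_plus_memI[of _ D 0 S] S by auto
    show "(+) M ` D \<subseteq> D + S" using set_plus_memI[of _ D M S] S by (auto simp: add.commute)
  qed (use fin M0 in auto)
  then have NE: "M - int (card E) \<le> int (card S) + r" using N card_res by linarith
  have "E = {}"
  proof (rule ccontr)
    assume ne: "E \<noteq> {}"
    let ?F = "E + uminus ` D"
    have "card E + card (uminus ` D) \<le> card ?F + 1"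
      using E fin D ne finite_subset[OF E] by (intro card_plus_ge_int) auto
    moreover have "card (uminus ` D) = card D" by (intro card_image) (auto simp: inj_on_def)
    \<comment> \<open>Both \<open>E\<close> and \<open>D\<close> lie in \<open>{0..l}\<close>; their
      differences lie among \<open>2 l + 1\<close> consecutive integers, which are distinct modulo
      \<open>M\<close> by \<open>2 * l + 2 <= M\<close>.\<close>
    moreover have "card (residues_of M ?F) = card ?F"
    proof (rule card_residues_of_small[where a = "-l"], rule subsetI)
      fix x assume "x \<in> ?F"
      then obtain e d where "e \<in> E" "d \<in> D" "x = e - d" by (auto elim: set_plus_memE)
      moreover have "0 \<le> e" "e \<le> l" "0 \<le> d" "d \<le> l" using \<open>e \<in> E\<close> \<open>d \<in> D\<close> E D by auto
      ultimately show "x \<in> {-l..<-l+M}" using M l by auto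
    qed
    moreover have "residues_of M ?F \<inter> residues_of M S = {}"
    proof (rule ccontr)
      assume "\<not> ?thesis"
      then obtain x s where "x \<in> ?F" "s \<in> S" "x mod M = s mod M" by auto
      then obtain e d where ed: "e \<in> E" "d \<in> D" "(e - d) mod M = s mod M" by (auto elim: set_plus_memE)
      then have "M dvd (d + s) - e" using mod_eq_dvd_iff[of s M "e - d"] by (simp add: algebra_simps)
      then have "(d + s) mod M = e mod M" by (simp add: mod_eq_dvd_iff)
      moreover have "e mod M = e" using ed by (simp add: E_def)
      moreover have "d + s \<in> D + S" using ed \<open>s \<in> S\<close> by (intro set_plus_memI)
      ultimately have "e \<in> residues_of M (D + S)" by (metis image_eqI)
      then show False using ed by (simp add: E_def)
    qed
    then have "card (residues_of M ?F) + card (residues_of M S) = card (residues_of M ?F \<union> residues_of M S)"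
      using fin finite_subset[OF E] by (intro card_Un_disjoint[symmetric]) (auto intro: finite_set_plus)
    moreover have "\<dots> \<le> card {0..<M}" using M0 by (intro card_mono) auto
    moreover have "int (card (residues_of M S)) = int (card S) - 1"
      using card_residues_of_interval[OF M0 S] .
    ultimately show False using NE r M0 by simp
  qed
  then show "M \<le> int (card S) + r" using NE by simp
qed

section \<open>Holes, gaps and intervals in integer sumsets\<close>

lemma missing_prefix:
  fixes P Q :: "int set"
  assumes "t \<notin> P + Q" "0 \<le> n"
  shows "n \<le> int (card ({u..<u+n} - P)) + int (card ({t-u-n<..t-u} - Q))"
proof -
  \<comment> \<open>For every \<open>i\<close> one of the two is a hole: \<open>i\<close> in
    \<open>P\<close> or \<open>t - i\<close> in \<open>Q\<close>. Reflecting the holes of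
    \<open>Q\<close> puts all of them into one window of length \<open>n\<close>.\<close>
  have "{u..<u+n} \<subseteq> ({u..<u+n} - P) \<union> (\<lambda>x. t - x) ` ({t-u-n<..t-u} - Q)"
  proof
    fix i assume i: "i \<in> {u..<u+n}"
    have "i \<notin> P \<or> t - i \<notin> Q" using assms(1) set_plus_memI[of i P "t - i" Q] by auto
    then show "i \<in> ({u..<u+n} - P) \<union> (\<lambda>x. t - x) ` ({t-u-n<..t-u} - Q)"
    proof
      assume "t - i \<notin> Q"
      then have "t - i \<in> {t-u-n<..t-u} - Q" using i by auto
      then have "t - (t - i) \<in> (\<lambda>x. t - x) ` ({t-u-n<..t-u} - Q)" by (rule imageI)
      then show ?thesis by simp
    qed (use i in auto)
  qed
  then have "card {u..<u+n} \<le> card (({u..<u+n} - P) \<union> (\<lambda>x. t - x) ` ({t-u-n<..t-u} - Q))"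
    by (intro card_mono) auto
  also have "\<dots> \<le> card ({u..<u+n} - P) + card ((\<lambda>x. t - x) ` ({t-u-n<..t-u} - Q))"
    by (rule card_Un_le)
  also have "card ((\<lambda>x. t - x) ` ({t-u-n<..t-u} - Q)) \<le> card ({t-u-n<..t-u} - Q)"
    by (rule card_image_le) auto
  finally show ?thesis using assms(2) by simp
qed

lemma card_holes:
  assumes "P \<subseteq> {0..a}" "(a::int) \<ge> 0"
  shows "int (card ({0..a} - P)) = a + 1 - int (card P)"
proof -
  have "finite P" using assms finite_subset by blast
  then have "card ({0..a} - P) = card {0..a} - card P" using assms by (intro card_Diff_subset) auto
  moreover have "card P \<le> card {0..a}" using assms by (intro card_mono) auto
  ultimately show ?thesis using assms by simp
qed

lemma card_Un_le_holes:
  fixes X Y Z :: "int set"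
  assumes "X \<inter> Y = {}" "X \<union> Y \<subseteq> Z" "finite Z"
  shows "int (card (X - P)) + int (card (Y - P)) \<le> int (card (Z - P))"
proof -
  have "card (X - P) + card (Y - P) = card ((X - P) \<union> (Y - P))"
    using assms by (intro card_Un_disjoint[symmetric]) (auto intro: finite_subset)
  also have "\<dots> \<le> card (Z - P)" using assms by (intro card_mono) auto
  finally show ?thesis by simp
qed

text \<open>A missing sum \<open>t\<close> near the left end forces \<open>t + 1\<close> holes among
  the first \<open>t + 1\<close> places of \<open>P\<close> and \<open>Q\<close>; near the right end
  the last places suffer. The conditions \<open>c\<close> keep these stretches apart, so each hole
  is charged once and the two spoiled ends have total length at most \<open>hP + hQ\<close>. Between
  them at least \<open>|P| + |Q| - 1\<close> consecutive sums remain.\<close>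

lemma sumset_contains_interval:
  fixes P Q :: "int set"
  assumes P: "P \<subseteq> {0..a}" and Q: "Q \<subseteq> {0..b}" and ab: "0 \<le> a" "a \<le> b"
    and h: "hP = a + 1 - int (card P)" "hQ = b + 1 - int (card Q)"
    and c: "hP + hQ \<le> a" "2 * hP + hQ \<le> a + 1" "2 * (hP + hQ) \<le> b + 1"
  shows "\<exists>t. {t..t + int (card P) + int (card Q) - 2} \<subseteq> P + Q"
proof -
  have hP: "int (card ({0..a} - P)) = hP" using card_holes[OF P] ab h by simp
  have hQ: "int (card ({0..b} - Q)) = hQ" using card_holes[OF Q] ab h by simp
  \<comment> \<open>The element \<open>-1\<close> is the default for an end without missing sums:
    its stretch has length \<open>t1 + 1 = 0\<close>.\<close>
  define L where "L = {-1} \<union> {t \<in> {0..a}. t \<notin> P + Q}"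
  define R where "R = {-1} \<union> {t \<in> {0..a}. a + b - t \<notin> P + Q}"
  define t1 where "t1 = Max L"
  define t2 where "t2 = Max R"
  have "finite {t \<in> {0..a}. t \<notin> P + Q}" "finite {t \<in> {0..a}. a + b - t \<notin> P + Q}"
    by (rule finite_subset[of _ "{0..a}"]; auto)+
  then have finL: "finite L" "finite R" by (simp_all add: L_def R_def)
  have t1: "t1 \<in> L" and t2: "t2 \<in> R" using finL Max_in[of L] Max_in[of R] by (auto simp: t1_def t2_def L_def R_def)
  have t1a: "-1 \<le> t1" "t1 \<le> a" "-1 \<le> t2" "t2 \<le> a" using t1 t2 ab by (auto simp: L_def R_def)
  have s1: "t1 + 1 \<le> int (card ({0..<t1+1} - P)) + int (card ({-1<..t1} - Q))"
  proof (cases "t1 = -1")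
    case False
    then show ?thesis using t1 missing_prefix[of t1 P Q "t1 + 1" 0] by (auto simp: L_def)
  qed simp
  have s2: "t2 + 1 \<le> int (card ({a-t2..<a+1} - P)) + int (card ({b-t2-1<..b} - Q))"
  proof (cases "t2 = -1")
    case False
    then show ?thesis using t2 missing_prefix[of "a+b-t2" P Q "t2 + 1" "a-t2"] by (auto simp: R_def algebra_simps)
  qed simp
  have sub: "int (card (X - P)) \<le> hP" if "X \<subseteq> {0..a}" for X
    unfolding hP[symmetric] using that by (intro of_nat_mono card_mono) auto
  have subQ: "int (card (X - Q)) \<le> hQ" if "X \<subseteq> {0..b}" for X
    unfolding hQ[symmetric] using that by (intro of_nat_mono card_mono) auto
  have b1: "t1 + 1 \<le> hP + hQ" using s1 sub[of "{0..<t1+1}"] subQ[of "{-1<..t1}"] t1a ab by force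
  have b2: "t2 + 1 \<le> hP + hQ" using s2 sub[of "{a-t2..<a+1}"] subQ[of "{b-t2-1<..b}"] t1a ab by force
  \<comment> \<open>The stretches in the longer interval of \<open>Q\<close> are separated first.
    Then the holes of \<open>Q\<close> count only once in the estimate that separates the stretches
    of \<open>P\<close>.\<close>
  have lt: "t1 + t2 < b" using b1 b2 c(3) by (simp add: algebra_simps)
  have Q2: "int (card ({-1<..t1} - Q)) + int (card ({b-t2-1<..b} - Q)) \<le> hQ"
    unfolding hQ[symmetric] using lt t1a ab by (intro card_Un_le_holes) auto
  have lt': "t1 + t2 < a"
    using s1 s2 Q2 sub[of "{0..<t1+1}"] sub[of "{a-t2..<a+1}"] t1a ab c by force
  have P2: "int (card ({0..<t1+1} - P)) + int (card ({a-t2..<a+1} - P)) \<le> hP"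
    unfolding hP[symmetric] using lt' t1a ab by (intro card_Un_le_holes) auto
  have fin: "t1 + t2 + 2 \<le> hP + hQ" using s1 s2 P2 Q2 by linarith
  have "t \<in> P + Q" if t: "t1 + 1 \<le> t" "t \<le> a + b - t2 - 1" for t
  proof (rule ccontr)
    assume nt: "t \<notin> P + Q"
    consider "t \<le> a" | "a < t" "t < b" | "b \<le> t" by linarith
    then show False
    proof cases
      case 1
      then have "t \<in> L" using nt t t1a by (auto simp: L_def)
      then have "t \<le> t1" using finL by (simp add: t1_def)
      then show False using t by simp
    next
      case 2
      have "a + 1 \<le> int (card ({0..<a+1} - P)) + int (card ({t-a-1<..t} - Q))"
        using missing_prefix[OF nt, of "a+1" 0] ab by (simp add: algebra_simps)
      moreover have "int (card ({0..<a+1} - P)) \<le> hP" by (intro sub) auto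
      moreover have "int (card ({t-a-1<..t} - Q)) \<le> hQ" using 2 by (intro subQ) auto
      ultimately show False using c by linarith
    next
      case 3
      then have "a + b - t \<in> R" using nt t t1a by (auto simp: R_def)
      then have "a + b - t \<le> t2" using finL by (simp add: t2_def)
      then show False using t by simp
    qed
  qed
  then have "{t1+1..t1+1 + int (card P) + int (card Q) - 2} \<subseteq> P + Q"
    using fin h by auto
  then show ?thesis by blast
qed

text \<open>By pigeonhole \<open>B + B\<close> meets every class modulo \<open>m\<close>, with
  representatives in \<open>{0..2 * m}\<close>. Adding \<open>0\<close> or \<open>m\<close> from the
  third summand moves a representative to the required point of \<open>{m..2 * m}\<close>.\<close>

lemma triple_sumset_interval:
  fixes B :: "int set"
  assumes B: "B \<subseteq> {0..m}" "0 \<in> B" "m \<in> B" and m: "m > 0" and big: "2 * (int (card B) - 1) > m"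
  shows "{m..2*m} \<subseteq> B + (B + B)"
proof
  fix t assume t: "t \<in> {m..2*m}"
  have fin: "finite B" using B finite_subset by blast
  have full: "residues_of m (B + B) = {0..<m}"
    using card_residues_of_interval[OF m B] big fin m by (intro residues_of_plus_UNIV) auto
  show "t \<in> B + (B + B)"
  proof (cases "t = m \<or> t = 2*m")
    case True
    then show ?thesis
    proof
      assume "t = m"
      then have "t = m + (0 + 0)" by simp
      then show ?thesis using B by (metis set_plus_memI)
    next
      assume "t = 2*m"
      then have "t = m + (m + 0)" by simp
      then show ?thesis using B by (metis set_plus_memI)
    qed
  next
    case False
    define \<rho> where "\<rho> = t - m"
    have \<rho>: "0 < \<rho>" "\<rho> < m" using t False by (auto simp: \<rho>_def)
    then obtain c where c: "c \<in> B + B" "c mod m = \<rho>" using full by (metis atLeastLessThan_iff imageE less_imp_le)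
    then obtain x y where xy: "x \<in> B" "y \<in> B" "c = x + y" by (metis set_plus_memE)
    have "x \<in> {0..m}" "y \<in> {0..m}" using xy B by auto
    then have cr: "0 \<le> c" "c \<le> 2*m" using xy by auto
    define k where "k = c div m"
    have ck: "c = k*m + \<rho>" using c by (simp add: k_def flip: c(2))
    have "k = 0 \<or> k = 1"
    proof -
      have "k \<ge> 0" using cr m by (simp add: k_def pos_imp_zdiv_nonneg_iff)
      moreover have "k < 2"
      proof (rule ccontr)
        assume "\<not> k < 2"
        then have "2 * m \<le> k * m" using m by simp
        then show False using ck cr \<rho> by linarith
      qed
      ultimately show ?thesis by linarith
    qed
    then show ?thesis
    proof
      assume "k = 0"
      then have "t = m + c" using ck \<rho>_def by simp
      then show ?thesis using B c by (metis set_plus_memI)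
    next
      assume "k = 1"
      then have "t = 0 + c" using ck \<rho>_def by simp
      then show ?thesis using B c by (metis set_plus_memI)
    qed
  qed
qed

text \<open>A window of length \<open>k >= l\<close> free of \<open>S\<close> separates
  \<open>D + S\<close> into two disjoint parts. Each gains \<open>|D| - 1\<close>, which makes at
  least \<open>|S| + 2 |D| - 2\<close> elements.\<close>

lemma no_long_gap:
  fixes D S :: "int set"
  assumes D: "D \<subseteq> {0..l}" "0 \<in> D" and S: "S \<subseteq> {0..M}" "0 \<in> S" "M \<in> S"
    and N: "int (card (D + S)) \<le> int (card S) + 2 * int (card D) - 3"
    and t: "l \<le> k" "0 \<le> t" "t \<le> M + k"
  shows "\<exists>s\<in>S. t - k \<le> s \<and> s \<le> t"
proof (rule ccontr)
  assume no: "\<not> ?thesis"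
  have fin: "finite D" "finite S" using D S finite_subset by blast+
  let ?A = "{s \<in> S. s < t - k}" and ?B = "{s \<in> S. s > t}"
  have mem: "0 \<in> ?A" "M \<in> ?B" using no S t by force+
  have "card D + card ?A \<le> card (D + ?A) + 1" "card D + card ?B \<le> card (D + ?B) + 1"
    using fin D mem by (intro card_plus_ge_int; auto)+
  moreover have "card (D + ?A) + card (D + ?B) \<le> card (D + S)"
    using fin D t by (intro card_plus_ge_separated[of D l _ _ S t]) auto
  moreover have "card S = card ?A + card ?B"
  proof -
    have "S = ?A \<union> ?B" using no by force
    then have "card S = card (?A \<union> ?B)" by simp
    also have "\<dots> = card ?A + card ?B" using fin t D by (intro card_Un_disjoint) auto
    finally show ?thesis .
  qed
  ultimately show False using N by linarith
qed

text \<open>Uncrossing, as for Hamidoune's atoms: \<open>|N X| - |X|\<close> is submodular, so the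
  intersection and the union of two minimisers cannot both be worse than they are. \<open>V\<close>
  is a minimiser of least size. The hypothesis \<open>dual\<close>, which is complementation in the
  applications, keeps \<open>V\<close> small enough for the union to stay admissible.\<close>

lemma submodular_atom:
  fixes G :: "'a set" and N :: "'a set \<Rightarrow> 'a set" and k :: nat
  defines "F \<equiv> \<lambda>X. X \<subseteq> G \<and> k \<le> card X \<and> card (N X) + k \<le> card G"
  assumes G: "finite G" and k: "k \<ge> 1"
    and NG: "\<And>X. X \<subseteq> G \<Longrightarrow> N X \<subseteq> G"
    and NU: "\<And>X Y. X \<subseteq> G \<Longrightarrow> Y \<subseteq> G \<Longrightarrow> N (X \<union> Y) = N X \<union> N Y"
    and dual: "\<And>X. F X \<Longrightarrow> \<exists>X'. X' \<subseteq> G \<and> card X' = card G - card (N X) \<and> card (N X') + card X \<le> card G"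
    and X0: "F X0"
  obtains V where "F V"
    and "\<And>X. F X \<Longrightarrow> card (N V) + card X \<le> card (N X) + card V"
    and "\<And>W. F W \<Longrightarrow> card W = card V \<Longrightarrow> card (N W) = card (N V) \<Longrightarrow> k \<le> card (V \<inter> W) \<Longrightarrow> W = V"
proof -
  define g where "g = (\<lambda>X. int (card (N X)) - int (card X))"
  have fin: "finite X" "finite (N X)" if "X \<subseteq> G" for X
    using that NG G finite_subset by blast+
  have finF: "finite {X. F X}" using G by (auto simp: F_def intro: finite_subset[of _ "Pow G"])
  define \<kappa> where "\<kappa> = Min (g ` {X. F X})"
  have \<kappa>: "\<kappa> \<le> g X" if "F X" for X using that finF by (auto simp: \<kappa>_def)
  have "\<kappa> \<in> g ` {X. F X}" unfolding \<kappa>_def using finF X0 by (intro Min_in) auto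
  then obtain X1 where X1: "F X1" "g X1 = \<kappa>" by auto
  obtain V where V: "F V" "g V = \<kappa>" and Vmin: "\<And>X. F X \<Longrightarrow> g X = \<kappa> \<Longrightarrow> card V \<le> card X"
    using ex_has_least_nat[of "\<lambda>X. F X \<and> g X = \<kappa>" X1 card] X1 by blast
  have VG: "V \<subseteq> G" using V by (simp add: F_def)
  \<comment> \<open>The dual of \<open>V\<close> is a minimiser too, so \<open>V\<close> has at most
    as many elements as its dual, that is \<open>|G| - |N V|\<close>.\<close>
  have half: "2 * int (card V) + \<kappa> \<le> int (card G)"
  proof -
    obtain V' where V': "V' \<subseteq> G" "card V' = card G - card (N V)" "card (N V') + card V \<le> card G"
      using dual[OF V(1)] by blast
    have "card (N V) + k \<le> card G" "k \<le> card V" using V(1) by (auto simp: F_def)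
    then have FV': "F V'" using V' by (simp add: F_def)
    moreover have "g V' \<le> \<kappa>" using V' V(2) \<open>card (N V) + k \<le> card G\<close> by (simp add: g_def)
    ultimately have "g V' = \<kappa>" using \<kappa> by force
    then have "card V \<le> card V'" using Vmin FV' by blast
    then show ?thesis using V' V(2) \<open>card (N V) + k \<le> card G\<close> by (simp add: g_def)
  qed
  show ?thesis
  proof (rule that[OF V(1)])
    fix X assume "F X"
    then show "card (N V) + card X \<le> card (N X) + card V" using \<kappa>[of X] V(2) by (simp add: g_def)
  next
    fix W assume W: "F W" "card W = card V" "card (N W) = card (N V)" "k \<le> card (V \<inter> W)"
    have WG: "W \<subseteq> G" using W by (simp add: F_def)
    have IG: "V \<inter> W \<subseteq> G" using VG by auto
    show "W = V"
    proof (rule ccontr)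
      assume "W \<noteq> V"
      then have "V \<inter> W \<noteq> V" using W(2) fin(1)[OF WG] by (metis Int_lower2 card_subset_eq)
      then have lt: "card (V \<inter> W) < card V" using fin(1)[OF VG] by (intro psubset_card_mono) auto
      have NI: "N (V \<inter> W) \<subseteq> N V \<inter> N W"
      proof -
        have "N V = N ((V \<inter> W) \<union> V)" by (simp add: Un_absorb1)
        moreover have "N W = N ((V \<inter> W) \<union> W)" by (simp add: Un_absorb1)
        ultimately show ?thesis using NU[OF IG VG] NU[OF IG WG] by auto
      qed
      have "card (N (V \<inter> W)) \<le> card (N V)" using NI fin(2)[OF VG] by (intro card_mono) auto
      then have FI: "F (V \<inter> W)" using V(1) W IG by (simp add: F_def)
      \<comment> \<open>The intersection is admissible and smaller than the least minimiser, so its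
        difference is strictly above the minimum. By submodularity the union would then lie strictly
        below the minimum or be inadmissible; \<open>half\<close> excludes the latter.\<close>
      have gI: "\<kappa> < g (V \<inter> W)" using \<kappa>[OF FI] Vmin[OF FI] lt by force
      have "card (N V \<union> N W) + card (N V \<inter> N W) = card (N V) + card (N W)"
        using fin(2) VG WG by (metis card_Un_Int)
      moreover have "card (N (V \<inter> W)) \<le> card (N V \<inter> N W)" using NI fin(2)[OF VG] by (intro card_mono) auto
      ultimately have nU: "card (N (V \<union> W)) + card (N (V \<inter> W)) \<le> 2 * card (N V)"
        using NU[OF VG WG] W(3) by simp
      have cU: "card (V \<union> W) + card (V \<inter> W) = 2 * card V"
        using fin(1) VG WG W(2) card_Un_Int[of V W] by simp
      show False
      proof (cases "F (V \<union> W)")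
        case True
        then show False using \<kappa>[of "V \<union> W"] nU cU gI V(2) by (simp add: g_def)
      next
        case False
        have "k \<le> card (V \<union> W)" using W(4) cU lt by linarith
        then have "card (N (V \<union> W)) + k > card G" using False VG WG by (simp add: F_def)
        then show False using nU gI V(2) half W(4) by (simp add: g_def)
      qed
    qed
  qed
qed

section \<open>Freiman's 3k-4 theorem\<close>

lemma residues_of_plus_left: "residues_of m (residues_of m A + B) = residues_of m (A + B)"
proof (intro equalityI subsetI)
  fix x assume "x \<in> residues_of m (residues_of m A + B)"
  then obtain a b where "a \<in> A" "b \<in> B" "x = (a mod m + b) mod m" by (auto elim!: set_plus_memE)
  then have "x = (a + b) mod m" by (simp add: mod_add_left_eq)
  then show "x \<in> residues_of m (A + B)" using \<open>a \<in> A\<close> \<open>b \<in> B\<close> by (metis image_eqI set_plus_memI)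
next
  fix x assume "x \<in> residues_of m (A + B)"
  then obtain a b where ab: "a \<in> A" "b \<in> B" "x = (a + b) mod m" by (auto elim!: set_plus_memE)
  then have "x = (a mod m + b) mod m" by (simp add: mod_add_left_eq)
  moreover have "a mod m + b \<in> residues_of m A + B" using ab by (intro set_plus_memI) auto
  ultimately show "x \<in> residues_of m (residues_of m A + B)" by blast
qed

lemma residues_of_plus_right: "residues_of m (A + residues_of m B) = residues_of m (A + B)"
  using residues_of_plus_left[of m B A] by (simp add: add.commute)

lemma residues_of_id: "A \<subseteq> {0..<m} \<Longrightarrow> residues_of m A = A"
proof -
  assume A: "A \<subseteq> {0..<m}"
  have "x mod m = x" if "x \<in> A" for x using that A by auto
  then show ?thesis by simp
qed

lemma card_residues_translate: "card (residues_of m ((+) t ` A)) = card (residues_of m A)"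
proof -
  have e: "residues_of m ((+) t ` A) = (\<lambda>r. (t + r) mod m) ` residues_of m A"
    by (auto simp: image_image mod_add_right_eq)
  have "inj_on (\<lambda>r. (t + r) mod m) (residues_of m A)"
  proof (rule inj_onI)
    fix x y assume xy: "x \<in> residues_of m A" "y \<in> residues_of m A" "(t + x) mod m = (t + y) mod m"
    then have "x mod m = y mod m" by (simp add: mod_eq_dvd_iff)
    then show "x = y" using xy by auto
  qed
  then show ?thesis unfolding e by (rule card_image)
qed

lemma plus_translate_right:
  fixes A B :: "'a::ab_group_add set"
  shows "A + (+) t ` B = (+) t ` (A + B)"
proof (intro equalityI subsetI)
  fix x assume "x \<in> A + (+) t ` B"
  then obtain a b where "a \<in> A" "b \<in> B" "x = t + (a + b)"
    by (auto elim!: set_plus_memE simp: add.left_commute)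
  then show "x \<in> (+) t ` (A + B)" by (intro image_eqI[of _ _ "a + b"] set_plus_memI)
next
  fix x assume "x \<in> (+) t ` (A + B)"
  then obtain a b where ab: "a \<in> A" "b \<in> B" "x = t + (a + b)"
    by (auto elim!: set_plus_memE)
  then have "a + (t + b) \<in> A + (+) t ` B" by (intro set_plus_memI imageI)
  then show "x \<in> A + (+) t ` B" using ab by (simp add: add.left_commute)
qed

lemma card_residue_classes:
  assumes d: "(d::int) > 0" and m: "d dvd m" "m > 0" and Q: "Q \<subseteq> {0..<d}"
  shows "int (card {x \<in> {0..<m}. x mod d \<in> Q}) = int (card Q) * (m div d)"
proof -
  let ?h = "m div d"
  let ?f = "\<lambda>(c, i). c + d * i"
  have mh: "m = d * ?h" using m by simp
  have "bij_betw ?f (Q \<times> {0..<?h}) {x \<in> {0..<m}. x mod d \<in> Q}"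
  proof (rule bij_betwI')
    fix x y assume xy: "x \<in> Q \<times> {0..<?h}" "y \<in> Q \<times> {0..<?h}"
    show "(?f x = ?f y) = (x = y)"
    proof
      assume e: "?f x = ?f y"
      obtain c i c' i' where ci: "x = (c, i)" "y = (c', i')" by (meson surj_pair)
      then have "(c + d * i) mod d = (c' + d * i') mod d" using e by simp
      then have "c mod d = c' mod d" by simp
      moreover have "c \<in> {0..<d}" "c' \<in> {0..<d}" using xy ci Q by auto
      ultimately have "c = c'" by simp
      then show "x = y" using e ci d by simp
    qed simp
  next
    fix x assume "x \<in> Q \<times> {0..<?h}"
    then obtain c i where ci: "x = (c, i)" "c \<in> Q" "0 \<le> i" "i < ?h" by auto
    have c: "0 \<le> c" "c < d" using ci Q by auto
    have "d * (i + 1) \<le> d * ?h" using ci d by (intro mult_left_mono) auto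
    then have "c + d * i < m" using c mh by (simp add: algebra_simps)
    moreover have "0 \<le> c + d * i" using c ci d by simp
    ultimately show "?f x \<in> {x \<in> {0..<m}. x mod d \<in> Q}" using ci c by simp
  next
    fix y assume y: "y \<in> {x \<in> {0..<m}. x mod d \<in> Q}"
    have "y div d < ?h"
    proof (rule ccontr)
      assume "\<not> ?thesis"
      then have "d * ?h \<le> d * (y div d)" using d by (intro mult_left_mono) auto
      also have "\<dots> \<le> y" using mult_div_mod_eq[of d y] pos_mod_sign[OF d, of y] by linarith
      finally show False using y mh by simp
    qed
    moreover have "0 \<le> y div d" using y d by (simp add: pos_imp_zdiv_nonneg_iff)
    ultimately have "(y mod d, y div d) \<in> Q \<times> {0..<?h}" using y by simp
    moreover have "y = ?f (y mod d, y div d)" by simp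
    ultimately show "\<exists>x\<in>Q \<times> {0..<?h}. y = ?f x" by blast
  qed
  then have "card {x \<in> {0..<m}. x mod d \<in> Q} = card (Q \<times> {0..<?h})" by (simp add: bij_betw_same_card)
  moreover have "?h \<ge> 0" using m d by (simp add: pos_imp_zdiv_nonneg_iff)
  ultimately show ?thesis by (simp add: card_cartesian_product)
qed

text \<open>Among the sets \<open>T\<close> with \<open>S + T \<noteq> \<int>/m\<close>, the difference \<open>|S + T| - |T|\<close> is minimised
  by a subgroup \<open>d\<int>/m\<close>.\<close>

lemma cyclic_isoperimetric:
  fixes S :: "int set"
  assumes m: "m > 0" and S: "finite S" "0 \<in> S"
    and T0: "finite T0" "T0 \<noteq> {}" "residues_of m (S + T0) \<noteq> {0..<m}"
  obtains d where "d > 0" "d dvd m" "int (card (residues_of d S)) < d"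
    "\<And>T. finite T \<Longrightarrow> T \<noteq> {} \<Longrightarrow> residues_of m (S + T) \<noteq> {0..<m} \<Longrightarrow>
       int (card (residues_of m T)) + (int (card (residues_of d S)) - 1) * (m div d)
         \<le> int (card (residues_of m (S + T)))"
proof -
  define G where "G = {0..<m}"
  define N where "N = (\<lambda>X. residues_of m (S + X))"
  define F where "F = (\<lambda>X. X \<subseteq> G \<and> 1 \<le> card X \<and> card (N X) + 1 \<le> card G)"
  have finG: "finite G" by (simp add: G_def)
  have cG: "int (card G) = m" using m by (simp add: G_def)
  have NG: "N X \<subseteq> G" for X unfolding N_def G_def using m by auto
  have finN: "finite (N X)" for X using NG finG finite_subset by blast
  have F_iff: "F X \<longleftrightarrow> X \<subseteq> G \<and> X \<noteq> {} \<and> N X \<noteq> G" for X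
  proof -
    have "card (N X) + 1 \<le> card G \<longleftrightarrow> N X \<noteq> G"
    proof
      assume "N X \<noteq> G"
      then have "card (N X) < card G" using NG[of X] finG by (intro psubset_card_mono) auto
      then show "card (N X) + 1 \<le> card G" by simp
    qed auto
    moreover have "1 \<le> card X \<longleftrightarrow> X \<noteq> {}" if "X \<subseteq> G"
      using finite_subset[OF that finG] by (auto simp: Suc_le_eq card_gt_0_iff)
    ultimately show ?thesis by (auto simp: F_def)
  qed
  have F0: "F (residues_of m T0)"
    unfolding F_iff using T0 m by (auto simp: G_def N_def residues_of_plus_right)
  have dual: "\<exists>X'. X' \<subseteq> G \<and> card X' = card G - card (N X) \<and> card (N X') + card X \<le> card G" if "F X" for X
  proof -
    define X' where "X' = residues_of m (uminus ` (G - N X))"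
    have XG: "X \<subseteq> G" using that by (simp add: F_def)
    have injm: "card (residues_of m (uminus ` Y)) = card Y" if "Y \<subseteq> G" for Y
    proof -
      have "uminus ` Y \<subseteq> {-m+1..<-m+1+m}" using that by (auto simp: G_def)
      then have "card (residues_of m (uminus ` Y)) = card (uminus ` Y)" by (rule card_residues_of_small)
      also have "\<dots> = card Y" by (intro card_image) (auto simp: inj_on_def)
      finally show ?thesis .
    qed
    have "card X' = card (G - N X)" unfolding X'_def by (rule injm) auto
    then have c: "card X' = card G - card (N X)" using NG finN by (simp add: card_Diff_subset)
    have "N X' \<inter> residues_of m (uminus ` X) = {}"
    proof (rule ccontr)
      assume "\<not> ?thesis"
      then obtain s g x where *: "s \<in> S" "g \<in> G - N X" "x \<in> X" "(s + (-g) mod m) mod m = (-x) mod m"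
        by (auto simp: N_def X'_def elim!: set_plus_memE)
      then have "(s - g) mod m = (-x) mod m" by (simp add: mod_add_right_eq)
      then have "m dvd (s + x) - g" using mod_eq_dvd_iff[of "s - g" m "-x"] by (simp add: algebra_simps)
      then have "(s + x) mod m = g mod m" by (simp add: mod_eq_dvd_iff)
      moreover have "g mod m = g" using * by (simp add: G_def)
      moreover have "(s + x) mod m \<in> N X" unfolding N_def using * by (intro imageI set_plus_memI)
      ultimately show False using * by simp
    qed
    then have "card (N X') + card (residues_of m (uminus ` X)) = card (N X' \<union> residues_of m (uminus ` X))"
      using finN XG finG by (intro card_Un_disjoint[symmetric]) (auto intro: finite_subset)
    also have "\<dots> \<le> card G" using finG NG m by (intro card_mono) (auto simp: G_def)
    finally have "card (N X') + card X \<le> card G" using injm[OF XG] by simp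
    moreover have "X' \<subseteq> G" using m by (auto simp: X'_def G_def)
    ultimately show ?thesis using c by blast
  qed
  have NU: "N (X \<union> Y) = N X \<union> N Y" for X Y
    unfolding N_def image_Un[symmetric] by (rule arg_cong[where f = "residues_of m"]) (auto simp: set_plus_image)
  obtain V where V: "F V"
    and Vmin: "\<And>X. F X \<Longrightarrow> card (N V) + card X \<le> card (N X) + card V"
    and Vint: "\<And>W. F W \<Longrightarrow> card W = card V \<Longrightarrow> card (N W) = card (N V) \<Longrightarrow> 1 \<le> card (V \<inter> W) \<Longrightarrow> W = V"
  proof (rule submodular_atom[of G 1 N "residues_of m T0"])
    show "\<exists>X'\<subseteq>G. card X' = card G - card (N X) \<and> card (N X') + card X \<le> card G"
      if "X \<subseteq> G \<and> 1 \<le> card X \<and> card (N X) + 1 \<le> card G" for X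
      using dual[of X] that unfolding F_def by blast
    show "residues_of m T0 \<subseteq> G \<and> 1 \<le> card (residues_of m T0) \<and> card (N (residues_of m T0)) + 1 \<le> card G"
      using F0 unfolding F_def .
  qed (use finG NG NU in \<open>auto simp: F_def\<close>)
  have transl: "F (residues_of m ((+) t ` X)) \<and> card (residues_of m ((+) t ` X)) = card X \<and>
      card (N (residues_of m ((+) t ` X))) = card (N X)" if "F X" for t X
  proof -
    have XG: "X \<subseteq> G" using that by (simp add: F_def)
    have "residues_of m X = X" using XG by (simp add: residues_of_id G_def)
    then have c1: "card (residues_of m ((+) t ` X)) = card X" using card_residues_translate[of m t X] by simp
    have "N (residues_of m ((+) t ` X)) = residues_of m ((+) t ` (S + X))"
      by (simp add: N_def residues_of_plus_right plus_translate_right)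
    then have c2: "card (N (residues_of m ((+) t ` X))) = card (N X)"
      using card_residues_translate[of m t "S + X"] by (simp add: N_def)
    have "residues_of m ((+) t ` X) \<subseteq> G" using m by (auto simp: G_def)
    then show ?thesis using that c1 c2 by (simp add: F_def)
  qed
  have "V \<noteq> {}" using V F_iff by blast
  then obtain v where v: "v \<in> V" by blast
  define V0 where "V0 = residues_of m ((+) (-v) ` V)"
  have V0: "F V0" "card V0 = card V" "card (N V0) = card (N V)"
    using transl[OF V, of "-v"] by (auto simp: V0_def)
  have "(-v + v) mod m \<in> V0" unfolding V0_def using v by (intro imageI)
  then have z: "0 \<in> V0" by simp
  have V0G: "V0 \<subseteq> G" using V0 by (simp add: F_def)
  \<comment> \<open>With \<open>k = 1\<close> the atom property says that a translate of the atom
    that meets it coincides with it. For the translate \<open>V0\<close> through \<open>0\<close>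
    this gives closure under differences, so \<open>V0\<close> is a subgroup.\<close>
  have stab: "residues_of m ((+) t ` V0) = V0" if "1 \<le> card (V0 \<inter> residues_of m ((+) t ` V0))" for t
  proof -
    define W where "W = residues_of m ((+) (t + v) ` V0)"
    have W: "F W" "card W = card V" "card (N W) = card (N V)"
      using transl[OF V0(1), of "t + v"] V0 by (auto simp: W_def)
    have V0V: "residues_of m ((+) v ` V0) = V"
    proof -
      have "residues_of m ((+) v ` V0) = residues_of m V"
        unfolding V0_def image_image by (rule image_cong) (simp_all add: mod_add_right_eq)
      then show ?thesis using V by (simp add: F_def G_def residues_of_id)
    qed
    have WW: "W = residues_of m ((+) v ` residues_of m ((+) t ` V0))"
      unfolding W_def image_image by (rule image_cong) (simp_all add: mod_add_right_eq add.assoc add.commute add.left_commute)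
    have "V0 \<inter> residues_of m ((+) t ` V0) \<noteq> {}"
    proof
      assume "V0 \<inter> residues_of m ((+) t ` V0) = {}"
      with that show False by simp
    qed
    then obtain x where x: "x \<in> V0" "x \<in> residues_of m ((+) t ` V0)" by blast
    have "(v + x) mod m \<in> V" using x V0V by blast
    moreover have "(v + x) mod m \<in> W" unfolding WW using x(2) by blast
    ultimately have "(v + x) mod m \<in> V \<inter> W" by simp
    moreover have "finite (V \<inter> W)" using W finG by (auto simp: F_def intro: finite_subset)
    ultimately have "1 \<le> card (V \<inter> W)" by (intro card_nonempty_pos)
    then have "W = V" using Vint W by blast
    then have "residues_of m ((+) (-v) ` W) = V0" by (simp add: V0_def)
    moreover have "residues_of m ((+) (-v) ` W) = residues_of m ((+) t ` V0)"
      unfolding W_def image_image by (rule image_cong) (simp_all add: mod_simps)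
    ultimately show ?thesis by simp
  qed
  have diff: "(x - y) mod m \<in> V0" if "x \<in> V0" "y \<in> V0" for x y
  proof -
    have "(-y + y) mod m \<in> residues_of m ((+) (-y) ` V0)" using that by (intro imageI)
    then have "0 \<in> V0 \<inter> residues_of m ((+) (-y) ` V0)" using z by simp
    moreover have "finite V0" using V0G finG finite_subset by blast
    ultimately have "1 \<le> card (V0 \<inter> residues_of m ((+) (-y) ` V0))" by (intro card_nonempty_pos) auto
    then have "residues_of m ((+) (-y) ` V0) = V0" by (rule stab)
    moreover have "(-y + x) mod m \<in> residues_of m ((+) (-y) ` V0)" using that by (intro imageI)
    ultimately show ?thesis by simp
  qed
  \<comment> \<open>The preimage of \<open>V0\<close> is a subgroup of the integers, and
    \<open>d\<close> below is its positive generator.\<close>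
  define H where "H = {x. x mod m \<in> V0}"
  have Hd: "x - y \<in> H" if "x \<in> H" "y \<in> H" for x y
    using diff[of "x mod m" "y mod m"] that by (simp add: H_def mod_diff_eq)
  have mH: "m \<in> H" using z by (simp add: H_def)
  have zH: "0 \<in> H" using z by (simp add: H_def)
  define d where "d = int (LEAST n. 0 < n \<and> int n \<in> H)"
  have ex: "0 < nat m \<and> int (nat m) \<in> H" using m mH by simp
  have dH: "d > 0" "d \<in> H" unfolding d_def using LeastI[of "\<lambda>n. 0 < n \<and> int n \<in> H", OF ex] by auto
  have dmin: "d \<le> x" if "0 < x" "x \<in> H" for x
    using Least_le[of "\<lambda>n. 0 < n \<and> int n \<in> H" "nat x"] that by (simp add: d_def)
  have mult: "d * int n \<in> H" for n
  proof (induction n)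
    case (Suc n)
    have "0 - d \<in> H" using Hd zH dH by blast
    then have "d * int n - (0 - d) \<in> H" using Hd Suc by blast
    then show ?case by (simp add: algebra_simps)
  qed (simp add: zH)
  have multZ: "d * k \<in> H" for k
  proof (cases "k \<ge> 0")
    case True then show ?thesis using mult[of "nat k"] by simp
  next
    case False
    then have "0 - d * int (nat (-k)) \<in> H" using Hd zH mult by blast
    then show ?thesis using False by simp
  qed
  have H_iff: "x \<in> H \<longleftrightarrow> d dvd x" for x
  proof
    assume "x \<in> H"
    then have "x - d * (x div d) \<in> H" using Hd multZ by blast
    then have "x mod d \<in> H" by (simp add: minus_mult_div_eq_mod)
    then have "x mod d = 0" using dmin[of "x mod d"] dH(1) pos_mod_bound[OF dH(1), of x] pos_mod_sign[OF dH(1), of x] by force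
    then show "d dvd x" by auto
  qed (auto simp: multZ)
  have dm: "d dvd m" using H_iff mH by blast
  have V0_eq: "V0 = {x \<in> {0..<m}. x mod d \<in> {0}}"
  proof -
    have "V0 = {x \<in> {0..<m}. x \<in> H}" using V0G by (auto simp: H_def G_def)
    then show ?thesis by (auto simp: H_iff mod_eq_0_iff_dvd)
  qed
  have cV0: "int (card V0) = m div d"
    unfolding V0_eq using card_residue_classes[OF dH(1) dm m, of "{0}"] dH by simp
  have N_eq: "N V0 = {x \<in> {0..<m}. x mod d \<in> residues_of d S}"
  proof (intro equalityI subsetI)
    fix x assume "x \<in> N V0"
    then obtain s y where "s \<in> S" "y \<in> V0" "x = (s + y) mod m" by (auto simp: N_def elim!: set_plus_memE)
    moreover have "d dvd y" using \<open>y \<in> V0\<close> by (auto simp: V0_eq mod_eq_0_iff_dvd)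
    then have "(s + y) mod d = s mod d" by auto
    moreover have "(s + y) mod m mod d = (s + y) mod d" using dm by (simp add: mod_mod_cancel)
    ultimately show "x \<in> {x \<in> {0..<m}. x mod d \<in> residues_of d S}" using m by auto
  next
    fix x assume "x \<in> {x \<in> {0..<m}. x mod d \<in> residues_of d S}"
    then obtain s where s: "s \<in> S" "x mod d = s mod d" "x \<in> {0..<m}" by auto
    have "d dvd x - s" using s(2) by (simp add: mod_eq_dvd_iff)
    then have "x - s \<in> H" by (simp add: H_iff)
    then have "(x - s) mod m \<in> V0" by (simp add: H_def)
    then have "(s + (x - s) mod m) mod m \<in> N V0" unfolding N_def using s by (intro imageI set_plus_memI)
    moreover have "(s + (x - s) mod m) mod m = x" using s(3) by (simp add: mod_add_right_eq)
    ultimately show "x \<in> N V0" by simp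
  qed
  have sub: "residues_of d S \<subseteq> {0..<d}" using dH by auto
  have cN: "int (card (N V0)) = int (card (residues_of d S)) * (m div d)"
    unfolding N_eq using card_residue_classes[OF dH(1) dm m sub] .
  show ?thesis
  proof (rule that[OF dH(1) dm])
    have "N V0 \<noteq> G" using V0(1) F_iff by blast
    then have "residues_of d S \<noteq> {0..<d}" unfolding N_eq G_def using dH(1) by auto
    then have "card (residues_of d S) < card {0..<d}" using sub by (intro psubset_card_mono) auto
    then show "int (card (residues_of d S)) < d" using dH by simp
  next
    fix T :: "int set" assume T: "finite T" "T \<noteq> {}" "residues_of m (S + T) \<noteq> {0..<m}"
    have "residues_of m T \<subseteq> G" unfolding G_def by (rule residues_of_subset[OF m])
    moreover have "residues_of m T \<noteq> {}" using T(2) by simp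
    moreover have "N (residues_of m T) \<noteq> G" unfolding N_def G_def residues_of_plus_right by (rule T(3))
    ultimately have "F (residues_of m T)" unfolding F_iff by blast
    from Vmin[OF this] have 1: "card (N V0) + card (residues_of m T) \<le> card (N (residues_of m T)) + card V0"
      unfolding V0(2,3) .
    have 2: "N (residues_of m T) = residues_of m (S + T)" unfolding N_def residues_of_plus_right ..
    have "int (card (N V0)) + int (card (residues_of m T)) \<le> int (card (residues_of m (S + T))) + int (card V0)"
      using 1 unfolding 2 by linarith
    then show "int (card (residues_of m T)) + (int (card (residues_of d S)) - 1) * (m div d)
         \<le> int (card (residues_of m (S + T)))"
      unfolding cN cV0 left_diff_distrib by linarith
  qed
qed

lemma card_eq_sum_residue_classes:
  assumes "finite (X :: int set)"
  shows "int (card X) = (\<Sum>c\<in>residues_of d X. int (card {x \<in> X. x mod d = c}))"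
proof -
  have "(\<Sum>x\<in>X. 1::int) = (\<Sum>c\<in>residues_of d X. \<Sum>x\<in>{x \<in> X. x mod d = c}. 1)"
    using assms by (rule sum.image_gen)
  then show ?thesis by simp
qed

lemma card_plus_affine:
  fixes P R :: "int set"
  assumes "d \<noteq> 0"
  shows "card ((\<lambda>x. b + d * x) ` P + (\<lambda>x. c + d * x) ` R) = card (P + R)"
proof -
  have "(\<lambda>x. b + d * x) ` P + (\<lambda>x. c + d * x) ` R = (\<lambda>x. b + c + d * x) ` (P + R)"
    by (force simp: set_plus_image image_iff algebra_simps)
  then show ?thesis using assms by (simp add: card_image inj_on_def)
qed

lemma class_as_affine_image:
  fixes A :: "int set"
  assumes "d > 0"
  shows "{a \<in> A. a mod d = c mod d} = (\<lambda>x. c mod d + d * x) ` {x. c mod d + d * x \<in> A}"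
proof (intro equalityI subsetI)
  fix a assume a: "a \<in> {a \<in> A. a mod d = c mod d}"
  then have "a = c mod d + d * (a div d)" using mult_div_mod_eq[of d a] by simp
  then show "a \<in> (\<lambda>x. c mod d + d * x) ` {x. c mod d + d * x \<in> A}" using a by auto
qed auto

lemma sum_le_one_exception:
  fixes f :: "'a \<Rightarrow> int"
  assumes "finite G" "g0 \<in> G" "f g0 \<le> E" "\<And>g. g \<in> G \<Longrightarrow> g \<noteq> g0 \<Longrightarrow> f g \<le> e"
  shows "(\<Sum>g\<in>G. f g) \<le> E + (int (card G) - 1) * e"
proof -
  have "(\<Sum>g\<in>G. f g) = f g0 + (\<Sum>g\<in>G - {g0}. f g)" using assms by (simp add: sum.remove)
  also have "(\<Sum>g\<in>G - {g0}. f g) \<le> (\<Sum>g\<in>G - {g0}. e)" using assms by (intro sum_mono) auto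
  also have "\<dots> = (int (card G) - 1) * e"
    using assms card_gt_0_iff[of G] by (auto simp: card_Diff_singleton of_nat_diff Suc_le_eq)
  finally show ?thesis using assms(3) by linarith
qed

text \<open>The bookkeeping that ends \<open>card_sumset_ge_long\<close>: \<open>n\<close> points
  occupy \<open>q\<close> classes with \<open>h\<close> places each and one extra place,
  \<open>D\<close> counts the holes, \<open>W\<close> the holes charged to new classes, and
  \<open>U\<close>, \<open>V\<close> are the sizes of the sumset in old and new classes. The product
  \<open>q * h\<close> is abstracted to make the estimate linear.\<close>

lemma class_count_bound:
  fixes n q h D D0 D' N U V W :: int
  assumes "D = D0 + D'" "D = q * h + 1 - n" "D0 \<ge> 0" "n + q * h - D0 \<le> U"
    "W \<le> 2 * D' + (q - 1 - 1) * (h - 1)" "(q - 1) * (2 * h - 1) - W \<le> V" "U + V \<le> N"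
  shows "3 * n - 3 \<le> N"
proof -
  have 1: "(q - 1 - 1) * (h - 1) = q * h - q - 2 * h + 2" by (simp add: algebra_simps)
  have 2: "(q - 1) * (2 * h - 1) = 2 * (q * h) - q - 2 * h + 1" by (simp add: algebra_simps)
  obtain a where a: "a = q * h" by blast
  show ?thesis using assms unfolding 1 2 a[symmetric] by linarith
qed

text \<open>If \<open>A + A\<close> covers all classes modulo \<open>l\<close>, the length alone
  suffices. Otherwise the extremal subgroup enters: \<open>A\<close> occupies \<open>q\<close>
  classes modulo \<open>d\<close>, at least two by \<open>gcd\<close>. Either the isoperimetric gain
  \<open>(q - 1) * h\<close> is at least \<open>n - 2\<close>, or \<open>A\<close> nearly fills its
  classes. In the second case \<open>A + A\<close> is counted class by class and found large in the
  \<open>q\<close> old classes and in \<open>q - 1\<close> new ones.\<close>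

lemma card_sumset_ge_long:
  fixes A :: "int set"
  assumes A: "A \<subseteq> {0..l}" "0 \<in> A" "l \<in> A" and l: "l > 0"
    and gcd: "\<And>d. d > 1 \<Longrightarrow> \<exists>a\<in>A. \<not> d dvd a"
    and long: "2 * int (card A) - 2 \<le> l"
  shows "3 * int (card A) - 3 \<le> int (card (A + A))"
proof (cases "residues_of l (A + A) = {0..<l}")
  case True
  have "finite A" using A finite_subset by blast
  then have "l + int (card A) \<le> int (card (A + A))"
    using A l True by (intro card_plus_ge_full_residues) auto
  then show ?thesis using long by linarith
next
  case False
  define n where "n = int (card A)"
  have finA: "finite A" using A finite_subset by blast
  have finAA: "finite (A + A)" using finA by (intro finite_set_plus)
  obtain d where d: "d > 0" "d dvd l" "int (card (residues_of d A)) < d"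
    and iso: "\<And>T. finite T \<Longrightarrow> T \<noteq> {} \<Longrightarrow> residues_of l (A + T) \<noteq> {0..<l} \<Longrightarrow>
       int (card (residues_of l T)) + (int (card (residues_of d A)) - 1) * (l div d)
         \<le> int (card (residues_of l (A + T)))"
    using cyclic_isoperimetric[OF l finA A(2) finA _ False] A(2) by blast
  define h where "h = l div d"
  define Q where "Q = residues_of d A"
  define q where "q = int (card Q)"
  have ldh: "l = d * h" using d by (simp add: h_def)
  have h: "h > 0" using ldh l d by (simp add: zero_less_mult_iff)
  have finQ: "finite Q" using finA by (simp add: Q_def)
  have Qd: "Q \<subseteq> {0..<d}" using d by (auto simp: Q_def)
  have "0 mod d \<in> Q" unfolding Q_def using A(2) by (intro imageI)
  then have zQ: "0 \<in> Q" by simp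
  have q1: "q \<ge> 1" using zQ finQ card_nonempty_pos[of Q 0] by (simp add: q_def)
  have q2: "q \<ge> 2"
  proof (rule ccontr)
    assume "\<not> q \<ge> 2"
    then have "card Q = 1" using q1 by (simp add: q_def)
    then have "Q = {0}" using zQ by (metis card_1_singletonE singletonD)
    moreover have "d > 1" using d(3) \<open>card Q = 1\<close> by (simp add: Q_def)
    then obtain a where a: "a \<in> A" "\<not> d dvd a" using gcd by blast
    moreover have "a mod d \<in> Q" unfolding Q_def using a(1) by (rule imageI)
    ultimately show False by (simp add: mod_eq_0_iff_dvd)
  qed
  have NA: "int (card (residues_of l (A + A))) + n \<le> int (card (A + A))"
  proof -
    have "card (residues_of l (A + A)) + card A \<le> card (A + A)"
    proof (intro card_residues_shift)
      show "A \<subseteq> A + A" using set_plus_memI[OF A(2), of _ A] by auto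
      show "(+) l ` A \<subseteq> A + A" using set_plus_memI[OF A(3), of _ A] by auto
    qed (use finAA l in auto)
    then show ?thesis by (simp add: n_def)
  qed
  have isoA: "n - 1 + (q - 1) * h \<le> int (card (residues_of l (A + A)))"
    using iso[OF finA _ False] A(2) card_residues_of_interval[OF l A] by (auto simp: q_def Q_def h_def n_def)
  show ?thesis
  proof (cases "(q - 1) * h \<ge> n - 2")
    case True
    then show ?thesis using NA isoA by (simp add: n_def)
  next
    case False
    \<comment> \<open>\<open>D\<close> counts the holes of \<open>A\<close> in its classes. The
      extra \<open>1\<close> is there because class \<open>0\<close> contains both \<open>0\<close>
      and \<open>l\<close> and so has \<open>h + 1\<close> places.\<close>
    define D where "D = q * h + 1 - n"
    have D: "D \<le> h - 2" using False by (simp add: D_def left_diff_distrib)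
    define K where "K = residues_of d (A + A)"
    have finK: "finite K" using finAA by (simp add: K_def)
    have Kd: "K \<subseteq> {0..<d}" using d by (auto simp: K_def)
    have K_add: "(a + b) mod d \<in> K" if abQ: "a \<in> Q" "b \<in> Q" for a b
    proof -
      obtain a' b' where "a' \<in> A" "b' \<in> A" "a = a' mod d" "b = b' mod d" using abQ unfolding Q_def by blast
      then have "(a + b) mod d = (a' + b') mod d" by (simp add: mod_add_eq)
      then show ?thesis unfolding K_def using \<open>a' \<in> A\<close> \<open>b' \<in> A\<close> by (metis image_eqI set_plus_memI)
    qed
    have QK: "Q \<subseteq> K"
    proof
      fix c assume c: "c \<in> Q"
      then have "(0 + c) mod d \<in> K" using K_add zQ by blast
      moreover have "c mod d = c" using c Qd by auto
      ultimately show "c \<in> K" by simp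
    qed
    have card_K: "int (card K) \<ge> 2 * q - 1"
    proof -
      \<comment> \<open>The test set for the isoperimetric bound is the full union of the classes in
        \<open>Q\<close>. Its sum with \<open>A\<close> stays in the classes of \<open>K\<close>, so
        a gain of \<open>(q - 1) * h\<close> points means \<open>q - 1\<close> further
        classes.\<close>
      define T where "T = {x \<in> {0..<l}. x mod d \<in> Q}"
      have cT: "int (card T) = q * h"
        unfolding T_def using card_residue_classes[OF d(1,2) l Qd] by (simp add: q_def h_def)
      have cK: "int (card {x \<in> {0..<l}. x mod d \<in> K}) = int (card K) * h"
        using card_residue_classes[OF d(1,2) l Kd] by (simp add: h_def)
      have sub: "residues_of l (A + T) \<subseteq> {x \<in> {0..<l}. x mod d \<in> K}"
      proof
        fix x assume "x \<in> residues_of l (A + T)"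
        then obtain a t where at: "a \<in> A" "t \<in> T" "x = (a + t) mod l" by (auto elim!: set_plus_memE)
        have "(a mod d + t mod d) mod d \<in> K" using at by (intro K_add) (auto simp: Q_def T_def)
        moreover have "(a mod d + t mod d) mod d = x mod d"
          using at d(2) by (simp add: mod_add_eq mod_mod_cancel)
        ultimately show "x \<in> {x \<in> {0..<l}. x mod d \<in> K}" using at l by simp
      qed
      have finT: "finite T" unfolding T_def by (rule finite_subset[of _ "{0..<l}"]) auto
      have finKl: "finite {x \<in> {0..<l}. x mod d \<in> K}" by (rule finite_subset[of _ "{0..<l}"]) auto
      show ?thesis
      proof (cases "residues_of l (A + T) = {0..<l}")
        case True
        have "card {0..<l} \<le> card {x \<in> {0..<l}. x mod d \<in> K}"
          using sub unfolding True by (rule card_mono[OF finKl])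
        then have "d * h \<le> int (card K) * h" using cK l ldh by simp
        then have "d \<le> int (card K)" using h by (simp add: mult.commute)
        moreover have "2 * q - 1 \<le> d"
        proof (rule ccontr)
          assume "\<not> ?thesis"
          then have "d * h \<le> (2 * q - 2) * h" using h by (intro mult_right_mono) auto
          then have "l \<le> 2 * (q * h) - 2 * h" using ldh by (simp add: left_diff_distrib)
          then show False using long D unfolding D_def n_def[symmetric] by linarith
        qed
        ultimately show ?thesis by linarith
      next
        case False
        have "T \<noteq> {}" using cT q1 h by auto
        then have "int (card (residues_of l T)) + (q - 1) * h \<le> int (card (residues_of l (A + T)))"
          using iso[OF finT _ False] by (simp add: q_def Q_def h_def)
        moreover have "residues_of l T = T" by (intro residues_of_id) (auto simp: T_def)
        moreover have "card (residues_of l (A + T)) \<le> card {x \<in> {0..<l}. x mod d \<in> K}"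
          using sub finKl by (intro card_mono)
        ultimately have "q * h + (q - 1) * h \<le> int (card K) * h" using cT cK by simp
        then have "(2 * q - 1) * h \<le> int (card K) * h" by (simp add: algebra_simps)
        then show ?thesis using h by simp
      qed
    qed
    define Ac where "Ac = (\<lambda>c. {a \<in> A. a mod d = c})"
    define I where "I = (\<lambda>c. {x. c + d * x \<in> A})"
    have AcI: "Ac c = (\<lambda>x. c + d * x) ` I c" if "c \<in> Q" for c
    proof -
      have "c mod d = c" using that Qd by auto
      then show ?thesis unfolding Ac_def I_def using class_as_affine_image[OF d(1), of A c] by simp
    qed
    have finAc: "finite (Ac c)" for c using finA by (simp add: Ac_def)
    have cAcI: "card (Ac c) = card (I c)" if "c \<in> Q" for c
      unfolding AcI[OF that] using d by (intro card_image) (auto simp: inj_on_def)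
    have finI: "finite (I c)" if "c \<in> Q" for c
      using finAc[of c] unfolding AcI[OF that] using d by (subst (asm) finite_image_iff) (auto simp: inj_on_def)
    have Ac_ne: "Ac c \<noteq> {}" if "c \<in> Q" for c using that by (auto simp: Ac_def Q_def)
    have I0: "I 0 \<subseteq> {0..h}" "0 \<in> I 0" "h \<in> I 0"
    proof -
      show "I 0 \<subseteq> {0..h}"
      proof
        fix x assume "x \<in> I 0"
        then have "0 \<le> d * x" "d * x \<le> d * h" using A ldh by (auto simp: I_def)
        then show "x \<in> {0..h}" using d by (simp add: zero_le_mult_iff)
      qed
    qed (use A ldh in \<open>auto simp: I_def\<close>)
    have Ic: "I c \<subseteq> {0..<h}" if "c \<in> Q" "c \<noteq> 0" for c
    proof
      fix x assume "x \<in> I c"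
      then have x: "0 \<le> c + d * x" "c + d * x \<le> d * h" using A ldh by (auto simp: I_def)
      have c: "0 < c" "c < d" using that Qd by force+
      have "x < h"
      proof (rule ccontr)
        assume "\<not> x < h"
        then have "d * h \<le> d * x" using d by simp
        then show False using x c by linarith
      qed
      moreover have "0 \<le> x"
      proof (rule ccontr)
        assume "\<not> 0 \<le> x"
        then have "d * x \<le> d * (-1)" using d by (intro mult_left_mono) auto
        then show False using x c by linarith
      qed
      ultimately show "x \<in> {0..<h}" by simp
    qed
    define Dc where "Dc = (\<lambda>c. (if c = 0 then h + 1 else h) - int (card (I c)))"
    have Dc_nonneg: "Dc c \<ge> 0" if "c \<in> Q" for c
    proof (cases "c = 0")
      case True
      have "card (I 0) \<le> card {0..h}" using I0 by (intro card_mono) auto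
      then show ?thesis using True h by (simp add: Dc_def)
    next
      case False
      have "card (I c) \<le> card {0..<h}" using Ic[OF that False] by (intro card_mono) auto
      then show ?thesis using False h by (simp add: Dc_def)
    qed
    have sumA: "n = (\<Sum>c\<in>Q. int (card (I c)))"
      unfolding n_def using card_eq_sum_residue_classes[OF finA, of d] cAcI by (simp add: Q_def Ac_def)
    have sumif: "(\<Sum>c\<in>Q. if c = 0 then h + 1 else h) = q * h + 1"
    proof -
      have "(\<Sum>c\<in>Q. if c = 0 then h + 1 else h) = (\<Sum>c\<in>Q. h + (if c = 0 then 1 else 0))"
        by (intro sum.cong) auto
      also have "\<dots> = q * h + 1" using finQ zQ by (simp add: sum.distrib q_def sum.delta)
      finally show ?thesis .
    qed
    have sumD: "(\<Sum>c\<in>Q. Dc c) = D"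
      unfolding Dc_def sum_subtractf sumif D_def sumA ..
    define D' where "D' = (\<Sum>c\<in>Q - {0}. Dc c)"
    have D0': "D = Dc 0 + D'" unfolding sumD[symmetric] D'_def using finQ zQ by (simp add: sum.remove)
    have Dle: "Dc c \<le> D'" if "c \<in> Q" "c \<noteq> 0" for c
      unfolding D'_def using that finQ Dc_nonneg by (intro member_le_sum) auto
    have Dle2: "Dc c + Dc c' \<le> D'" if "c \<in> Q" "c \<noteq> 0" "c' \<in> Q" "c' \<noteq> 0" "c \<noteq> c'" for c c'
    proof -
      have "(\<Sum>c\<in>{c, c'}. Dc c) \<le> D'"
        unfolding D'_def using that finQ Dc_nonneg by (intro sum_mono2) auto
      then show ?thesis using that by simp
    qed
    have D0_nonneg: "Dc 0 \<ge> 0" using Dc_nonneg[OF zQ] .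
    define Cc where "Cc = (\<lambda>c. {s \<in> A + A. s mod d = c})"
    have finCc: "finite (Cc c)" for c using finAA by (simp add: Cc_def)
    have Cc_ge: "card (I a + I b) \<le> card (Cc c)" if "a \<in> Q" "b \<in> Q" "(a + b) mod d = c" for a b c
    proof -
      have "Ac a + Ac b \<subseteq> Cc c"
      proof
        fix x assume "x \<in> Ac a + Ac b"
        then obtain u v where "u \<in> Ac a" "v \<in> Ac b" "x = u + v" by (rule set_plus_memE)
        then show "x \<in> Cc c" using that(3) by (auto simp: Ac_def Cc_def mod_add_eq intro: set_plus_memI)
      qed
      then have "card (Ac a + Ac b) \<le> card (Cc c)" using finCc by (intro card_mono)
      moreover have "card (Ac a + Ac b) = card (I a + I b)"
        unfolding AcI[OF that(1)] AcI[OF that(2)] using d by (intro card_plus_affine) simp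
      ultimately show ?thesis by simp
    qed
    have I_ne: "I c \<noteq> {}" if "c \<in> Q" for c using Ac_ne[OF that] AcI[OF that] by auto
    \<comment> \<open>For an old class other than \<open>0\<close> the other summand is taken from
      class \<open>0\<close>, which contains \<open>0\<close> and \<open>l\<close>. As there are at
      most \<open>h - 2\<close> holes, the pigeonhole modulo \<open>h\<close> applies and a full
      period \<open>h\<close> is gained. Class \<open>0\<close> itself falls short of this by its
      own holes.\<close>
    have CQ: "int (card (I c)) + h - (if c = 0 then Dc 0 else 0) \<le> int (card (Cc c))" if c: "c \<in> Q" for c
    proof (cases "c = 0")
      case True
      have "card (I 0) + card (I 0) \<le> card (I 0 + I 0) + 1"
        using finI[OF zQ] I_ne[OF zQ] by (intro card_plus_ge_int)
      moreover have "card (I 0 + I 0) \<le> card (Cc 0)" using zQ by (intro Cc_ge) auto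
      ultimately show ?thesis using True by (simp add: Dc_def)
    next
      case False
      have "int (card (residues_of h (I 0))) = int (card (I 0)) - 1"
        using card_residues_of_interval[OF h I0] .
      moreover have "card (residues_of h (I c)) = card (I c)"
        using Ic[OF c False] by (intro card_residues_of_small[where a = 0]) auto
      moreover have "Dc 0 + Dc c \<le> h - 2" using D D0' Dle[OF c False] by linarith
      ultimately have "int (card (residues_of h (I 0))) + int (card (residues_of h (I c))) > h"
        using False h by (simp add: Dc_def)
      then have "h + int (card (I c)) \<le> int (card (I 0 + I c))"
        using h finI zQ c I0 by (intro card_plus_ge_short) auto
      moreover have "card (I 0 + I c) \<le> card (Cc c)" using zQ c Qd by (intro Cc_ge) auto
      ultimately show ?thesis using False by simp
    qed
    have sumQ: "n + q * h - Dc 0 \<le> (\<Sum>c\<in>Q. int (card (Cc c)))"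
    proof -
      have "(\<Sum>c\<in>Q. int (card (I c)) + h - (if c = 0 then Dc 0 else 0)) = n + q * h - Dc 0"
        using finQ zQ by (simp add: sum.distrib sum_subtractf sumA q_def sum.delta)
      moreover have "(\<Sum>c\<in>Q. int (card (I c)) + h - (if c = 0 then Dc 0 else 0)) \<le> (\<Sum>c\<in>Q. int (card (Cc c)))"
        by (intro sum_mono CQ)
      ultimately show ?thesis by linarith
    qed
    have "card (K - Q) = card K - card Q" using QK finQ by (rule card_Diff_subset[rotated])
    moreover have "2 * int (card Q) - 1 \<le> int (card K)" using card_K unfolding q_def .
    ultimately have "card Q - 1 \<le> card (K - Q)" by linarith
    from obtain_subset_with_card_n[OF this] obtain G
      where G: "G \<subseteq> K - Q" "card G = card Q - 1" "finite G" by metis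
    have cG: "int (card G) = q - 1" using G(2) q1 unfolding q_def by linarith
    have "\<exists>a b. a \<in> Q \<and> b \<in> Q \<and> a \<noteq> 0 \<and> b \<noteq> 0 \<and> (a + b) mod d = c" if "c \<in> G" for c
    proof -
      have "c \<in> K" "c \<notin> Q" using that G by auto
      then obtain x y where xy: "x \<in> A" "y \<in> A" "c = (x + y) mod d" by (auto simp: K_def elim!: set_plus_memE)
      have e: "(x mod d + y mod d) mod d = c" using xy by (simp add: mod_add_eq)
      have m: "x mod d \<in> Q" "y mod d \<in> Q" using xy by (auto simp: Q_def)
      have "x mod d \<noteq> 0" using e m \<open>c \<notin> Q\<close> by auto
      moreover have "y mod d \<noteq> 0" using e m \<open>c \<notin> Q\<close> by auto
      ultimately show ?thesis using e m by blast
    qed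
    then have "\<forall>c\<in>G. \<exists>p. fst p \<in> Q \<and> snd p \<in> Q \<and> fst p \<noteq> 0 \<and> snd p \<noteq> 0 \<and> (fst p + snd p) mod d = c"
      by (metis fst_conv snd_conv)
    from bchoice[OF this] obtain f where f: "\<forall>c\<in>G. fst (f c) \<in> Q \<and> snd (f c) \<in> Q \<and> fst (f c) \<noteq> 0 \<and>
        snd (f c) \<noteq> 0 \<and> (fst (f c) + snd (f c)) mod d = c" ..
    define al where "al = (\<lambda>c. fst (f c))"
    define be where "be = (\<lambda>c. snd (f c))"
    have ab: "al c \<in> Q \<and> be c \<in> Q \<and> al c \<noteq> 0 \<and> be c \<noteq> 0 \<and> (al c + be c) mod d = c" if "c \<in> G" for c
      using f that by (simp add: al_def be_def)
    define w where "w = (\<lambda>c. Dc (al c) + Dc (be c))"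
    have CG: "2 * h - 1 - w c \<le> int (card (Cc c))" if c: "c \<in> G" for c
    proof -
      have abc: "al c \<in> Q" "be c \<in> Q" "al c \<noteq> 0" "be c \<noteq> 0" "(al c + be c) mod d = c" using ab[OF c] by auto
      have "card (I (al c)) + card (I (be c)) \<le> card (I (al c) + I (be c)) + 1"
        using finI I_ne abc by (intro card_plus_ge_int) auto
      moreover have "card (I (al c) + I (be c)) \<le> card (Cc c)" using abc by (intro Cc_ge) auto
      ultimately show ?thesis using abc by (simp add: w_def Dc_def)
    qed
    have w2: "w c \<le> 2 * D'" if "c \<in> G" for c
      using Dle[of "al c"] Dle[of "be c"] ab[OF that] by (simp add: w_def)
    \<comment> \<open>Two different nonzero classes have at most \<open>D'\<close> holes together,
      hence at most \<open>h - 2\<close>. More than \<open>h - 1\<close> occurs only for the double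
      of a class with about half of its places empty, and the holes do not suffice for two such
      classes; this is the single exception in the sum of the \<open>w c\<close>.\<close>
    have big: "al c = be c" if "c \<in> G" "w c > h - 1" for c
    proof (rule ccontr)
      assume "al c \<noteq> be c"
      then have "w c \<le> D'" using Dle2[of "al c" "be c"] ab[OF that(1)] by (simp add: w_def)
      then show False using that(2) D D0' D0_nonneg by linarith
    qed
    have one: "c = c'" if c: "c \<in> G" "w c > h - 1" and c': "c' \<in> G" "w c' > h - 1" for c c'
    proof (rule ccontr)
      assume "c \<noteq> c'"
      then have "al c \<noteq> al c'" using big[OF c] big[OF c'] ab[OF c(1)] ab[OF c'(1)] by auto
      then have "Dc (al c) + Dc (al c') \<le> D'" using Dle2 ab[OF c(1)] ab[OF c'(1)] by blast
      moreover have "2 * Dc (al c) > h - 1" "2 * Dc (al c') > h - 1"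
        using c(2) c'(2) big[OF c] big[OF c'] by (simp_all add: w_def)
      ultimately show False using D D0' D0_nonneg by linarith
    qed
    have "G \<noteq> {}" using cG q2 by auto
    have "\<exists>c0\<in>G. \<forall>c\<in>G. c \<noteq> c0 \<longrightarrow> w c \<le> h - 1"
    proof (cases "\<exists>c\<in>G. w c > h - 1")
      case True
      then obtain c where "c \<in> G" "w c > h - 1" by blast
      then show ?thesis using one by (intro bexI[of _ c]) force+
    next
      case False
      then show ?thesis using \<open>G \<noteq> {}\<close> by force
    qed
    then obtain c0 where c0: "c0 \<in> G" "\<forall>c\<in>G. c \<noteq> c0 \<longrightarrow> w c \<le> h - 1" by (rule bexE)
    have "(\<Sum>c\<in>G. w c) \<le> 2 * D' + (int (card G) - 1) * (h - 1)"
    proof (rule sum_le_one_exception[OF G(3) c0(1)])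
      show "w c0 \<le> 2 * D'" using w2 c0(1) .
      show "w c \<le> h - 1" if "c \<in> G" "c \<noteq> c0" for c using c0(2) that by blast
    qed
    then have W: "(\<Sum>c\<in>G. w c) \<le> 2 * D' + (q - 1 - 1) * (h - 1)" unfolding cG .
    have "(\<Sum>c\<in>G. 2 * h - 1 - w c) = (\<Sum>c\<in>G. 2 * h - 1) - (\<Sum>c\<in>G. w c)"
      by (rule sum_subtractf)
    also have "(\<Sum>c\<in>G. 2 * h - 1) = (q - 1) * (2 * h - 1)" unfolding sum_constant cG ..
    finally have S: "(q - 1) * (2 * h - 1) - (\<Sum>c\<in>G. w c) \<le> (\<Sum>c\<in>G. int (card (Cc c)))"
      using sum_mono[of G "\<lambda>c. 2 * h - 1 - w c" "\<lambda>c. int (card (Cc c))", OF CG] by linarith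
    have K: "int (card (A + A)) = (\<Sum>c\<in>K. int (card (Cc c)))"
      unfolding K_def Cc_def using finAA by (rule card_eq_sum_residue_classes)
    have QG: "(\<Sum>c\<in>Q \<union> G. int (card (Cc c))) \<le> (\<Sum>c\<in>K. int (card (Cc c)))"
      using QK G finK by (intro sum_mono2) auto
    have "(\<Sum>c\<in>Q \<union> G. int (card (Cc c))) = (\<Sum>c\<in>Q. int (card (Cc c))) + (\<Sum>c\<in>G. int (card (Cc c)))"
      using G finQ by (intro sum.union_disjoint) auto
    then have "(\<Sum>c\<in>Q. int (card (Cc c))) + (\<Sum>c\<in>G. int (card (Cc c))) \<le> int (card (A + A))"
      unfolding K using QG by simp
    then show ?thesis
      unfolding n_def[symmetric] by (rule class_count_bound[OF D0' D_def D0_nonneg sumQ W S])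
  qed
qed

text \<open>\<open>card_sumset_ge_long\<close> rules out the lengths from \<open>2 |A| - 2\<close>
  on. Below that \<open>A\<close> fills more than half of its interval, and the pigeonhole modulo
  \<open>l\<close> applies with \<open>A\<close> as both summands.\<close>

theorem freiman_3k_minus_4:
  fixes A :: "int set"
  assumes A: "A \<subseteq> {0..l}" "0 \<in> A" "l \<in> A" and l: "l > 0"
    and gcd: "\<And>d. d > 1 \<Longrightarrow> \<exists>a\<in>A. \<not> d dvd a"
    and small: "int (card (A + A)) \<le> 3 * int (card A) - 4"
  shows "l + int (card A) \<le> int (card (A + A))" "l \<le> 2 * int (card A) - 4"
proof -
  have "finite A" using A finite_subset by blast
  have "l \<le> 2 * int (card A) - 3" using card_sumset_ge_long[OF A l gcd] small by linarith
  then show "l + int (card A) \<le> int (card (A + A))"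
    using \<open>finite A\<close> A l card_residues_of_interval[OF l A] by (intro card_plus_ge_short) auto
  with small show "l \<le> 2 * int (card A) - 4" by linarith
qed

section \<open>Sumsets modulo a prime\<close>

lemma of_int_mod_ring_eq_iff:
  "(of_int a :: 'p::prime_card mod_ring) = of_int b \<longleftrightarrow> a mod int CARD('p) = b mod int CARD('p)"
  unfolding of_int_of_int_mod_ring by transfer simp

lemma of_int_mod_ring_surj: "\<exists>k. 0 \<le> k \<and> k < int CARD('p) \<and> (x :: 'p::prime_card mod_ring) = of_int k"
proof -
  obtain i where "i < CARD('p)" "x = of_nat i" using surj_of_nat_mod_ring[of x] by auto
  then show ?thesis by (intro exI[of _ "int i"]) auto
qed

lemma card_mod_ring_le: "card (X :: 'p::prime_card mod_ring set) \<le> CARD('p)"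
  using card_mono[of UNIV X] by simp

lemma translate_stable_UNIV:
  fixes X :: "'p::prime_card mod_ring set"
  assumes "x \<in> X" "d \<noteq> 0" "\<And>y. y \<in> X \<Longrightarrow> y + d \<in> X"
  shows "X = UNIV"
proof -
  have st: "x + of_nat n * d \<in> X" for n
  proof (induction n)
    case (Suc n)
    then show ?case using assms(3)[OF Suc] by (simp add: algebra_simps)
  qed (use assms in simp)
  have "z \<in> X" for z
  proof -
    obtain n where "(z - x) / d = of_nat n" using surj_of_nat_mod_ring[of "(z - x) / d"] by auto
    then have "z = x + of_nat n * d" using assms(2) by (simp add: field_simps)
    then show ?thesis using st by simp
  qed
  then show ?thesis by auto
qed

text \<open>Induction on \<open>|Y|\<close>, replacing a pair by its union and intersection.
  \<open>Y\<close> is first translated to some \<open>W\<close> that meets \<open>X\<close> but is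
  not contained in it; then the transform keeps the total size, shrinks the second set and does not
  enlarge the sumset.\<close>

theorem cauchy_davenport:
  fixes X Y :: "'p::prime_card mod_ring set"
  assumes "X \<noteq> {}" "Y \<noteq> {}"
  shows "min CARD('p) (card X + card Y - 1) \<le> card (X + Y)"
  using assms
proof (induction "card Y" arbitrary: X Y rule: less_induct)
  case less
  show ?case
  proof (cases "card Y = 1 \<or> X = UNIV")
    case True
    have "card X \<le> card (Y + X)" using less.prems by (intro card_plus_ge_left) auto
    then have "card X \<le> card (X + Y)" by (simp only: add.commute)
    moreover have "card X = CARD('p)" if "X = UNIV" using that by simp
    ultimately show ?thesis using True by linarith
  next
    case False
    obtain y where y: "y \<in> Y" using less.prems by blast
    have "\<exists>y'\<in>Y. y' \<noteq> y"
    proof (rule ccontr)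
      assume "\<not> ?thesis"
      then have "Y = {y}" using y by blast
      then have "card Y = 1" by simp
      then show False using False by blast
    qed
    then obtain y' where y': "y' \<in> Y" "y' \<noteq> y" by blast
    obtain x0 where "x0 \<in> X" using less.prems by blast
    moreover have "y' - y \<noteq> 0" using y' by simp
    ultimately have "\<not> (\<forall>x\<in>X. x + (y' - y) \<in> X)"
    proof (intro notI)
      assume x0: "x0 \<in> X" "y' - y \<noteq> 0" and all: "\<forall>x\<in>X. x + (y' - y) \<in> X"
      have "X = UNIV" by (rule translate_stable_UNIV[OF x0]) (rule bspec[OF all])
      then show False using False by blast
    qed
    then obtain x where x: "x \<in> X" "x + (y' - y) \<notin> X" by blast
    define W where "W = (+) (x - y) ` Y"
    have W: "x \<in> W" "x + (y' - y) \<in> W"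
      unfolding W_def by (rule image_eqI[OF _ y], simp, rule image_eqI[OF _ y'(1)], simp)
    have cW: "card W = card Y" by (simp add: W_def)
    have "X \<inter> W \<subset> W" using x W by blast
    then have "card (X \<inter> W) < card Y" unfolding cW[symmetric] by (intro psubset_card_mono) auto
    then have "min CARD('p) (card (X \<union> W) + card (X \<inter> W) - 1) \<le> card ((X \<union> W) + (X \<inter> W))"
      by (rule less.hyps) (use x W in blast)+
    also have "\<dots> \<le> card (X + W)"
    proof (intro card_mono subsetI)
      fix s assume "s \<in> (X \<union> W) + (X \<inter> W)"
      then obtain a b where ab: "a \<in> X \<union> W" "b \<in> X \<inter> W" "s = a + b" by (rule set_plus_memE)
      have "a + b \<in> X + W"
      proof (cases "a \<in> X")
        case True
        then show ?thesis using ab by (intro set_plus_memI) auto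
      next
        case False
        then show ?thesis unfolding add.commute[of a b] using ab by (intro set_plus_memI) auto
      qed
      then show "s \<in> X + W" using ab by simp
    qed simp
    also have "X + W = (+) (x - y) ` (X + Y)" unfolding W_def by (rule plus_translate_right)
    also have "card \<dots> = card (X + Y)" by simp
    finally have "min CARD('p) (card (X \<union> W) + card (X \<inter> W) - 1) \<le> card (X + Y)" .
    moreover have "card (X \<union> W) + card (X \<inter> W) = card X + card Y"
      using cW card_Un_Int[of X W] by simp
    ultimately show ?thesis by linarith
  qed
qed

corollary cauchy_davenport_small:
  fixes X Y :: "'p::prime_card mod_ring set"
  assumes "X \<noteq> {}" "Y \<noteq> {}" "card (X + Y) < CARD('p)"
  shows "int (card X) + int (card Y) - 1 \<le> int (card (X + Y))"
  using cauchy_davenport[OF assms(1,2)] assms(3) by linarith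

text \<open>Three sets with \<open>0 \<notin> X + Y + Z\<close> that almost fill the group; the sumset of any two of them
  is then small, so the three sets play symmetric roles.\<close>

definition trio :: "'p::prime_card mod_ring set \<Rightarrow> 'p mod_ring set \<Rightarrow> 'p mod_ring set \<Rightarrow> int \<Rightarrow> bool" where
  "trio X Y Z r \<longleftrightarrow> X \<noteq> {} \<and> Y \<noteq> {} \<and> Z \<noteq> {} \<and> (\<forall>x\<in>X. \<forall>y\<in>Y. \<forall>z\<in>Z. x + y + z \<noteq> 0) \<and>
     int CARD('p) \<le> int (card X) + int (card Y) + int (card Z) + r"

lemma trio_swap:
  assumes "trio X Y Z r"
  shows "trio Y X Z r"
proof -
  have "y + x + z \<noteq> 0" if "x \<in> X" "y \<in> Y" "z \<in> Z" for x y z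
    using assms that by (auto simp: trio_def add.commute[of y])
  then show ?thesis using assms by (auto simp: trio_def)
qed

lemma trio_rotate:
  assumes "trio X Y Z r"
  shows "trio Y Z X r"
proof -
  have "y + z + x \<noteq> 0" if "x \<in> X" "y \<in> Y" "z \<in> Z" for x y z
    using assms that by (auto simp: trio_def add.commute[of _ x] add.assoc)
  then show ?thesis using assms by (auto simp: trio_def)
qed

lemma card_uminus_image [simp]: "card (uminus ` (X :: 'a::group_add set)) = card X"
  by (intro card_image) (auto simp: inj_on_def)

lemma trio_card_plus:
  assumes "trio X Y (Z :: 'p::prime_card mod_ring set) r"
  shows "card (X + Y) + card Z \<le> CARD('p)"
    and "int (card (X + Y)) \<le> int (card X) + int (card Y) + r"
    and "card (X + Y) < CARD('p)"
proof -
  have "(X + Y) \<inter> uminus ` Z = {}"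
  proof (rule ccontr)
    assume "\<not> ?thesis"
    then obtain z where z: "z \<in> Z" "-z \<in> X + Y" by auto
    from z(2) obtain x y where xy: "x \<in> X" "y \<in> Y" "-z = x + y" by (rule set_plus_memE)
    have "x + y + z = 0" unfolding xy(3)[symmetric] by simp
    moreover have "\<forall>x\<in>X. \<forall>y\<in>Y. \<forall>z\<in>Z. x + y + z \<noteq> 0" using assms by (simp add: trio_def)
    ultimately show False using xy z by blast
  qed
  then have "card (X + Y) + card (uminus ` Z) = card ((X + Y) \<union> uminus ` Z)"
    by (intro card_Un_disjoint[symmetric]) auto
  also have "\<dots> \<le> CARD('p)" by (rule card_mod_ring_le)
  finally show 1: "card (X + Y) + card Z \<le> CARD('p)" by simp
  then show "int (card (X + Y)) \<le> int (card X) + int (card Y) + r"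
    using assms by (auto simp: trio_def)
  have "card Z > 0" using assms by (auto simp: trio_def card_gt_0_iff)
  with 1 show "card (X + Y) < CARD('p)" by linarith
qed

lemma trio_complement:
  fixes X Y :: "'p::prime_card mod_ring set"
  assumes "X \<noteq> {}" "Y \<noteq> {}" "X + Y \<noteq> UNIV" "int (card (X + Y)) \<le> int (card X) + int (card Y) + r"
  shows "trio X Y (uminus ` (UNIV - (X + Y))) r"
    and "card (uminus ` (UNIV - (X + Y))) = CARD('p) - card (X + Y)"
proof -
  show c: "card (uminus ` (UNIV - (X + Y))) = CARD('p) - card (X + Y)"
    by (simp add: card_Diff_subset)
  have "x + y + z \<noteq> 0" if "x \<in> X" "y \<in> Y" "z \<in> uminus ` (UNIV - (X + Y))" for x y z
  proof
    assume "x + y + z = 0"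
    then have "x + y = - z" by (simp add: eq_neg_iff_add_eq_0)
    then show False using that set_plus_memI[OF that(1,2)] by auto
  qed
  moreover have "card (X + Y) \<le> CARD('p)" by (rule card_mod_ring_le)
  ultimately show "trio X Y (uminus ` (UNIV - (X + Y))) r"
    using assms c by (auto simp: trio_def)
qed

section \<open>Iterated sumsets and their growth\<close>

primrec nfold :: "nat \<Rightarrow> 'a::comm_monoid_add set \<Rightarrow> 'a set" where
  "nfold 0 X = {0}"
| "nfold (Suc n) X = X + nfold n X"

lemma nfold_add: "nfold (m + n) X = nfold m X + nfold n X"
proof (induction m)
  case 0
  show ?case by (auto simp: set_plus_def)
next
  case (Suc m)
  then show ?case by (simp add: add.assoc)
qed

lemma finite_nfold: "finite X \<Longrightarrow> finite (nfold n X)"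
  by (induction n) (auto intro: finite_set_plus)

lemma nfold_nonempty: "X \<noteq> {} \<Longrightarrow> nfold n X \<noteq> {}"
  by (induction n) (auto simp: set_plus_def)

lemma nfold_mono:
  assumes "X \<subseteq> Y"
  shows "nfold n X \<subseteq> nfold n Y"
proof (induction n)
  case (Suc n)
  show ?case unfolding nfold.simps by (rule set_plus_mono2[OF assms Suc])
qed simp

text \<open>Petridis' lemma, in the form that follows from minimising \<open>|X + Y'| - (1 + \<mu>) |Y'|\<close> instead of a ratio:
  larger \<open>\<mu>\<close> makes the extremal \<open>Y0\<close> larger.\<close>

lemma petridis_step:
  fixes X Y0 :: "'a::ab_group_add set"
  assumes fin: "finite X" "finite Y0" "finite S" and S: "S \<noteq> {}"
    and min: "\<And>Y1. Y1 \<subseteq> Y0 \<Longrightarrow> real (card (X + Y0)) - \<nu> * real (card Y0) \<le> real (card (X + Y1)) - \<nu> * real (card Y1)"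
  shows "real (card (X + (Y0 + S))) - \<nu> * real (card (Y0 + S)) \<le> real (card (X + Y0)) - \<nu> * real (card Y0)"
  using fin(3) S
proof (induction S rule: finite_ne_induct)
  case (singleton s)
  have "Y0 + {s} = (+) s ` Y0" by (auto simp: set_plus_image image_iff add.commute)
  then show ?case by (simp add: plus_translate_right)
next
  case (insert s S)
  define B where "B = Y0 + S"
  \<comment> \<open>\<open>Y1\<close> collects the points whose translates by \<open>s\<close> are
    already present. Adding \<open>s\<close> to \<open>S\<close> saves \<open>|Y1|\<close> points in
    \<open>Y0 + S\<close> and at least \<open>|X + Y1|\<close> points in the sum with
    \<open>X\<close>; the minimality of \<open>Y0\<close> against \<open>Y1\<close> balances the
    two.\<close>
  define Y1 where "Y1 = {y \<in> Y0. s + y \<in> B}"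
  have fB: "finite B" using fin insert by (simp add: B_def finite_set_plus)
  have e: "Y0 + insert s S = B \<union> (+) s ` Y0"
    by (auto simp: B_def set_plus_image image_iff add.commute)
  have i: "B \<inter> (+) s ` Y0 = (+) s ` Y1" by (auto simp: Y1_def)
  have "card (B \<union> (+) s ` Y0) + card (B \<inter> (+) s ` Y0) = card B + card ((+) s ` Y0)"
    using fB fin by (intro card_Un_Int[symmetric]) auto
  then have c1: "card (Y0 + insert s S) + card Y1 = card B + card Y0" using e i by simp
  have e2: "X + (Y0 + insert s S) = (X + B) \<union> (+) s ` (X + Y0)"
    unfolding e plus_translate_right[symmetric] by (auto simp: set_plus_image)
  have "(+) s ` (X + Y1) \<subseteq> (X + B) \<inter> (+) s ` (X + Y0)"
    unfolding plus_translate_right[symmetric] using i by (auto simp: set_plus_image)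
  then have "card ((+) s ` (X + Y1)) \<le> card ((X + B) \<inter> (+) s ` (X + Y0))"
    using fB fin by (intro card_mono) (auto intro: finite_set_plus)
  moreover have "card ((X + B) \<union> (+) s ` (X + Y0)) + card ((X + B) \<inter> (+) s ` (X + Y0)) = card (X + B) + card ((+) s ` (X + Y0))"
    using fB fin by (intro card_Un_Int[symmetric] finite_set_plus finite_imageI) auto
  ultimately have c2: "card (X + (Y0 + insert s S)) + card (X + Y1) \<le> card (X + B) + card (X + Y0)"
    using e2 by simp
  have "real (card (X + (Y0 + insert s S))) + real (card (X + Y1)) \<le> real (card (X + B)) + real (card (X + Y0))"
    using c2 unfolding of_nat_add[symmetric] by (rule of_nat_mono)
  moreover have "\<nu> * real (card (Y0 + insert s S)) + \<nu> * real (card Y1) = \<nu> * real (card B) + \<nu> * real (card Y0)"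
    unfolding distrib_left[symmetric] of_nat_add[symmetric] c1 ..
  moreover have "real (card (X + Y0)) - \<nu> * real (card Y0) \<le> real (card (X + Y1)) - \<nu> * real (card Y1)"
    by (rule min) (auto simp: Y1_def)
  ultimately show ?case using insert.IH unfolding B_def by linarith
qed

text \<open>\<open>petridis_step\<close> with \<open>S = nfold n X\<close> is an affine recursion
  with factor \<open>1 + \<mu>\<close> and constant term \<open>m - \<mu> |Y0|\<close>, where
  \<open>m = |X + Y0| - |Y0|\<close>; its solution is the geometric sum. The second conclusion later
  shows that \<open>Y0\<close> is almost all of \<open>Y\<close>.\<close>

lemma petridis:
  fixes X Y :: "'a::ab_group_add set"
  assumes fin: "finite X" "finite Y" and ne: "X \<noteq> {}" "Y \<noteq> {}"
    and \<mu>: "real (card (X + Y)) \<le> (1 + \<mu>) * real (card Y)"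
  obtains Y0 where "Y0 \<subseteq> Y" "Y0 \<noteq> {}"
    "real (card (X + Y0)) - (1 + \<mu>) * real (card Y0) \<le> real (card (X + Y)) - (1 + \<mu>) * real (card Y)"
    "\<And>n. real (card (nfold n X + Y0)) \<le> real (card Y0) + (real (card (X + Y0)) - real (card Y0)) * (\<Sum>i<n. (1 + \<mu>) ^ i)"
proof -
  define \<Phi> where "\<Phi> = (\<lambda>Y'. real (card (X + Y')) - (1 + \<mu>) * real (card Y'))"
  define P where "P = {Y'. Y' \<subseteq> Y \<and> Y' \<noteq> {}}"
  have finP: "finite P" using fin by (auto simp: P_def intro: finite_subset[of _ "Pow Y"])
  have YP: "Y \<in> P" using ne by (simp add: P_def)
  have "Min (\<Phi> ` P) \<in> \<Phi> ` P" using finP YP by (intro Min_in) auto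
  then obtain Y0 where Y0: "Y0 \<in> P" "\<Phi> Y0 = Min (\<Phi> ` P)" by auto
  have min: "\<Phi> Y0 \<le> \<Phi> Y'" if "Y' \<in> P" for Y' using that finP Y0 by simp
  have "\<Phi> Y \<le> 0" using \<mu> by (simp add: \<Phi>_def)
  then have neg: "\<Phi> Y0 \<le> 0" using min[OF YP] by simp
  have min': "\<Phi> Y0 \<le> \<Phi> Y1" if "Y1 \<subseteq> Y0" for Y1
  proof (cases "Y1 = {}")
    case True
    have "X + Y1 = {}" using True by (auto simp: set_plus_def)
    then show ?thesis using neg True by (simp add: \<Phi>_def)
  next
    case False
    then show ?thesis using that Y0 by (intro min) (auto simp: P_def)
  qed
  have Y0Y: "Y0 \<subseteq> Y" "Y0 \<noteq> {}" using Y0 by (auto simp: P_def)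
  have finY0: "finite Y0" using Y0Y fin finite_subset by blast
  have step: "real (card (X + (Y0 + S))) \<le> (1 + \<mu>) * real (card (Y0 + S)) + \<Phi> Y0"
    if "finite S" "S \<noteq> {}" for S
    using petridis_step[OF fin(1) finY0 that, of "1 + \<mu>"] min' by (simp add: \<Phi>_def)
  define m where "m = real (card (X + Y0)) - real (card Y0)"
  have \<Phi>m: "\<Phi> Y0 = m - \<mu> * real (card Y0)" by (simp add: \<Phi>_def m_def algebra_simps)
  have bound: "real (card (nfold n X + Y0)) \<le> real (card Y0) + m * (\<Sum>i<n. (1 + \<mu>) ^ i)" for n
  proof (induction n)
    case 0
    have "{0} + Y0 = Y0" by (auto simp: set_plus_def)
    then show ?case by simp
  next
    case (Suc n)
    have "nfold (Suc n) X + Y0 = X + (Y0 + nfold n X)" by (simp only: nfold.simps add.assoc add.commute[of "nfold n X" Y0])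
    then have "real (card (nfold (Suc n) X + Y0)) \<le> (1 + \<mu>) * real (card (Y0 + nfold n X)) + \<Phi> Y0"
      using step[OF finite_nfold[OF fin(1)] nfold_nonempty[OF ne(1)]] by simp
    also have "\<dots> = (1 + \<mu>) * real (card (nfold n X + Y0)) + \<Phi> Y0" by (simp add: add.commute)
    also have "\<dots> \<le> (1 + \<mu>) * (real (card Y0) + m * (\<Sum>i<n. (1 + \<mu>) ^ i)) + \<Phi> Y0"
    proof -
      have "real (card Y) > 0" using ne fin by (simp add: card_gt_0_iff)
      moreover have "0 \<le> (1 + \<mu>) * real (card Y)" using \<mu> of_nat_0_le_iff order_trans by blast
      ultimately have "0 \<le> 1 + \<mu>" by (simp add: zero_le_mult_iff)
      then show ?thesis using Suc by (simp add: mult_left_mono)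
    qed
    also have "\<dots> = real (card Y0) + m * (1 + (1 + \<mu>) * (\<Sum>i<n. (1 + \<mu>) ^ i))"
      unfolding \<Phi>m by (simp add: algebra_simps)
    also have "1 + (1 + \<mu>) * (\<Sum>i<n. (1 + \<mu>) ^ i) = (\<Sum>i<Suc n. (1 + \<mu>) ^ i)"
      by (subst sum.lessThan_Suc_shift) (simp add: sum_distrib_left)
    finally show ?case .
  qed
  show ?thesis
    using that[OF Y0Y] min[OF YP] bound by (simp add: \<Phi>_def m_def)
qed

section \<open>Rectification by Fourier analysis\<close>

definition chi :: "'p::prime_card mod_ring \<Rightarrow> complex" where
  "chi x = cis (2 * pi * real_of_int (to_int_mod_ring x) / real CARD('p))"

lemma cis_period: "cis (2 * pi * real_of_int (a mod b) / real_of_int b) = cis (2 * pi * real_of_int a / real_of_int b)"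
proof (cases "b = 0")
  case False
  have "real_of_int a = real_of_int (b * (a div b) + a mod b)" by simp
  also have "\<dots> = real_of_int b * real_of_int (a div b) + real_of_int (a mod b)"
    by (simp only: of_int_add of_int_mult)
  finally have "real_of_int a = real_of_int b * real_of_int (a div b) + real_of_int (a mod b)" .
  then have e: "2 * pi * real_of_int a / real_of_int b
      = 2 * pi * real_of_int (a mod b) / real_of_int b + 2 * pi * real_of_int (a div b)"
    using False by (simp add: field_simps)
  show ?thesis unfolding e cis_mult[symmetric] by simp
qed simp

lemma chi_add: "chi (x + y :: 'p::prime_card mod_ring) = chi x * chi y"
proof -
  have "chi (x + y) = cis (2 * pi * real_of_int (to_int_mod_ring x + to_int_mod_ring y) / real_of_int (int CARD('p)))"
    unfolding chi_def to_int_mod_ring_add using cis_period[of "to_int_mod_ring x + to_int_mod_ring y" "int CARD('p)"] by simp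
  also have "\<dots> = chi x * chi y"
    unfolding chi_def cis_mult by (simp add: add_divide_distrib distrib_left)
  finally show ?thesis .
qed

lemma chi_0 [simp]: "chi 0 = 1"
  by (simp add: chi_def)

lemma norm_chi [simp]: "cmod (chi x) = 1"
  by (simp add: chi_def)

lemma chi_eq_1_iff: "chi (x :: 'p::prime_card mod_ring) = 1 \<longleftrightarrow> x = 0"
proof
  define k where "k = to_int_mod_ring x"
  have k: "0 \<le> k" "k < int CARD('p)"
    using range_to_int_mod_ring[where 'a='p] rangeI[of to_int_mod_ring x] by (auto simp: k_def)
  assume "chi x = 1"
  then have "Re (chi x) = 1" by simp
  then have "cos (2 * pi * real_of_int k / real CARD('p)) = 1" by (simp add: chi_def k_def)
  then obtain n :: int where "2 * pi * real_of_int k / real CARD('p) = real_of_int n * 2 * pi"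
    using cos_one_2pi_int by blast
  then have "real_of_int k = real_of_int n * real CARD('p)" by (simp add: field_simps)
  then have "real_of_int k = real_of_int (n * int CARD('p))" by simp
  then have kn: "k = n * int CARD('p)" by (simp only: of_int_eq_iff)
  have "n = 0"
  proof (rule ccontr)
    assume "n \<noteq> 0"
    then consider "n \<ge> 1" | "n \<le> -1" by linarith
    then show False
    proof cases
      case 1
      then have "1 * int CARD('p) \<le> n * int CARD('p)" by (intro mult_right_mono) auto
      then show False using kn k by linarith
    next
      case 2
      then have "n * int CARD('p) < 0" by (intro mult_neg_pos) auto
      then show False using kn k by linarith
    qed
  qed
  then show "x = 0" using kn by (simp add: k_def)
qed simp

lemma cnj_chi: "cnj (chi x) = chi (- x)"
proof -
  have "chi x * chi (- x) = 1" by (simp add: chi_add[symmetric])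
  moreover have "chi x * cnj (chi x) = 1" by (simp add: complex_norm_square[symmetric])
  moreover have "chi x \<noteq> 0" using norm_chi[of x] by force
  ultimately have "chi x * cnj (chi x) = chi x * chi (- x)" "chi x \<noteq> 0" by simp_all
  then show ?thesis by simp
qed

lemma sum_chi:
  "(\<Sum>t\<in>UNIV. chi (t * u)) = (if u = 0 then of_nat CARD('p) else 0)" for u :: "'p::prime_card mod_ring"
proof (cases "u = 0")
  case False
  define s where "s = (\<Sum>t\<in>UNIV. chi (t * u))"
  have "s * chi u = (\<Sum>t\<in>UNIV. chi ((t + 1) * u))"
    unfolding s_def sum_distrib_right by (simp add: chi_add distrib_right)
  also have "\<dots> = s"
    unfolding s_def
    by (rule sum.reindex_bij_witness[of _ "\<lambda>t. t - 1" "\<lambda>t. t + 1"]) auto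
  finally have "s * (chi u - 1) = 0" by (simp add: algebra_simps)
  then show ?thesis using False chi_eq_1_iff[of u] by (simp add: s_def)
qed simp

definition fourier :: "'p::prime_card mod_ring set \<Rightarrow> 'p mod_ring \<Rightarrow> complex" where
  "fourier X t = (\<Sum>x\<in>X. chi (t * x))"

lemma fourier_0: "fourier X 0 = of_nat (card X)"
  by (simp add: fourier_def)

lemma parseval:
  fixes X :: "'p::prime_card mod_ring set"
  shows "(\<Sum>t\<in>UNIV. (cmod (fourier X t))\<^sup>2) = real CARD('p) * real (card X)"
proof -
  have "complex_of_real (\<Sum>t\<in>UNIV. (cmod (fourier X t))\<^sup>2) = (\<Sum>t\<in>UNIV. fourier X t * cnj (fourier X t))"
    by (simp only: of_real_sum complex_norm_square)
  also have "\<dots> = (\<Sum>t\<in>UNIV. \<Sum>x\<in>X. \<Sum>x'\<in>X. chi (t * (x - x')))"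
    unfolding fourier_def by (simp add: sum_product cnj_chi chi_add[symmetric] right_diff_distrib)
  also have "\<dots> = (\<Sum>x\<in>X. \<Sum>t\<in>UNIV. \<Sum>x'\<in>X. chi (t * (x - x')))" by (rule sum.swap)
  also have "\<dots> = (\<Sum>x\<in>X. \<Sum>x'\<in>X. \<Sum>t\<in>UNIV. chi (t * (x - x')))"
    by (rule sum.cong[OF refl], rule sum.swap)
  also have "\<dots> = (\<Sum>x\<in>X. \<Sum>x'\<in>X. if x = x' then of_nat CARD('p) else 0)"
    by (simp add: sum_chi)
  also have "\<dots> = of_nat CARD('p) * of_nat (card X)" by (simp add: sum.delta)
  finally have "complex_of_real (\<Sum>t\<in>UNIV. (cmod (fourier X t))\<^sup>2) = complex_of_real (real CARD('p) * real (card X))"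
    by simp
  then show ?thesis by (simp only: of_real_eq_iff)
qed

lemma sum_fourier_triple:
  fixes X Y Z :: "'p::prime_card mod_ring set"
  assumes "\<forall>x\<in>X. \<forall>y\<in>Y. \<forall>z\<in>Z. x + y + z \<noteq> 0"
  shows "(\<Sum>t\<in>UNIV. fourier X t * (fourier Y t * fourier Z t)) = 0"
proof -
  have "(\<Sum>t\<in>UNIV. fourier X t * (fourier Y t * fourier Z t))
      = (\<Sum>t\<in>UNIV. \<Sum>x\<in>X. \<Sum>y\<in>Y. \<Sum>z\<in>Z. chi (t * (x + y + z)))"
    unfolding fourier_def
    by (simp only: sum_product, simp only: sum_distrib_left, simp add: chi_add distrib_left mult.assoc)
  also have "\<dots> = (\<Sum>x\<in>X. \<Sum>t\<in>UNIV. \<Sum>y\<in>Y. \<Sum>z\<in>Z. chi (t * (x + y + z)))" by (rule sum.swap)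
  also have "\<dots> = (\<Sum>x\<in>X. \<Sum>y\<in>Y. \<Sum>t\<in>UNIV. \<Sum>z\<in>Z. chi (t * (x + y + z)))"
    by (rule sum.cong[OF refl], rule sum.swap)
  also have "\<dots> = (\<Sum>x\<in>X. \<Sum>y\<in>Y. \<Sum>z\<in>Z. \<Sum>t\<in>UNIV. chi (t * (x + y + z)))"
    by (rule sum.cong[OF refl], rule sum.cong[OF refl], rule sum.swap)
  also have "\<dots> = 0" using assms by (simp add: sum_chi)
  finally show ?thesis .
qed

text \<open>Frequency \<open>0\<close> contributes \<open>|X| |Y| |Z|\<close> to a vanishing sum, so
  the others must cancel it. Cauchy-Schwarz over them and Parseval for \<open>Y\<close> and
  \<open>Z\<close> give \<open>|X|^2 |Y| |Z| <= M^2 (p - |Y|) (p - |Z|)\<close>, where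
  \<open>M\<close> is the largest nontrivial coefficient of \<open>X\<close>.\<close>

lemma large_fourier_coefficient:
  fixes X Y Z :: "'p::prime_card mod_ring set"
  assumes t: "trio X Y Z r" and m: "real m = real (card X) + real_of_int r"
    and m2: "m \<le> card Y" "2 * card Y \<le> CARD('p)"
  obtains t where "t \<noteq> 0" "(real (card Y) - real m) * real (card X) \<le> cmod (fourier X t) * real (card Y)"
proof -
  define x y z p where "x = real (card X)" and "y = real (card Y)" and "z = real (card Z)" and "p = real CARD('p)"
  define T where "T = UNIV - {0 :: 'p mod_ring}"
  have pos: "x > 0" "y > 0" "z > 0" using t by (auto simp: trio_def x_def y_def z_def card_gt_0_iff)
  have "1 \<in> T" by (simp add: T_def)
  then have T: "finite T" "T \<noteq> {}" by auto
  have "Max ((\<lambda>t. cmod (fourier X t)) ` T) \<in> (\<lambda>t. cmod (fourier X t)) ` T"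
    using T by (intro Max_in) auto
  then obtain t0 where t0: "t0 \<in> T" "cmod (fourier X t0) = Max ((\<lambda>t. cmod (fourier X t)) ` T)" by auto
  define M where "M = cmod (fourier X t0)"
  have M: "cmod (fourier X t) \<le> M" if "t \<in> T" for t using that T t0 by (simp add: M_def)
  have M0: "M \<ge> 0" by (simp add: M_def)
  have parT: "(\<Sum>t\<in>T. (cmod (fourier W t))\<^sup>2) = real (card W) * (p - real (card W))" for W :: "'p mod_ring set"
  proof -
    have "p * real (card W) = (cmod (fourier W 0))\<^sup>2 + (\<Sum>t\<in>T. (cmod (fourier W t))\<^sup>2)"
      unfolding T_def p_def parseval[symmetric] by (rule sum.remove) auto
    then show ?thesis by (simp add: fourier_0 power2_eq_square algebra_simps)
  qed
  have "fourier X 0 * (fourier Y 0 * fourier Z 0) + (\<Sum>t\<in>T. fourier X t * (fourier Y t * fourier Z t))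
      = (\<Sum>t\<in>UNIV. fourier X t * (fourier Y t * fourier Z t))"
    unfolding T_def by (rule sum.remove[symmetric]) auto
  also have "\<dots> = 0" using t by (intro sum_fourier_triple) (simp add: trio_def)
  finally have "(\<Sum>t\<in>T. fourier X t * (fourier Y t * fourier Z t)) = - (fourier X 0 * (fourier Y 0 * fourier Z 0))"
    by (simp only: eq_neg_iff_add_eq_0 add.commute)
  then have "cmod (\<Sum>t\<in>T. fourier X t * (fourier Y t * fourier Z t)) = cmod (fourier X 0 * (fourier Y 0 * fourier Z 0))"
    by (simp only: norm_minus_cancel)
  then have "x * y * z = cmod (\<Sum>t\<in>T. fourier X t * (fourier Y t * fourier Z t))"
    by (simp add: fourier_0 norm_mult x_def y_def z_def)
  also have "\<dots> \<le> (\<Sum>t\<in>T. M * (cmod (fourier Y t) * cmod (fourier Z t)))"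
  proof (rule sum_norm_le)
    fix t assume "t \<in> T"
    then show "cmod (fourier X t * (fourier Y t * fourier Z t)) \<le> M * (cmod (fourier Y t) * cmod (fourier Z t))"
      unfolding norm_mult by (intro mult_right_mono M) simp_all
  qed
  finally have "x * y * z \<le> M * (\<Sum>t\<in>T. cmod (fourier Y t) * cmod (fourier Z t))" by (simp add: sum_distrib_left)
  then have "(x * y * z)\<^sup>2 \<le> (M * (\<Sum>t\<in>T. cmod (fourier Y t) * cmod (fourier Z t)))\<^sup>2"
    using pos by (intro power_mono) auto
  also have "\<dots> \<le> M\<^sup>2 * ((\<Sum>t\<in>T. (cmod (fourier Y t))\<^sup>2) * (\<Sum>t\<in>T. (cmod (fourier Z t))\<^sup>2))"
    unfolding power_mult_distrib by (intro mult_left_mono Cauchy_Schwarz_ineq_sum) auto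
  also have "\<dots> = M\<^sup>2 * (y * (p - y) * (z * (p - z)))" unfolding parT y_def z_def ..
  also have "\<dots> = (M\<^sup>2 * ((p - y) * (p - z))) * (y * z)" by (simp only: ac_simps)
  also have "(x * y * z)\<^sup>2 = (x\<^sup>2 * (y * z)) * (y * z)" by (simp only: power2_eq_square ac_simps)
  finally have 1: "x\<^sup>2 * (y * z) \<le> M\<^sup>2 * ((p - y) * (p - z))"
    by (rule mult_right_le_imp_le) (use pos in simp)
  have pz: "p - z \<le> y + real m"
  proof -
    have "real_of_int (int CARD('p)) \<le> real_of_int (int (card X) + int (card Y) + int (card Z) + r)"
      using t unfolding trio_def by (simp only: of_int_le_iff)
    then show ?thesis using m by (simp add: p_def y_def z_def)
  qed
  have py: "y \<le> p - y" using m2(2) unfolding y_def p_def by linarith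
  have my: "0 \<le> real m" "real m \<le> y" using m2 by (auto simp: y_def)
  \<comment> \<open>By \<open>p - z <= y + m\<close> and \<open>y <= p - y\<close> the factor
    \<open>p - y\<close> will cancel, which leaves
    \<open>x^2 (y - m) <= M^2 (y + m)\<close>.\<close>
  have "(p - y) * (y - real m) \<le> y * z"
  proof -
    have "(p - y) * (y - real m) = y * (p - y) - real m * (p - y)" by (simp add: algebra_simps)
    also have "\<dots> \<le> y * (p - y) - real m * y" using py my by (simp add: mult_left_mono)
    also have "\<dots> = y * (p - y - real m)" by (simp add: algebra_simps)
    also have "\<dots> \<le> y * z" using pz pos by (intro mult_left_mono) auto
    finally show ?thesis .
  qed
  then have "x\<^sup>2 * ((p - y) * (y - real m)) \<le> x\<^sup>2 * (y * z)" by (intro mult_left_mono) auto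
  also note 1
  also have "M\<^sup>2 * ((p - y) * (p - z)) \<le> M\<^sup>2 * ((p - y) * (y + real m))"
    using pz py pos by (intro mult_left_mono) auto
  also have "M\<^sup>2 * ((p - y) * (y + real m)) = (M\<^sup>2 * (y + real m)) * (p - y)" by (simp only: ac_simps)
  also have "x\<^sup>2 * ((p - y) * (y - real m)) = (x\<^sup>2 * (y - real m)) * (p - y)" by (simp only: ac_simps)
  finally have "x\<^sup>2 * (y - real m) \<le> M\<^sup>2 * (y + real m)"
    by (rule mult_right_le_imp_le) (use py pos in linarith)
  \<comment> \<open>Multiplying by \<open>y - m\<close> and dropping \<open>m^2\<close> from
    \<open>y^2 - m^2\<close> makes both sides perfect squares.\<close>
  then have "(x\<^sup>2 * (y - real m)) * (y - real m) \<le> (M\<^sup>2 * (y + real m)) * (y - real m)"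
    using my by (intro mult_right_mono) auto
  also have "\<dots> = M\<^sup>2 * (y\<^sup>2 - (real m)\<^sup>2)" by (simp add: power2_eq_square algebra_simps)
  also have "\<dots> \<le> M\<^sup>2 * y\<^sup>2" by (intro mult_left_mono) auto
  also have "(x\<^sup>2 * (y - real m)) * (y - real m) = ((y - real m) * x)\<^sup>2" by (simp only: power2_eq_square ac_simps)
  also have "M\<^sup>2 * y\<^sup>2 = (M * y)\<^sup>2" by (simp only: power_mult_distrib)
  finally have "(y - real m) * x \<le> M * y" by (rule power2_le_imp_le) (use M0 pos in simp)
  then show ?thesis using that[of t0] t0 by (simp add: T_def M_def x_def y_def)
qed

lemma near_multiple_of_cos_large:
  assumes j: "j \<ge> 1" and c: "cos \<theta> > cos (pi / real j)"
  obtains q :: int where "\<bar>\<theta> - 2 * pi * real_of_int q\<bar> < pi / real j"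
proof -
  define q where "q = round (\<theta> / (2 * pi))"
  define \<theta>' where "\<theta>' = \<theta> - 2 * pi * real_of_int q"
  have "\<bar>real_of_int q - \<theta> / (2 * pi)\<bar> \<le> 1 / 2" unfolding q_def by (rule of_int_round_abs_le)
  then have "\<bar>2 * pi * (real_of_int q - \<theta> / (2 * pi))\<bar> \<le> pi" unfolding abs_mult by simp
  moreover have "2 * pi * (real_of_int q - \<theta> / (2 * pi)) = - \<theta>'" by (simp add: \<theta>'_def field_simps)
  ultimately have b: "\<bar>\<theta>'\<bar> \<le> pi" by simp
  have "cos \<theta>' = cos \<theta>" unfolding \<theta>'_def cos_diff by simp
  then have "cos \<bar>\<theta>'\<bar> > cos (pi / real j)" using c by (simp add: cos_abs_real)
  moreover have "0 \<le> pi / real j" "pi / real j \<le> pi" using j by (auto simp: field_simps)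
  ultimately have "\<bar>\<theta>'\<bar> < pi / real j" using b cos_mono_less_eq[of "pi / real j" "\<bar>\<theta>'\<bar>"] by simp
  then show ?thesis using that by (simp add: \<theta>'_def)
qed

text \<open>After a rotation the coefficient is a sum of cosines. A point with cosine at most
  \<open>cos (pi / j)\<close> costs \<open>1 - cos (pi / j)\<close>, and the coefficient is close to
  \<open>|X|\<close>, so there are few such points. The phases of the others lie within
  \<open>pi / j\<close> of the mean direction, an arc of \<open>p / j\<close> residues, which
  division by the frequency \<open>t\<close> turns into a progression.\<close>

lemma rectification_arc:
  fixes X Y Z :: "'p::prime_card mod_ring set" and j :: nat
  assumes t: "trio X Y Z r" and m: "real m = real (card X) + real_of_int r"
    and m2: "m \<le> card Y" "2 * card Y \<le> CARD('p)" and j: "j \<ge> 1"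
  obtains a d where "d \<noteq> 0"
    "(1 - cos (pi / real j)) * (real (card X) - real (card {x \<in> X. \<exists>i. 0 \<le> i \<and> i \<le> int (CARD('p) div j) \<and> x = a + of_int i * d}))
        * real (card Y) \<le> real m * real (card X)"
proof -
  define p where "p = real CARD('p)"
  have p: "p > 0" by (simp add: p_def)
  obtain t where t: "t \<noteq> 0" and big: "(real (card Y) - real m) * real (card X) \<le> cmod (fourier X t) * real (card Y)"
    using large_fourier_coefficient[OF t m m2] .
  define \<phi> where "\<phi> = Arg (fourier X t)"
  define k where "k = (\<lambda>x. to_int_mod_ring (t * x))"
  define g where "g = (\<lambda>x. cos (2 * pi * real_of_int (k x) / p - \<phi>))"
  define S where "S = {x \<in> X. g x > cos (pi / real j)}"
  have "complex_of_real (cmod (fourier X t)) = fourier X t * cis (- \<phi>)"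
  proof -
    have "fourier X t = of_real (cmod (fourier X t)) * cis \<phi>" unfolding \<phi>_def rcis_def[symmetric] rcis_cmod_Arg ..
    then have "fourier X t * cis (- \<phi>) = (of_real (cmod (fourier X t)) * cis \<phi>) * cis (- \<phi>)" by simp
    also have "\<dots> = of_real (cmod (fourier X t))" by (simp add: cis_mult mult.assoc)
    finally show ?thesis ..
  qed
  also have "\<dots> = (\<Sum>x\<in>X. cis (2 * pi * real_of_int (k x) / p - \<phi>))"
    unfolding fourier_def sum_distrib_right chi_def cis_mult k_def p_def by simp
  finally have "Re (complex_of_real (cmod (fourier X t))) = Re (\<Sum>x\<in>X. cis (2 * pi * real_of_int (k x) / p - \<phi>))"
    by (rule arg_cong)
  then have "cmod (fourier X t) = (\<Sum>x\<in>X. g x)" by (simp add: g_def)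
  also have "\<dots> = (\<Sum>x\<in>S. g x) + (\<Sum>x\<in>X - S. g x)"
    by (subst sum.subset_diff[of S X]) (auto simp: S_def)
  also have "\<dots> \<le> (\<Sum>x\<in>S. 1) + (\<Sum>x\<in>X - S. cos (pi / real j))"
    by (intro add_mono sum_mono) (auto simp: S_def g_def)
  also have "\<dots> = real (card S) + (real (card X) - real (card S)) * cos (pi / real j)"
  proof -
    have "card (X - S) = card X - card S" "card S \<le> card X"
      by (auto simp: S_def intro!: card_Diff_subset card_mono)
    then show ?thesis by (simp add: of_nat_diff)
  qed
  finally have F: "cmod (fourier X t) \<le> real (card S) + (real (card X) - real (card S)) * cos (pi / real j)" .
  \<comment> \<open>Lower end of the open arc of length \<open>p / j\<close> centred at the phase of
    the coefficient; the progression starts at the first integer above it.\<close>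
  define L where "L = p * \<phi> / (2 * pi) - p / (2 * real j)"
  define k0 where "k0 = \<lfloor>L\<rfloor> + 1"
  define d where "d = inverse t"
  define a where "a = of_int k0 * d"
  have SA: "S \<subseteq> {x \<in> X. \<exists>i. 0 \<le> i \<and> i \<le> int (CARD('p) div j) \<and> x = a + of_int i * d}"
  proof
    fix x assume x: "x \<in> S"
    then obtain q :: int where q: "\<bar>2 * pi * real_of_int (k x) / p - \<phi> - 2 * pi * real_of_int q\<bar> < pi / real j"
      using near_multiple_of_cos_large[OF j, of "2 * pi * real_of_int (k x) / p - \<phi>"] by (auto simp: S_def g_def)
    define k' where "k' = k x - int CARD('p) * q"
    have "2 * pi / p * (real_of_int k' - p * \<phi> / (2 * pi)) = 2 * pi * real_of_int (k x) / p - \<phi> - 2 * pi * real_of_int q"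
      using p by (simp add: k'_def p_def field_simps)
    then have "2 * pi / p * \<bar>real_of_int k' - p * \<phi> / (2 * pi)\<bar> < pi / real j"
      using q p by (simp add: abs_mult[symmetric] abs_mult_pos)
    then have "\<bar>real_of_int k' - p * \<phi> / (2 * pi)\<bar> < p / (2 * real j)"
      using p j by (simp add: field_simps)
    moreover have "p / real j = 2 * (p / (2 * real j))" by simp
    ultimately have k': "L < real_of_int k'" "real_of_int k' < L + p / real j"
      unfolding L_def by linarith+
    have "k0 \<le> k'" using k'(1) floor_less_iff[of L k'] unfolding k0_def by linarith
    moreover have "k' - k0 \<le> int (CARD('p) div j)"
    proof -
      have "L < real_of_int k0" unfolding k0_def by simp
      then have "real_of_int (k' - k0) < p / real j" using k' by simp
      then have "real_of_int (k' - k0) * real j < real CARD('p)" using j by (simp add: p_def field_simps)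
      then have "real_of_int ((k' - k0) * int j) < real_of_int (int CARD('p))" by simp
      then have "(k' - k0) * int j < int CARD('p)" by (simp only: of_int_less_iff)
      then have "k' - k0 \<le> int CARD('p) div int j" 
        using zdiv_mono1[of "(k' - k0) * int j" "int CARD('p)" "int j"] j by simp
      then show ?thesis by (simp add: zdiv_int)
    qed
    moreover have "x = a + of_int (k' - k0) * d"
    proof -
      have "of_int k' = t * x"
        by (simp add: k'_def k_def of_int_of_int_mod_ring[symmetric]) (simp add: of_int_of_int_mod_ring)
      then show ?thesis using t by (simp add: a_def d_def algebra_simps)
    qed
    ultimately show "x \<in> {x \<in> X. \<exists>i. 0 \<le> i \<and> i \<le> int (CARD('p) div j) \<and> x = a + of_int i * d}"
      using x by (intro CollectI conjI exI[of _ "k' - k0"]) (auto simp: S_def)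
  qed
  define A where "A = {x \<in> X. \<exists>i. 0 \<le> i \<and> i \<le> int (CARD('p) div j) \<and> x = a + of_int i * d}"
  have cSA: "real (card S) \<le> real (card A)" using SA by (auto simp: A_def intro!: card_mono)
  have "(1 - cos (pi / real j)) * (real (card X) - real (card A)) \<le> (1 - cos (pi / real j)) * (real (card X) - real (card S))"
    using cSA by (intro mult_left_mono) auto
  also have "\<dots> \<le> real (card X) - cmod (fourier X t)" using F by (simp add: algebra_simps)
  finally have "(1 - cos (pi / real j)) * (real (card X) - real (card A)) * real (card Y) \<le> (real (card X) - cmod (fourier X t)) * real (card Y)"
    by (intro mult_right_mono) auto
  also have "\<dots> \<le> real m * real (card X)" using big by (simp add: algebra_simps)
  finally show ?thesis using that[of d a] t by (simp add: d_def A_def)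
qed

section \<open>Arithmetic progressions modulo a prime\<close>

definition apmap :: "'p::prime_card mod_ring \<Rightarrow> 'p mod_ring \<Rightarrow> int \<Rightarrow> 'p mod_ring" where
  "apmap a d i = a + of_int i * d"

text \<open>Beware of the indexing: the progression in \<open>in_ap d L X\<close> has \<open>L + 1\<close> terms.\<close>

definition in_ap :: "'p::prime_card mod_ring \<Rightarrow> int \<Rightarrow> 'p mod_ring set \<Rightarrow> bool" where
  "in_ap d L X \<longleftrightarrow> (\<exists>a. X \<subseteq> apmap a d ` {0..L})"

lemma apmap_add: "apmap a d i + apmap b d j = apmap (a + b) d (i + j)"
  by (simp add: apmap_def distrib_right)

lemma apmap_shift: "apmap a d (s + i) = apmap (apmap a d s) d i"
  by (simp add: apmap_def distrib_right)

lemma apmap_eq_iff: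
  fixes a d :: "'p::prime_card mod_ring"
  assumes "d \<noteq> 0"
  shows "apmap a d i = apmap a d j \<longleftrightarrow> i mod int CARD('p) = j mod int CARD('p)"
  using assms by (simp add: apmap_def of_int_mod_ring_eq_iff)

lemma inj_on_apmap:
  fixes a d :: "'p::prime_card mod_ring"
  assumes d: "d \<noteq> 0" and S: "S \<subseteq> {u..v}" "v - u < int CARD('p)"
  shows "inj_on (apmap a d) S"
proof (rule inj_onI)
  fix i j assume ij: "i \<in> S" "j \<in> S" "apmap a d i = apmap a d j"
  then have "int CARD('p) dvd i - j" using apmap_eq_iff[OF d] by (simp add: mod_eq_dvd_iff)
  moreover have "\<bar>i - j\<bar> < int CARD('p)" 
  proof -
    have "u \<le> i" "i \<le> v" "u \<le> j" "j \<le> v" using ij S(1) by auto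
    then show ?thesis using S(2) by linarith
  qed
  ultimately show "i = j" using dvd_imp_le_int[of "i - j" "int CARD('p)"] by fastforce
qed

lemma card_apmap:
  fixes a d :: "'p::prime_card mod_ring"
  assumes "d \<noteq> 0" "S \<subseteq> {u..v}" "v - u < int CARD('p)"
  shows "card (apmap a d ` S) = card S"
  by (rule card_image[OF inj_on_apmap[OF assms]])

lemma apmap_plus: "apmap a d ` I + apmap b d ` J = apmap (a + b) d ` (I + J)"
proof (intro equalityI subsetI)
  fix x assume "x \<in> apmap a d ` I + apmap b d ` J"
  then obtain s t where st: "s \<in> apmap a d ` I" "t \<in> apmap b d ` J" "x = s + t" by (rule set_plus_memE)
  then obtain i j where "i \<in> I" "j \<in> J" "x = apmap a d i + apmap b d j" by blast
  then show "x \<in> apmap (a + b) d ` (I + J)" unfolding apmap_add by (intro image_eqI[OF _ set_plus_memI]) simp_all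
next
  fix x assume "x \<in> apmap (a + b) d ` (I + J)"
  then obtain k where k: "k \<in> I + J" "x = apmap (a + b) d k" by blast
  from k(1) obtain i j where ij: "i \<in> I" "j \<in> J" "k = i + j" by (rule set_plus_memE)
  have "apmap a d i + apmap b d j \<in> apmap a d ` I + apmap b d ` J" using ij by (intro set_plus_memI imageI)
  then show "x \<in> apmap a d ` I + apmap b d ` J" using ij k by (simp add: apmap_add)
qed

lemma nfold_apmap: "nfold n (apmap a d ` I) = apmap (of_nat n * a) d ` nfold n I"
proof (induction n)
  case (Suc n)
  then show ?case by (simp add: apmap_plus distrib_right)
qed (simp add: apmap_def)

lemma apmap_surj:
  fixes a d :: "'p::prime_card mod_ring"
  assumes "d \<noteq> 0"
  shows "\<exists>i. u \<le> i \<and> i < u + int CARD('p) \<and> x = apmap a d i"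
proof -
  obtain k where k: "(x - apmap a d u) / d = of_int k" "0 \<le> k" "k < int CARD('p)"
    using of_int_mod_ring_surj[of "(x - apmap a d u) / d"] by blast
  have "x = apmap a d u + ((x - apmap a d u) / d) * d" using assms by simp
  then have "x = apmap a d (u + k)" unfolding k(1) by (simp add: apmap_def distrib_right)
  then show ?thesis using k by (intro exI[of _ "u + k"]) simp
qed

lemma ap_hull:
  fixes X :: "'p::prime_card mod_ring set"
  assumes X: "X \<noteq> {}" "X \<subseteq> apmap a d ` {u..v}" and d: "d \<noteq> 0" and uv: "v - u < int CARD('p)"
  obtains a' I l where "X = apmap a' d ` I" "I \<subseteq> {0..l}" "0 \<in> I" "l \<in> I" "0 \<le> l" "l \<le> v - u"
    "card I = card X" "int (card X) \<le> l + 1"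
proof -
  define I0 where "I0 = {i \<in> {u..v}. apmap a d i \<in> X}"
  have "finite I0" unfolding I0_def by (rule finite_subset[of _ "{u..v}"]) auto
  moreover have XI: "X = apmap a d ` I0" using X(2) by (auto simp: I0_def)
  ultimately have I0: "finite I0" "I0 \<noteq> {}" using X by auto
  define s t where "s = Min I0" and "t = Max I0"
  have st: "s \<in> I0" "t \<in> I0" unfolding s_def t_def using I0 by (auto intro: Min_in Max_in)
  have b: "s \<le> i" "i \<le> t" if "i \<in> I0" for i using that I0 by (auto simp: s_def t_def)
  define I where "I = (\<lambda>i. i - s) ` I0"
  have e: "apmap (apmap a d s) d ` I = X"
    unfolding I_def XI image_image apmap_shift[symmetric] by simp
  have I: "I \<subseteq> {0..t - s}" "0 \<in> I" "t - s \<in> I"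
    using st b by (auto simp: I_def image_iff)
  have ts: "0 \<le> t - s" "t - s \<le> v - u" using st b[OF st(1)] by (auto simp: I0_def)
  have c: "card I = card X" unfolding e[symmetric]
    by (rule card_apmap[symmetric, OF d I(1)]) (use ts uv in simp)
  have "card I \<le> card {0..t - s}" using I by (intro card_mono) auto
  then have "int (card X) \<le> t - s + 1" using c ts by simp
  then show ?thesis using that[of "apmap a d s" I "t - s"] e I ts c by simp
qed

lemma in_ap_hull:
  fixes X :: "'p::prime_card mod_ring set"
  assumes X: "X \<noteq> {}" "in_ap d L X" and d: "d \<noteq> 0" and L: "L < int CARD('p)"
  obtains a I l where "X = apmap a d ` I" "I \<subseteq> {0..l}" "0 \<in> I" "l \<in> I" "0 \<le> l" "l \<le> L"
    "card I = card X" "int (card X) \<le> l + 1"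
proof -
  obtain a where "X \<subseteq> apmap a d ` {0..L}" using X by (auto simp: in_ap_def)
  from ap_hull[OF X(1) this d] L show ?thesis using that by (metis diff_zero)
qed

lemma card_apmap_plus:
  fixes a b d :: "'p::prime_card mod_ring"
  assumes "d \<noteq> 0" "I \<subseteq> {0..l}" "J \<subseteq> {0..M}" "l + M < int CARD('p)"
  shows "card (apmap a d ` I + apmap b d ` J) = card (I + J)"
proof -
  have "I + J \<subseteq> {0..l + M}"
  proof
    fix k assume "k \<in> I + J"
    then obtain i j where "i \<in> I" "j \<in> J" "k = i + j" by (rule set_plus_memE)
    then show "k \<in> {0..l + M}" using assms(2,3) by fastforce
  qed
  then show ?thesis unfolding apmap_plus using assms by (intro card_apmap) auto
qed

text \<open>The reflection of the interval in the missing sum \<open>g\<close> is a gap of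
  \<open>Z\<close>. A gap of \<open>v - u + 1\<close> consecutive terms leaves
  \<open>p - 1 - (v - u)\<close> terms, whose last index is one less; \<open>u <= v + 1\<close>
  admits an empty interval.\<close>

lemma in_ap_of_missing_interval:
  fixes Z W :: "'p::prime_card mod_ring set"
  assumes d: "d \<noteq> 0" and W: "apmap a d ` {u..v} \<subseteq> W" and g: "g \<notin> W + Z" and uv: "u \<le> v + 1"
  shows "in_ap d (int CARD('p) - 2 - (v - u)) Z"
proof -
  define c where "c = g - apmap a d u + d"
  have "z \<in> apmap c d ` {0..int CARD('p) - 2 - (v - u)}" if z: "z \<in> Z" for z
  proof -
    obtain i where i: "0 \<le> i" "i < int CARD('p)" "z = apmap c d i" using apmap_surj[OF d, of 0 z c] by auto
    have "i \<le> int CARD('p) - 2 - (v - u)"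
    proof (rule ccontr)
      assume "\<not> ?thesis"
      then have "u + (int CARD('p) - 1 - i) \<in> {u..v}" using i by auto
      then have "apmap a d (u + (int CARD('p) - 1 - i)) \<in> W" using W by blast
      then have "apmap a d (u + (int CARD('p) - 1 - i)) + z \<in> W + Z" using z by (rule set_plus_memI)
      moreover have "apmap a d (u + (int CARD('p) - 1 - i)) + z = g"
        unfolding i(3) c_def apmap_def by (simp add: algebra_simps)
      ultimately show False using g by simp
    qed
    then show ?thesis using i by auto
  qed
  then show ?thesis unfolding in_ap_def by blast
qed

definition zero_sum_free :: "'p::prime_card mod_ring set \<Rightarrow> 'p mod_ring set \<Rightarrow> 'p mod_ring set \<Rightarrow> bool" where
  "zero_sum_free X Y Z \<longleftrightarrow> (\<forall>x\<in>X. \<forall>y\<in>Y. \<forall>z\<in>Z. x + y + z \<noteq> 0)"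

lemma zero_sum_free_plus: "zero_sum_free X Y Z \<Longrightarrow> 0 \<notin> X + Y + Z"
  unfolding zero_sum_free_def by (auto elim!: set_plus_memE)

text \<open>No sum wraps around because \<open>l + M < p\<close>. Whatever the true length of
  \<open>Y\<close>, it is at least \<open>|Y| - 1\<close>, so \<open>X + Y\<close> is filled from
  index \<open>l + 1\<close> to \<open>|Y| - 2\<close>, and this stretch confines
  \<open>Z\<close>.\<close>

lemma in_ap_third:
  fixes X Y Z :: "'p::prime_card mod_ring set"
  assumes d: "d \<noteq> 0" and X: "X \<noteq> {}" "in_ap d l X" and Y: "Y \<noteq> {}" "in_ap d M Y" and lM: "l + M < int CARD('p)"
    and N: "int (card (X + Y)) \<le> int (card X) + int (card Y) + r" and h: "l + 1 + r + 3 \<le> 2 * int (card X)"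
    and z: "zero_sum_free X Y Z" and l: "l + 2 \<le> int (card Y)"
  shows "in_ap d (int CARD('p) - int (card Y) + l + 1) Z"
proof -
  have nn: "0 \<le> l" "0 \<le> M" using X Y by (auto simp: in_ap_def)
  have lp: "l < int CARD('p)" "M < int CARD('p)" using nn lM by linarith+
  obtain a I l' where I: "X = apmap a d ` I" "I \<subseteq> {0..l'}" "0 \<in> I" "l' \<in> I" "0 \<le> l'" "l' \<le> l"
      "card I = card X" "int (card X) \<le> l' + 1"
    by (rule in_ap_hull[OF X d lp(1)])
  obtain b J M' where J: "Y = apmap b d ` J" "J \<subseteq> {0..M'}" "0 \<in> J" "M' \<in> J" "0 \<le> M'" "M' \<le> M"
      "card J = card Y" "int (card Y) \<le> M' + 1"
    by (rule in_ap_hull[OF Y d lp(2)])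
  have IJ: "int (card (I + J)) \<le> int (card I) + int (card J) + r"
    using N card_apmap_plus[OF d I(2) J(2), of a b] I J lM by simp
  have finJ: "finite J" using J(2) finite_subset by blast
  have "{l + 1..int (card Y) - 2} \<subseteq> I + J"
  proof
    fix t assume "t \<in> {l + 1..int (card Y) - 2}"
    then have t: "l' + 1 \<le> t" "t \<le> M' - 1" using I J by auto
    show "t \<in> I + J"
      by (rule dense_sumset_interval[OF I(2,3) finJ J(3,4) IJ _ t]) (use h I in simp)
  qed
  then have "apmap (a + b) d ` {l + 1..int (card Y) - 2} \<subseteq> X + Y"
    unfolding I(1) J(1) apmap_plus by (rule image_mono)
  from in_ap_of_missing_interval[OF d this zero_sum_free_plus[OF z]]
  show ?thesis using l by (simp add: algebra_simps)
qed

text \<open>The crude length \<open>M\<close> only has to exclude wraparound;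
  \<open>dense_sumset_length\<close> then replaces it by the sharp one.\<close>

lemma in_ap_tight:
  fixes X Y :: "'p::prime_card mod_ring set"
  assumes d: "d \<noteq> 0" and X: "X \<noteq> {}" "in_ap d l X" and Y: "Y \<noteq> {}" "in_ap d M Y" and lM: "l + M < int CARD('p)"
    and N: "int (card (X + Y)) \<le> int (card X) + int (card Y) + r" and h: "l + 1 + r + 3 \<le> 2 * int (card X)"
    and s: "int (card Y) + int (card X) \<ge> l + 3"
  shows "in_ap d (int (card Y) + r) Y"
proof -
  have nn: "0 \<le> l" "0 \<le> M" using X Y by (auto simp: in_ap_def)
  have lp: "l < int CARD('p)" "M < int CARD('p)" using nn lM by linarith+
  obtain a I l' where I: "X = apmap a d ` I" "I \<subseteq> {0..l'}" "0 \<in> I" "l' \<in> I" "0 \<le> l'" "l' \<le> l"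
      "card I = card X" "int (card X) \<le> l' + 1"
    by (rule in_ap_hull[OF X d lp(1)])
  obtain b J M' where J: "Y = apmap b d ` J" "J \<subseteq> {0..M'}" "0 \<in> J" "M' \<in> J" "0 \<le> M'" "M' \<le> M"
      "card J = card Y" "int (card Y) \<le> M' + 1"
    by (rule in_ap_hull[OF Y d lp(2)])
  have IJ: "int (card (I + J)) \<le> int (card I) + int (card J) + r"
    using N card_apmap_plus[OF d I(2) J(2), of a b] I J lM by simp
  have "M' \<le> int (card J) + r"
    by (rule dense_sumset_length[OF I(2,3,4) J(2,3,4) IJ]) (use h s I J in simp_all)
  then have "J \<subseteq> {0..int (card Y) + r}" using J by auto
  then have "apmap b d ` J \<subseteq> apmap b d ` {0..int (card Y) + r}" by (rule image_mono)
  then show ?thesis unfolding in_ap_def J(1)[symmetric] by (rule exI)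
qed

text \<open>\<open>h\<close> bounds the holes of either set, and the inequalities on
  \<open>h\<close> imply those of \<open>sumset_contains_interval\<close> with the shorter interval
  first. In a trio \<open>p - |X| - |Y|\<close> is at most \<open>|Z| + r\<close>, so the result is
  of the sharp form.\<close>

lemma in_ap_plus_interval:
  fixes X Y :: "'p::prime_card mod_ring set"
  assumes d: "d \<noteq> 0" and X: "X \<noteq> {}" "in_ap d (int (card X) - 1 + h) X" and Y: "Y \<noteq> {}" "in_ap d (int (card Y) - 1 + h) Y"
    and p: "int (card X) - 1 + h < int CARD('p)" "int (card Y) - 1 + h < int CARD('p)"
    and h: "3 * h \<le> int (card X)" "3 * h \<le> int (card Y)" "4 * h \<le> max (int (card X)) (int (card Y))"
    and h0: "0 \<le> h"
    and z: "zero_sum_free X Y Z"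
  shows "in_ap d (int CARD('p) - int (card X) - int (card Y)) Z"
proof -
  obtain a I l where I: "X = apmap a d ` I" "I \<subseteq> {0..l}" "0 \<in> I" "l \<in> I" "0 \<le> l" "l \<le> int (card X) - 1 + h"
      "card I = card X" "int (card X) \<le> l + 1"
    by (rule in_ap_hull[OF X d p(1)])
  obtain b J M where J: "Y = apmap b d ` J" "J \<subseteq> {0..M}" "0 \<in> J" "M \<in> J" "0 \<le> M" "M \<le> int (card Y) - 1 + h"
      "card J = card Y" "int (card Y) \<le> M + 1"
    by (rule in_ap_hull[OF Y d p(2)])
  have pos: "int (card X) \<ge> 1" "int (card Y) \<ge> 1" using X(1) Y(1) by (simp_all add: Suc_le_eq card_gt_0_iff)
  have hole: "l + 1 - int (card I) \<le> h" "M + 1 - int (card J) \<le> h" using I(6,7) J(6,7) by linarith+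
  have "\<exists>t. {t..t + int (card X) + int (card Y) - 2} \<subseteq> I + J"
  proof (cases "l \<le> M")
    case True
    have hM: "3 * h \<le> l + 1" "4 * h \<le> M + 1" "2 * h \<le> l" using True I(8) J(8) h h0 pos by linarith+
    have c1: "l + 1 - int (card I) + (M + 1 - int (card J)) \<le> l" using hole hM by linarith
    have c2: "2 * (l + 1 - int (card I)) + (M + 1 - int (card J)) \<le> l + 1" using hole hM by (simp add: algebra_simps)
    have c3: "2 * (l + 1 - int (card I) + (M + 1 - int (card J))) \<le> M + 1" using hole hM by (simp add: algebra_simps)
    have "\<exists>t. {t..t + int (card I) + int (card J) - 2} \<subseteq> I + J"
      by (rule sumset_contains_interval[OF I(2) J(2) I(5) True refl refl c1 c2 c3])
    then show ?thesis unfolding I(7) J(7) .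
  next
    case False
    then have Ml: "M \<le> l" by simp
    then have hM: "3 * h \<le> M + 1" "4 * h \<le> l + 1" "2 * h \<le> M" using I(8) J(8) h h0 pos by linarith+
    have c1: "M + 1 - int (card J) + (l + 1 - int (card I)) \<le> M" using hole hM by linarith
    have c2: "2 * (M + 1 - int (card J)) + (l + 1 - int (card I)) \<le> M + 1" using hole hM by (simp add: algebra_simps)
    have c3: "2 * (M + 1 - int (card J) + (l + 1 - int (card I))) \<le> l + 1" using hole hM by (simp add: algebra_simps)
    have "\<exists>t. {t..t + int (card J) + int (card I) - 2} \<subseteq> J + I"
      by (rule sumset_contains_interval[OF J(2) I(2) J(5) Ml refl refl c1 c2 c3])
    then obtain t where "{t..t + int (card J) + int (card I) - 2} \<subseteq> J + I" ..
    moreover have "t + int (card J) + int (card I) - 2 = t + int (card X) + int (card Y) - 2"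
      unfolding I(7) J(7) by simp
    moreover have "J + I = I + J" by (rule add.commute)
    ultimately have "{t..t + int (card X) + int (card Y) - 2} \<subseteq> I + J" by simp
    then show ?thesis ..
  qed
  then obtain t where "{t..t + int (card X) + int (card Y) - 2} \<subseteq> I + J" by blast
  then have "apmap (a + b) d ` {t..t + int (card X) + int (card Y) - 2} \<subseteq> X + Y"
    unfolding I(1) J(1) apmap_plus by (rule image_mono)
  from in_ap_of_missing_interval[OF d this zero_sum_free_plus[OF z]]
  show ?thesis using pos by (simp add: algebra_simps)
qed

lemma trio_zero_sum_free: "trio X Y Z r \<Longrightarrow> zero_sum_free X Y Z"
  by (simp add: trio_def zero_sum_free_def)

text \<open>By Cauchy-Davenport \<open>|X + Y0| - |Y0|\<close> is at least \<open>|X| - 1\<close>,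
  only \<open>r + 1\<close> below \<open>m\<close>; this slack bounds the loss
  \<open>\<mu> (|Y| - |Y0|)\<close>. A large \<open>\<mu>\<close> makes \<open>Y0\<close> almost all
  of \<open>Y\<close> but worsens the growth factor \<open>1 + \<mu>\<close>, so each application
  chooses its own value.\<close>

lemma trio_petridis:
  fixes X Y Z :: "'p::prime_card mod_ring set"
  assumes t: "trio X Y Z r" and m: "m = real (card X) + real_of_int r" and \<mu>: "m \<le> \<mu> * real (card Y)" "0 < \<mu>"
  obtains Y0 where "Y0 \<subseteq> Y" "Y0 \<noteq> {}" "\<mu> * (real (card Y) - real (card Y0)) \<le> real_of_int r + 1"
    "real (card (X + Y0)) \<le> real (card Y0) + m"
    "\<And>j. real (card (nfold j X + Y0)) \<le> real (card Y0) + m * (\<Sum>i<j. (1 + \<mu>) ^ i)"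
    "\<And>j. real (card Y) + m * (\<Sum>i<j. (1 + \<mu>) ^ i) < real CARD('p) \<Longrightarrow>
       real (card (nfold j X)) \<le> m * (\<Sum>i<j. (1 + \<mu>) ^ i) + 1"
proof -
  have ne: "X \<noteq> {}" "Y \<noteq> {}" using t by (auto simp: trio_def)
  have "real_of_int (int (card (X + Y))) \<le> real_of_int (int (card X) + int (card Y) + r)"
    using trio_card_plus(2)[OF t] by (simp only: of_int_le_iff)
  then have XY: "real (card (X + Y)) \<le> real (card Y) + m" using m by simp
  then have "real (card (X + Y)) \<le> (1 + \<mu>) * real (card Y)" using \<mu> by (simp add: distrib_right)
  then obtain Y0 where Y0: "Y0 \<subseteq> Y" "Y0 \<noteq> {}"
    and \<Phi>: "real (card (X + Y0)) - (1 + \<mu>) * real (card Y0) \<le> real (card (X + Y)) - (1 + \<mu>) * real (card Y)"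
    and P: "\<And>n. real (card (nfold n X + Y0)) \<le> real (card Y0) + (real (card (X + Y0)) - real (card Y0)) * (\<Sum>i<n. (1 + \<mu>) ^ i)"
    by (rule petridis[OF finite finite ne]) blast
  have cY0: "real (card Y0) \<le> real (card Y)" using Y0 by (simp add: card_mono)
  define m0 where "m0 = real (card (X + Y0)) - real (card Y0)"
  have m0: "m0 + \<mu> * (real (card Y) - real (card Y0)) \<le> m"
    using \<Phi> XY by (simp add: m0_def algebra_simps)
  have "0 \<le> \<mu> * (real (card Y) - real (card Y0))" using \<mu> cY0 by simp
  then have m0m: "m0 \<le> m" using m0 by linarith
  have "card (X + Y0) \<le> card (X + Y)" using Y0(1) by (intro card_mono set_plus_mono2) auto
  then have "card (X + Y0) < CARD('p)" using trio_card_plus(3)[OF t] by linarith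
  then have "int (card X) + int (card Y0) - 1 \<le> int (card (X + Y0))"
    by (rule cauchy_davenport_small[OF ne(1) Y0(2)])
  then have "real (card X) - 1 \<le> m0" by (simp add: m0_def)
  then have 1: "\<mu> * (real (card Y) - real (card Y0)) \<le> real_of_int r + 1" using m0 m by linarith
  have 2: "real (card (nfold j X + Y0)) \<le> real (card Y0) + m * (\<Sum>i<j. (1 + \<mu>) ^ i)" for j
  proof -
    have "m0 * (\<Sum>i<j. (1 + \<mu>) ^ i) \<le> m * (\<Sum>i<j. (1 + \<mu>) ^ i)"
      using m0m \<mu> by (intro mult_right_mono sum_nonneg) auto
    then show ?thesis using P[of j] by (simp add: m0_def)
  qed
  have 3: "real (card (nfold j X)) \<le> m * (\<Sum>i<j. (1 + \<mu>) ^ i) + 1"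
    if "real (card Y) + m * (\<Sum>i<j. (1 + \<mu>) ^ i) < real CARD('p)" for j
  proof -
    have "real (card (nfold j X + Y0)) < real CARD('p)" using 2[of j] that cY0 by linarith
    then have "card (nfold j X + Y0) < CARD('p)" by simp
    then have "int (card (nfold j X)) + int (card Y0) - 1 \<le> int (card (nfold j X + Y0))"
      by (rule cauchy_davenport_small[OF nfold_nonempty[OF ne(1)] Y0(2)])
    then show ?thesis using 2[of j] by linarith
  qed
  have 4: "real (card (X + Y0)) \<le> real (card Y0) + m" using m0m by (simp add: m0_def)
  show ?thesis by (rule that[OF Y0 1 4 2 3])
qed

text \<open>Among all arcs of length at most \<open>h\<close> that contain as many points of \<open>V\<close> as possible, take one that is
  as short as possible. If \<open>g > 1\<close> divided all its indices, the difference \<open>g d\<close> would give a shorter arc.\<close>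

lemma optimal_arc:
  fixes V :: "'p::prime_card mod_ring set" and h :: nat
  assumes d0: "d0 \<noteq> 0" and h: "h < CARD('p)"
    and n0: "2 \<le> card {x \<in> V. \<exists>i. 0 \<le> i \<and> i \<le> int h \<and> x = a0 + of_int i * d0}"
  obtains a d I l where "d \<noteq> 0" "I \<subseteq> {0..l}" "0 \<in> I" "l \<in> I" "0 < l" "l \<le> int h" "apmap a d ` I \<subseteq> V"
    "card {x \<in> V. \<exists>i. 0 \<le> i \<and> i \<le> int h \<and> x = a0 + of_int i * d0} \<le> card I"
    "\<And>b e J u. e \<noteq> 0 \<Longrightarrow> J \<subseteq> {u..u + int h} \<Longrightarrow> apmap b e ` J \<subseteq> V \<Longrightarrow> card J \<le> card I"
    "\<And>g. g > 1 \<Longrightarrow> \<exists>i\<in>I. \<not> g dvd i"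
proof -
  define P where "P = (\<lambda>n l. \<exists>a d I. d \<noteq> 0 \<and> I \<subseteq> {0..int l} \<and> apmap a d ` I \<subseteq> V \<and> card I = n)"
  define Q where "Q = (\<lambda>n. \<exists>l\<le>h. P n l)"
  define N0 where "N0 = card {x \<in> V. \<exists>i. 0 \<le> i \<and> i \<le> int h \<and> x = a0 + of_int i * d0}"
  have shift: "Q (card J)" if "e \<noteq> 0" "J \<subseteq> {u..u + int h}" "apmap b e ` J \<subseteq> V" for b e J u
  proof -
    have 1: "(\<lambda>j. j - u) ` J \<subseteq> {0..int h}" using that by auto
    have "apmap (apmap b e u) e ` (\<lambda>j. j - u) ` J = apmap b e ` J"
      unfolding image_image apmap_shift[symmetric] by simp
    then have 2: "apmap (apmap b e u) e ` (\<lambda>j. j - u) ` J \<subseteq> V" using that by simp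
    have 3: "card ((\<lambda>j. j - u) ` J) = card J" by (intro card_image) (simp add: inj_on_def)
    have "P (card J) h" unfolding P_def
      by (rule exI[of _ "apmap b e u"], rule exI[of _ e], rule exI[of _ "(\<lambda>j. j - u) ` J"])
        (intro conjI that(1) 1 2 3)
    then show ?thesis unfolding Q_def by (rule exI[of _ h, OF conjI[OF order_refl]])
  qed
  have QN0: "Q N0"
  proof -
    define J where "J = {i. 0 \<le> i \<and> i \<le> int h \<and> apmap a0 d0 i \<in> V}"
    have J: "J \<subseteq> {0..0 + int h}" by (auto simp: J_def)
    have e: "apmap a0 d0 ` J = {x \<in> V. \<exists>i. 0 \<le> i \<and> i \<le> int h \<and> x = a0 + of_int i * d0}"
      by (auto simp: J_def apmap_def)
    have "card J = N0" unfolding N0_def e[symmetric]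
      by (rule card_apmap[symmetric, OF d0 J]) (use h in simp)
    moreover have "apmap a0 d0 ` J \<subseteq> V" by (auto simp: J_def)
    ultimately show ?thesis using shift[OF d0 J] by blast
  qed
  have Qb: "n < h + 2" if Qn: "Q n" for n
  proof -
    obtain l where l: "l \<le> h" "P n l" using Qn unfolding Q_def by blast
    then obtain I where I: "I \<subseteq> {0..int l}" "card I = n" unfolding P_def by blast
    have "card I \<le> card {0..int l}" using I by (intro card_mono) auto
    then show ?thesis using I l by simp
  qed
  obtain n where n: "Q n" "\<And>n'. Q n' \<Longrightarrow> n' \<le> n"
  proof -
    have bnd: "y \<le> h + 2" if "Q y" for y using Qb[OF that] by simp
    have "Q (Greatest Q)" by (rule GreatestI_nat[of Q, OF QN0 bnd])
    moreover have "n' \<le> Greatest Q" if "Q n'" for n' by (rule Greatest_le_nat[of Q, OF that bnd])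
    ultimately show ?thesis by (rule that)
  qed
  have n2: "2 \<le> n" using n(2)[OF QN0] n0 by (simp add: N0_def)
  define l where "l = (LEAST l. l \<le> h \<and> P n l)"
  have l: "l \<le> h \<and> P n l" unfolding l_def by (rule LeastI_ex) (use n(1) in \<open>simp add: Q_def\<close>)
  have lmin: "l \<le> k" if k: "k \<le> h" "P n k" for k
  proof -
    have "k \<le> h \<and> P n k" using k by simp
    then show ?thesis unfolding l_def by (rule Least_le)
  qed
  obtain a d I0 where I0: "d \<noteq> 0" "I0 \<subseteq> {0..int l}" "apmap a d ` I0 \<subseteq> V" "card I0 = n"
    using conjunct2[OF l] unfolding P_def by blast
  have c0: "card (apmap a d ` I0) = card I0"
    by (rule card_apmap[OF I0(1,2)]) (use l h in simp)
  have ne: "apmap a d ` I0 \<noteq> {}" using I0(4) n2 by auto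
  obtain a' I l' where I: "apmap a d ` I0 = apmap a' d ` I" "I \<subseteq> {0..l'}" "0 \<in> I" "l' \<in> I" "0 \<le> l'" "l' \<le> int l - 0"
     "card I = card (apmap a d ` I0)" "int (card (apmap a d ` I0)) \<le> l' + 1"
    by (rule ap_hull[OF ne image_mono[OF I0(2)] I0(1)]) (use l h in simp)
  have cI: "card I = n" using I(7) c0 I0(4) by simp
  have IV: "apmap a' d ` I \<subseteq> V" using I(1) I0(3) by simp
  have l': "0 < l'" using I(8) c0 I0(4) n2 by linarith
  have gcd: "\<exists>i\<in>I. \<not> g dvd i" if g: "g > 1" for g
  proof (rule ccontr)
    assume "\<not> ?thesis"
    then have dv: "g dvd i" if "i \<in> I" for i using that by blast
    have "g \<le> l'" using dv[OF I(4)] l' by (rule zdvd_imp_le)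
    then have gp: "g < int CARD('p)" using I(6) l h by linarith
    have gd: "of_int g * d \<noteq> (0 :: 'p mod_ring)"
    proof -
      have "(of_int g :: 'p mod_ring) \<noteq> of_int 0" unfolding of_int_mod_ring_eq_iff using g gp by simp
      then show ?thesis using I0(1) by simp
    qed
    define J where "J = (\<lambda>i. i div g) ` I"
    have J: "J \<subseteq> {0..int (nat (l' div g))}"
      using I(2) g by (auto simp: J_def zdiv_mono1 pos_imp_zdiv_nonneg_iff)
    have "inj_on (\<lambda>i. i div g) I"
    proof (rule inj_onI)
      fix i j assume ij: "i \<in> I" "j \<in> I" "i div g = j div g"
      have "g * (i div g) = i" by (rule dvd_mult_div_cancel[OF dv[OF ij(1)]])
      moreover have "g * (j div g) = j" by (rule dvd_mult_div_cancel[OF dv[OF ij(2)]])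
      ultimately show "i = j" unfolding ij(3) by simp
    qed
    then have cJ: "card J = n" unfolding J_def cI[symmetric] by (rule card_image)
    have "apmap a' (of_int g * d) ` J = apmap a' d ` I"
      unfolding J_def image_image
    proof (rule image_cong[OF refl])
      fix i assume "i \<in> I"
      have "of_int (i div g) * (of_int g * d) = of_int (i div g * g) * d" by (simp only: of_int_mult mult.assoc)
      also have "i div g * g = i" using dv[OF \<open>i \<in> I\<close>] by simp
      finally show "apmap a' (of_int g * d) (i div g) = apmap a' d i" by (simp only: apmap_def)
    qed
    then have JV: "apmap a' (of_int g * d) ` J \<subseteq> V" using IV by simp
    have PJ: "P n (nat (l' div g))" unfolding P_def
      by (rule exI[of _ a'], rule exI[of _ "of_int g * d"], rule exI[of _ J]) (intro conjI gd J JV cJ)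
    have lt: "l' div g < l'" using l' g by (intro int_div_less_self) auto
    then have "nat (l' div g) \<le> h" using I(6) l by linarith
    then have "l \<le> nat (l' div g)" using PJ by (rule lmin)
    then show False using lt I(6) l' g pos_imp_zdiv_nonneg_iff[of g l'] by linarith
  qed
  show ?thesis
  proof (rule that[OF I0(1) I(2,3,4) l' _ IV])
    show "l' \<le> int h" using I(6) l by linarith
    show "card {x \<in> V. \<exists>i. 0 \<le> i \<and> i \<le> int h \<and> x = a0 + of_int i * d0} \<le> card I"
      using n(2)[OF QN0] cI by (simp add: N0_def)
    show "card J \<le> card I" if "e \<noteq> 0" "J \<subseteq> {u..u + int h}" "apmap b e ` J \<subseteq> V" for b e J u
      using n(2)[OF shift[OF that]] cI by simp
    show "\<exists>i\<in>I. \<not> g dvd i" if "g > 1" for g by (rule gcd[OF that])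
  qed
qed

section \<open>Trios without a small member\<close>

lemma mem_translate_iff: "s \<in> (+) w ` V \<longleftrightarrow> s - w \<in> (V :: 'a::ab_group_add set)"
proof
  assume "s \<in> (+) w ` V"
  then obtain v where "v \<in> V" "s = w + v" by blast
  then show "s - w \<in> V" by simp
next
  assume "s - w \<in> V"
  then have "w + (s - w) \<in> (+) w ` V" by (rule imageI)
  then show "s \<in> (+) w ` V" by simp
qed

text \<open>\<open>rep s\<close> counts the representations of \<open>s\<close> as a sum from
  \<open>V\<close> and \<open>Y\<close>. Its total is \<open>|V| |Y|\<close>, and its second moment
  is a sum of sizes of intersections of translates of \<open>V\<close>; Cauchy-Schwarz on the
  support \<open>V + Y\<close> compares the two.\<close>

lemma energy_bound:
  fixes V Y :: "'p::prime_card mod_ring set"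
  assumes k: "\<And>t. t \<noteq> 0 \<Longrightarrow> real (card (V \<inter> (+) t ` V)) \<le> k"
  shows "(real (card V) * real (card Y))\<^sup>2
    \<le> real (card (V + Y)) * (real (card Y) * (real (card V) + (real (card Y) - 1) * k))"
proof -
  define f :: "'p mod_ring \<Rightarrow> 'p mod_ring \<Rightarrow> real" where "f = (\<lambda>s w. of_bool (s - w \<in> V))"
  define rep where "rep = (\<lambda>s. \<Sum>w\<in>Y. f s w)"
  have f1: "(\<Sum>s\<in>UNIV. f s w) = real (card V)" for w
  proof -
    have e: "{s. s - w \<in> V} = (+) w ` V" unfolding mem_translate_iff[symmetric] by (rule Collect_mem_eq)
    have "(\<Sum>s\<in>UNIV. f s w) = real (card {s. s - w \<in> V})" by (simp add: f_def)
    then show ?thesis unfolding e by simp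
  qed
  have f2: "(\<Sum>s\<in>UNIV. f s w * f s w') \<le> (if w = w' then real (card V) else k)" for w w'
  proof (cases "w = w'")
    case True
    have "(\<Sum>s\<in>UNIV. f s w * f s w') = (\<Sum>s\<in>UNIV. f s w)"
      by (rule sum.cong[OF refl]) (simp add: f_def True)
    then show ?thesis unfolding f1 using True by simp
  next
    case False
    have e: "{s. s - w \<in> V \<and> s - w' \<in> V} = (+) w ` (V \<inter> (+) (w' - w) ` V)"
      unfolding set_eq_iff
    proof (rule allI)
      fix s
      have "s - w - (w' - w) = s - w'" by simp
      then show "s \<in> {s. s - w \<in> V \<and> s - w' \<in> V} \<longleftrightarrow> s \<in> (+) w ` (V \<inter> (+) (w' - w) ` V)"
        by (simp add: mem_translate_iff del: image_iff)
    qed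
    have "f s w * f s w' = of_bool (s - w \<in> V \<and> s - w' \<in> V)" for s by (simp add: f_def)
    then have "(\<Sum>s\<in>UNIV. f s w * f s w') = real (card {s. s - w \<in> V \<and> s - w' \<in> V})" by simp
    also have "\<dots> = real (card (V \<inter> (+) (w' - w) ` V))" unfolding e by simp
    also have "\<dots> \<le> k" by (rule k) (use False in simp)
    finally show ?thesis using False by simp
  qed
  have out: "rep s = 0" if "s \<notin> V + Y" for s
  proof -
    have "s - w \<notin> V" if "w \<in> Y" for w
    proof
      assume "s - w \<in> V"
      then have "s - w + w \<in> V + Y" using that by (rule set_plus_memI)
      then show False using \<open>s \<notin> V + Y\<close> by simp
    qed
    then show ?thesis unfolding rep_def f_def by (intro sum.neutral) simp
  qed
  have "(\<Sum>s\<in>V + Y. rep s) = (\<Sum>s\<in>UNIV. rep s)" by (rule sum.mono_neutral_left) (auto intro: out)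
  also have "\<dots> = (\<Sum>w\<in>Y. \<Sum>s\<in>UNIV. f s w)" unfolding rep_def by (rule sum.swap)
  also have "\<dots> = real (card V) * real (card Y)" by (simp add: f1)
  finally have 1: "(\<Sum>s\<in>V + Y. 1 * rep s) = real (card V) * real (card Y)" by simp
  have "(\<Sum>s\<in>V + Y. (rep s)\<^sup>2) \<le> (\<Sum>s\<in>UNIV. (rep s)\<^sup>2)" by (rule sum_mono2) auto
  also have "\<dots> = (\<Sum>s\<in>UNIV. \<Sum>w\<in>Y. \<Sum>w'\<in>Y. f s w * f s w')"
    unfolding rep_def power2_eq_square sum_product ..
  also have "\<dots> = (\<Sum>w\<in>Y. \<Sum>s\<in>UNIV. \<Sum>w'\<in>Y. f s w * f s w')" by (rule sum.swap)
  also have "\<dots> = (\<Sum>w\<in>Y. \<Sum>w'\<in>Y. \<Sum>s\<in>UNIV. f s w * f s w')"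
    by (rule sum.cong[OF refl], rule sum.swap)
  also have "\<dots> \<le> (\<Sum>w\<in>Y. \<Sum>w'\<in>Y. if w = w' then real (card V) else k)"
    by (intro sum_mono f2)
  also have "\<dots> = (\<Sum>w\<in>Y. real (card V) + (real (card Y) - 1) * k)"
  proof (rule sum.cong[OF refl])
    fix w assume w: "w \<in> Y"
    then have "card Y \<ge> 1" by (simp add: Suc_le_eq card_gt_0_iff) blast
    have "(\<Sum>w'\<in>Y. if w = w' then real (card V) else k) = real (card V) + (\<Sum>w'\<in>Y - {w}. if w = w' then real (card V) else k)"
      using w by (subst sum.remove[of Y w]) auto
    also have "(\<Sum>w'\<in>Y - {w}. if w = w' then real (card V) else k) = (\<Sum>w'\<in>Y - {w}. k)"
      by (rule sum.cong) auto
    also have "\<dots> = (real (card Y) - 1) * k" using w \<open>card Y \<ge> 1\<close> by (simp add: card_Diff_singleton of_nat_diff)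
    finally show "(\<Sum>w'\<in>Y. if w = w' then real (card V) else k) = real (card V) + (real (card Y) - 1) * k" .
  qed
  finally have 2: "(\<Sum>s\<in>V + Y. (rep s)\<^sup>2) \<le> real (card Y) * (real (card V) + (real (card Y) - 1) * k)" by simp
  have "(\<Sum>s\<in>V + Y. 1 * rep s)\<^sup>2 \<le> (\<Sum>s\<in>V + Y. 1\<^sup>2) * (\<Sum>s\<in>V + Y. (rep s)\<^sup>2)"
    by (rule Cauchy_Schwarz_ineq_sum)
  also have "\<dots> \<le> real (card (V + Y)) * (real (card Y) * (real (card V) + (real (card Y) - 1) * k))"
    using 2 by (simp add: mult_left_mono)
  finally show ?thesis unfolding 1 .
qed

text \<open>\<open>submodular_atom\<close> in the whole group for \<open>N W = W + Y\<close>, with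
  the negative of the complement of \<open>W + Y\<close> as the dual of \<open>W\<close>. A
  translate that meets \<open>V\<close> in \<open>k\<close> points would equal \<open>V\<close>, and
  in a group of prime order \<open>V\<close> would be everything.\<close>

lemma atom_exists:
  fixes X Y Z :: "'p::prime_card mod_ring set"
  assumes t: "trio X Y Z r" and k: "1 \<le> k" "k \<le> card X" "k \<le> card Z"
  obtains V where "k \<le> card V" "card (V + Y) + k \<le> CARD('p)" "card (V + Y) + card X \<le> card (X + Y) + card V"
    "\<And>t. t \<noteq> 0 \<Longrightarrow> card (V \<inter> (+) t ` V) < k"
proof -
  have NU: "(U \<union> W) + Y = (U + Y) \<union> (W + Y)" for U W :: "'p mod_ring set"
    by (auto simp: set_plus_def)
  have dual: "\<exists>W'. W' \<subseteq> UNIV \<and> card W' = card (UNIV :: 'p mod_ring set) - card (W + Y) \<and> card (W' + Y) + card W \<le> card (UNIV :: 'p mod_ring set)"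
    for W :: "'p mod_ring set"
  proof (intro exI conjI)
    define W' where "W' = uminus ` (UNIV - (W + Y))"
    show "card W' = card (UNIV :: 'p mod_ring set) - card (W + Y)" by (simp add: W'_def card_Diff_subset)
    have "(W' + Y) \<inter> uminus ` W = {}"
    proof (rule ccontr)
      assume "\<not> ?thesis"
      then obtain w where w: "w \<in> W" "-w \<in> W' + Y" by auto
      from w(2) obtain s y where sy: "s \<in> W'" "y \<in> Y" "-w = s + y" by (rule set_plus_memE)
      have "w + y \<in> W + Y" using w(1) sy(2) by (rule set_plus_memI)
      moreover have "w + y = - s" 
      proof -
        have "- (s + y) = w" unfolding sy(3)[symmetric] by simp
        then have "w = - (s + y)" by simp
        then show ?thesis by simp
      qed
      ultimately show False using sy(1) by (auto simp: W'_def)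
    qed
    then have "card (W' + Y) + card (uminus ` W) = card ((W' + Y) \<union> uminus ` W)"
      by (intro card_Un_disjoint[symmetric]) auto
    also have "\<dots> \<le> card (UNIV :: 'p mod_ring set)" by (intro card_mono) auto
    finally show "card (W' + Y) + card W \<le> card (UNIV :: 'p mod_ring set)" by simp
  qed simp
  have X0: "X \<subseteq> UNIV \<and> k \<le> card X \<and> card (X + Y) + k \<le> card (UNIV :: 'p mod_ring set)"
    using k trio_card_plus(1)[OF t] by simp
  obtain V where V: "V \<subseteq> UNIV \<and> k \<le> card V \<and> card (V + Y) + k \<le> card (UNIV :: 'p mod_ring set)"
    and V1: "\<And>W. W \<subseteq> UNIV \<and> k \<le> card W \<and> card (W + Y) + k \<le> card (UNIV :: 'p mod_ring set) \<Longrightarrow>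
        card (V + Y) + card W \<le> card (W + Y) + card V"
    and V2: "\<And>W. W \<subseteq> UNIV \<and> k \<le> card W \<and> card (W + Y) + k \<le> card (UNIV :: 'p mod_ring set) \<Longrightarrow>
        card W = card V \<Longrightarrow> card (W + Y) = card (V + Y) \<Longrightarrow> k \<le> card (V \<inter> W) \<Longrightarrow> W = V"
    by (rule submodular_atom[where G = "UNIV :: 'p mod_ring set" and N = "\<lambda>V. V + Y", OF finite k(1) subset_UNIV NU dual X0]) blast
  have "card (V \<inter> (+) t ` V) < k" if t0: "t \<noteq> 0" for t
  proof (rule ccontr)
    assume "\<not> ?thesis"
    then have big: "k \<le> card (V \<inter> (+) t ` V)" by simp
    have e: "(+) t ` V + Y = (+) t ` (V + Y)"
      using plus_translate_right[of Y t V] by (simp only: add.commute)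
    have c: "card ((+) t ` V + Y) = card (V + Y)" unfolding e by simp
    have VV: "(+) t ` V = V" by (rule V2[OF _ _ c big]) (use V c in simp_all)
    have "V \<noteq> {}" using V k(1) by auto
    then obtain x where x: "x \<in> V" by blast
    have "y + t \<in> V" if "y \<in> V" for y
    proof -
      have "t + y \<in> (+) t ` V" using that by (rule imageI)
      then show ?thesis unfolding VV by (simp only: add.commute)
    qed
    then have "V = UNIV" by (rule translate_stable_UNIV[OF x t0])
    moreover have "card V \<le> card (Y + V)"
      by (rule card_plus_ge_left) (use t in \<open>simp_all add: trio_def\<close>)
    then have "card V \<le> card (V + Y)" by (simp only: add.commute)
    ultimately show False using V k(1) by simp
  qed
  then show ?thesis using that[of V] V V1[OF X0] by simp
qed

text \<open>At \<open>v = u y\<close> the hypothesis becomes \<open>u\<^sup>2 \<le> (1.01 + u) (0.005 u + 0.035)\<close>, and the largest such \<open>u\<close>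
  is slightly below \<open>0.21\<close>.\<close>

lemma atom_size_bound:
  fixes v y r k N :: real
  assumes e: "(v * y)\<^sup>2 \<le> N * (y * (v + (y - 1) * k))" and N: "N \<le> v + y + r" "0 \<le> N"
    and k: "0 \<le> k" "k \<le> (7 / 200) * y" and y: "200 \<le> y" "r \<le> (1 / 100) * y" and v: "0 \<le> v"
  shows "v < (21 / 100) * y"
proof (rule ccontr)
  assume "\<not> ?thesis"
  define u where "u = v / y"
  have vu: "v = u * y" using y by (simp add: u_def)
  then have u: "(21 / 100) \<le> u" using \<open>\<not> v < (21 / 100) * y\<close> y by simp
  have kb: "v + (y - 1) * k \<le> ((1 / 200) * u + (7 / 200)) * (y * y)"
  proof -
    have "(y - 1) * k \<le> y * ((7 / 200) * y)" using k y by (intro mult_mono) auto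
    \<comment> \<open>This uses \<open>y >= 200\<close>: the diagonal term \<open>v\<close> of the
      energy becomes the summand \<open>0.005 u\<close> after division by
      \<open>y^2\<close>.\<close>
    moreover have "u * y \<le> (1 / 200) * u * y * y"
    proof -
      have "(u * y) * 200 \<le> (u * y) * y" using y u by (intro mult_left_mono) auto
      then show ?thesis by simp
    qed
    ultimately show ?thesis unfolding vu by (simp add: algebra_simps)
  qed
  have Nb: "N \<le> ((101 / 100) + u) * y" using N y unfolding vu by (simp add: algebra_simps)
  have "(u * y * y)\<^sup>2 \<le> N * (y * (v + (y - 1) * k))" using e unfolding vu .
  also have "\<dots> \<le> (((101 / 100) + u) * y) * (y * (((1 / 200) * u + (7 / 200)) * (y * y)))"
    using Nb kb N y k v u by (intro mult_mono mult_nonneg_nonneg add_nonneg_nonneg) auto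
  also have "\<dots> = (((101 / 100) + u) * ((1 / 200) * u + (7 / 200))) * (y * y * y * y)" by (simp only: ac_simps)
  also have "(u * y * y)\<^sup>2 = (u * u) * (y * y * y * y)" by (simp only: power2_eq_square ac_simps)
  finally have "u * u \<le> ((101 / 100) + u) * ((1 / 200) * u + (7 / 200))"
    by (rule mult_right_le_imp_le) (use y in simp)
  moreover have "(21 / 100) * u \<le> u * u" using u by (intro mult_right_mono) auto
  ultimately show False using u by (simp add: algebra_simps)
qed

text \<open>The quadratic terms are estimated by the chord of \<open>v \<mapsto> v\<^sup>2\<close> between \<open>0.035 y\<close> and \<open>0.21 y\<close>.\<close>

lemma atom_numeric:
  fixes v y r :: real
  assumes v: "(7 / 200) * y \<le> v" "v \<le> (21 / 100) * y" and r: "r = -1 \<or> 0 \<le> r" "100 * r + 300 \<le> y"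
  shows "(v + r) * v \<le> y * ((51 / 200) * v - (147 / 20000) * y)"
    "(v + r) * (v + r) \<le> y * ((51 / 200) * v - (147 / 20000) * y + (11 / 50) * r + (11 / 50))"
proof -
  have y: "200 \<le> y" using r by linarith
  have "0 \<le> (v - (7 / 200) * y) * ((21 / 100) * y - v)" using v by simp
  then have 1: "v * v \<le> y * ((49 / 200) * v - (147 / 20000) * y)" by (simp add: algebra_simps)
  have "r * v \<le> ((1 / 100) * y) * v" using r v y by (intro mult_right_mono) auto
  then show 2: "(v + r) * v \<le> y * ((51 / 200) * v - (147 / 20000) * y)" using 1 by (simp add: algebra_simps)
  have "r * (v + r) \<le> (r + 1) * ((11 / 50) * y)"
    using r(1)
  proof
    assume "r = -1"
    then show ?thesis using v y by simp
  next
    assume "0 \<le> r"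
    then show ?thesis using r v y by (intro mult_mono) auto
  qed
  moreover have "(v + r) * (v + r) = (v + r) * v + r * (v + r)" by (simp add: algebra_simps)
  moreover have "y * ((51 / 200) * v - (147 / 20000) * y + (11 / 50) * r + (11 / 50))
      = y * ((51 / 200) * v - (147 / 20000) * y) + (r + 1) * ((11 / 50) * y)" by (simp add: algebra_simps)
  ultimately show "(v + r) * (v + r) \<le> y * ((51 / 200) * v - (147 / 20000) * y + (11 / 50) * r + (11 / 50))"
    using 2 by linarith
qed

section \<open>Rectification of the atom\<close>

lemma plus_zero_set [simp]: "V + {0} = (V :: 'a::comm_monoid_add set)"
  by (auto simp: set_plus_def)

lemma nfold_2: "nfold 2 V = V + V"
  by (simp add: numeral_2_eq_2)

lemma nfold_3: "nfold 3 V = V + (V + V)"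
  by (simp add: numeral_3_eq_3)

lemma two_mul_half_less: "2 * (CARD('p::prime_card) div 2) < CARD('p)" if "CARD('p) > 2"
proof -
  have "prime CARD('p)" by (rule prime_card)
  then have "odd CARD('p)" using that by (simp add: prime_odd_nat)
  then show ?thesis by presburger
qed

lemma trio_sum_bound:
  assumes "trio X Y (Z :: 'p::prime_card mod_ring set) r"
  shows "int (card X) + int (card Y) + int (card Z) - 1 \<le> int CARD('p)" "-1 \<le> r"
proof -
  have "int (card X) + int (card Y) - 1 \<le> int (card (X + Y))"
    using assms trio_card_plus(3)[OF assms] by (intro cauchy_davenport_small) (auto simp: trio_def)
  then show "int (card X) + int (card Y) + int (card Z) - 1 \<le> int CARD('p)" "-1 \<le> r"
    using trio_card_plus(1,2)[OF assms] by linarith+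
qed

text \<open>For half arcs the loss factor \<open>1 - cos (pi / 2)\<close> is \<open>1\<close>, and
  sums of two points do not wrap. By \<open>atom_numeric\<close> the arc holds more than
  \<open>0.745 |V|\<close> points, while \<open>|V + V| <= 2 m + m^2 / |Y| + 1\<close> is small
  enough for the 3k-4 theorem on the indices. Maximality of the arc then excludes points outside
  it.\<close>

lemma atom_rectified:
  fixes V Y W :: "'p::prime_card mod_ring set"
  assumes t: "trio V Y W r" and v: "(7 / 200) * real (card Y) \<le> real (card V)" "real (card V) \<le> (21 / 100) * real (card Y)"
    and y: "100 * r + 300 \<le> int (card Y)" "2 * card Y \<le> CARD('p)"
  obtains a d I l where "d \<noteq> 0" "V = apmap a d ` I" "I \<subseteq> {0..l}" "0 \<in> I" "l \<in> I" "0 < l" "card I = card V"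
    "l \<le> 2 * int (card V) - 4"
    "real_of_int l \<le> (251 / 200) * real (card V) - (147 / 20000) * real (card Y) + (111 / 50) * real_of_int r + (61 / 50)"
proof -
  have r1: "-1 \<le> r" by (rule trio_sum_bound(2)[OF t])
  then have "r = -1 \<or> 0 \<le> r" by linarith
  then have rr: "real_of_int r = -1 \<or> 0 \<le> real_of_int r" by auto
  have yr: "100 * real_of_int r + 300 \<le> real (card Y)" using y(1) by linarith
  have neY: "Y \<noteq> {}" using t by (simp add: trio_def)
  have y200: "200 \<le> real (card Y)" using yr rr by linarith
  note num = atom_numeric[OF v rr yr]
  define m where "m = nat (int (card V) + r)"
  have "7 \<le> real (card V)" using v y200 by linarith
  then have v7: "7 \<le> card V" by simp
  have m: "real m = real (card V) + real_of_int r" using v7 r1 by (simp add: m_def)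
  have m0: "0 < real m" using m v7 rr by linarith
  have mle: "real m \<le> (11 / 50) * real (card Y)" using m v(2) yr by linarith
  then have mY: "m \<le> card Y" by linarith
  obtain a0 d0 where d0: "d0 \<noteq> 0"
    and n0: "(1 - cos (pi / real 2)) * (real (card V) - real (card {x \<in> V. \<exists>i. 0 \<le> i \<and> i \<le> int (CARD('p) div 2) \<and> x = a0 + of_int i * d0}))
        * real (card Y) \<le> real m * real (card V)"
    by (rule rectification_arc[OF t m mY y(2), of 2]) simp
  define N0 where "N0 = card {x \<in> V. \<exists>i. 0 \<le> i \<and> i \<le> int (CARD('p) div 2) \<and> x = a0 + of_int i * d0}"
  have "(real (card V) - real N0) * real (card Y) \<le> ((51 / 200) * real (card V) - (147 / 20000) * real (card Y)) * real (card Y)"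
    using n0 num(1) m by (simp add: N0_def mult.commute)
  then have "real (card V) - real N0 \<le> (51 / 200) * real (card V) - (147 / 20000) * real (card Y)"
    by (rule mult_right_le_imp_le) (use y200 in linarith)
  then have N0: "(149 / 200) * real (card V) + (147 / 20000) * real (card Y) \<le> real N0" by linarith
  then have "2 \<le> N0" using v7 y200 by linarith
  then have N02: "2 \<le> card {x \<in> V. \<exists>i. 0 \<le> i \<and> i \<le> int (CARD('p) div 2) \<and> x = a0 + of_int i * d0}"
    by (simp add: N0_def)
  have p2: "CARD('p) > 2" using y(2) y200 by linarith
  have hp: "CARD('p) div 2 < CARD('p)" using p2 by simp
  obtain a d I l where I: "d \<noteq> 0" "I \<subseteq> {0..l}" "0 \<in> I" "l \<in> I" "0 < l" "l \<le> int (CARD('p) div 2)" "apmap a d ` I \<subseteq> V"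
    "card {x \<in> V. \<exists>i. 0 \<le> i \<and> i \<le> int (CARD('p) div 2) \<and> x = a0 + of_int i * d0} \<le> card I"
    and Imax: "\<And>b e J u. e \<noteq> 0 \<Longrightarrow> J \<subseteq> {u..u + int (CARD('p) div 2)} \<Longrightarrow> apmap b e ` J \<subseteq> V \<Longrightarrow> card J \<le> card I"
    and Igcd: "\<And>g. g > 1 \<Longrightarrow> \<exists>i\<in>I. \<not> g dvd i"
    by (rule optimal_arc[OF d0 hp N02]) blast
  have finI: "finite I" using I(2) finite_subset by blast
  define A where "A = apmap a d ` I"
  have AV: "A \<subseteq> V" using I(7) by (simp add: A_def)
  have l2: "l + l < int CARD('p)" using I(6) two_mul_half_less[OF p2] by linarith
  have cA: "card A = card I" unfolding A_def by (rule card_apmap[OF I(1,2)]) (use l2 I(5) in linarith)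
  have cAA: "card (A + A) = card (I + I)" unfolding A_def by (rule card_apmap_plus[OF I(1,2,2) l2])
  have n: "real N0 \<le> real (card I)" using I(8) by (simp add: N0_def)
  have nv: "card I \<le> card V" using AV unfolding cA[symmetric] by (simp add: card_mono)
  \<comment> \<open>Only the growth of \<open>V + V\<close> matters here and not the size of
    \<open>Y0\<close>, so \<open>\<mu>\<close> takes its least admissible value
    \<open>m / |Y|\<close>.\<close>
  have K: "real (card (V + V)) \<le> (451 / 200) * real (card V) - (147 / 20000) * real (card Y) + (111 / 50) * real_of_int r + (61 / 50)"
  proof -
    define \<mu> where "\<mu> = real m / real (card Y)"
    have \<mu>: "real m \<le> \<mu> * real (card Y)" "0 < \<mu>" using m0 neY by (simp_all add: \<mu>_def card_gt_0_iff)
    have s: "(\<Sum>i<2. (1 + \<mu>) ^ i) = 2 + \<mu>" by (simp add: numeral_2_eq_2)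
    have "real m * \<mu> * real (card Y) = real m * real m" using neY by (simp add: \<mu>_def)
    also have "\<dots> \<le> ((51 / 200) * real (card V) - (147 / 20000) * real (card Y) + (11 / 50) * real_of_int r + (11 / 50)) * real (card Y)"
      using num(2) unfolding m by (simp only: mult.commute)
    finally have mm: "real m * \<mu> \<le> (51 / 200) * real (card V) - (147 / 20000) * real (card Y) + (11 / 50) * real_of_int r + (11 / 50)"
      by (rule mult_right_le_imp_le) (use y200 in linarith)
    have p: "2 * real (card Y) \<le> real CARD('p)" using y(2) by linarith
    have small: "real (card Y) + real m * (\<Sum>i<2. (1 + \<mu>) ^ i) < real CARD('p)"
      unfolding s distrib_left using mm mle p y200 yr rr v by linarith
    obtain Y0 where "\<And>j. real (card Y) + real m * (\<Sum>i<j. (1 + \<mu>) ^ i) < real CARD('p) \<Longrightarrow>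
       real (card (nfold j V)) \<le> real m * (\<Sum>i<j. (1 + \<mu>) ^ i) + 1"
      by (rule trio_petridis[OF t m \<mu>]) blast
    from this[OF small] have "real (card (V + V)) \<le> real m * 2 + real m * \<mu> + 1" unfolding s nfold_2 distrib_left by simp
    then show ?thesis using mm m by linarith
  qed
  have "card (A + A) \<le> card (V + V)" using AV by (intro card_mono set_plus_mono2) auto
  then have KI: "real (card (I + I)) \<le> (451 / 200) * real (card V) - (147 / 20000) * real (card Y) + (111 / 50) * real_of_int r + (61 / 50)"
    using K cAA by linarith
  then have "real (card (I + I)) \<le> 3 * real (card I) - 4" using n N0 v yr rr by linarith
  then have "int (card (I + I)) \<le> 3 * int (card I) - 4" by linarith
  then have F: "l + int (card I) \<le> int (card (I + I))" "l \<le> 2 * int (card I) - 4"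
    using freiman_3k_minus_4[OF I(2,3,4,5) Igcd] by simp_all
  have "A = V"
  proof (rule ccontr)
    assume "A \<noteq> V"
    then obtain \<alpha> where \<alpha>: "\<alpha> \<in> V" "\<alpha> \<notin> A" using AV by blast
    \<comment> \<open>Otherwise \<open>\<alpha> + A\<close> and \<open>A + A\<close> would be
      disjoint parts of \<open>V + V\<close> with at least \<open>3 |A| - 1\<close> elements
      together, against \<open>K\<close>.\<close>
    have "(+) \<alpha> ` A \<inter> (A + A) \<noteq> {}"
    proof
      assume dis: "(+) \<alpha> ` A \<inter> (A + A) = {}"
      have "card ((+) \<alpha> ` A) + card (A + A) = card ((+) \<alpha> ` A \<union> (A + A))"
        using dis by (intro card_Un_disjoint[symmetric]) auto
      also have "\<dots> \<le> card (V + V)"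
      proof (intro card_mono Un_least)
        show "(+) \<alpha> ` A \<subseteq> V + V" using \<alpha>(1) AV by (auto intro!: set_plus_memI)
        show "A + A \<subseteq> V + V" by (rule set_plus_mono2[OF AV AV])
      qed simp
      finally have "card I + card (I + I) \<le> card (V + V)" using cA cAA by simp
      moreover have "int (card I) \<le> l + 1"
        using card_mono[of "{0..l}" I] I(2,5) by simp
      ultimately have "3 * int (card I) - 1 \<le> int (card (V + V))" using F(1) by linarith
      then have "3 * real (card I) - 1 \<le> real (card (V + V))" by linarith
      then show False using K n N0 v yr rr by linarith
    qed
    then obtain s where s: "s \<in> (+) \<alpha> ` A" "s \<in> A + A" by blast
    from s(1) obtain i3 where i3: "i3 \<in> I" "s = \<alpha> + apmap a d i3" by (auto simp: A_def)
    from s(2) obtain x1 x2 where "x1 \<in> A" "x2 \<in> A" "s = x1 + x2" by (rule set_plus_memE)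
    then obtain i1 i2 where i12: "i1 \<in> I" "i2 \<in> I" "s = apmap a d i1 + apmap a d i2" by (auto simp: A_def)
    define t where "t = i1 + i2 - i3"
    have "\<alpha> = apmap a d i1 + apmap a d i2 - apmap a d i3" using i3(2) i12(3) by (simp add: eq_diff_eq)
    then have \<alpha>t: "\<alpha> = apmap a d t" by (simp add: apmap_def t_def algebra_simps)
    then have tI: "t \<notin> I" using \<alpha>(2) by (auto simp: A_def)
    have tl: "-l \<le> t" "t \<le> 2 * l" 
    proof -
      have "0 \<le> i1" "i1 \<le> l" "0 \<le> i2" "i2 \<le> l" "0 \<le> i3" "i3 \<le> l" using i12(1,2) i3(1) I(2) by auto
      then show "-l \<le> t" "t \<le> 2 * l" unfolding t_def by linarith+
    qed
    have "real_of_int l \<le> 2 * real (card V) - 4" using F(2) nv by linarith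
    then have "2 * real_of_int l \<le> real (card Y)" using v(2) y200 by linarith
    then have "2 * l \<le> int (card Y)" by linarith
    then have lh: "2 * l \<le> int (CARD('p) div 2)" using y(2) by linarith
    \<comment> \<open>So \<open>\<alpha>\<close> belongs to the progression with an index between
      \<open>-l\<close> and \<open>2 l\<close>. Together with \<open>I\<close> it fits into a window
      of length \<open>2 l <= p div 2\<close>, an arc with one more point.\<close>
    have "insert t I \<subseteq> {min 0 t..min 0 t + int (CARD('p) div 2)}"
      using I(2,5) tl lh by (auto simp: min_def)
    moreover have "apmap a d ` insert t I \<subseteq> V" using I(7) \<alpha>(1) \<alpha>t by simp
    ultimately have "card (insert t I) \<le> card I" by (rule Imax[OF I(1)])
    then show False using tI finI by simp
  qed
  then have VA: "V = apmap a d ` I" by (simp add: A_def)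
  have cI: "card I = card V" using cA \<open>A = V\<close> by simp
  have lb: "real_of_int l \<le> (251 / 200) * real (card V) - (147 / 20000) * real (card Y) + (111 / 50) * real_of_int r + (61 / 50)"
    using F(1) KI cI by linarith
  show ?thesis by (rule that[OF I(1) VA I(2,3,4,5) cI _ lb]) (use F(2) cI in linarith)
qed

lemma in_ap_mono: "in_ap d L X \<Longrightarrow> L \<le> M \<Longrightarrow> in_ap d M X"
  unfolding in_ap_def by (meson atLeastatMost_subset_iff image_mono order_refl order_trans)

lemma zero_sum_free_subset: "zero_sum_free X Y Z \<Longrightarrow> X' \<subseteq> X \<Longrightarrow> Y' \<subseteq> Y \<Longrightarrow> Z' \<subseteq> Z \<Longrightarrow> zero_sum_free X' Y' Z'"
  unfolding zero_sum_free_def by (meson subsetD)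

text \<open>\<open>nfold 3 V\<close> contains \<open>l + 1\<close> consecutive terms, and by the
  growth bound its sum with \<open>Y0\<close> is not everything; so \<open>Y0\<close> has a gap long
  enough to keep sums with \<open>V\<close> from wrapping. Then \<open>in_ap_third\<close> confines
  \<open>W\<close> and after it all of \<open>Y\<close>, and \<open>in_ap_tight\<close> makes the
  length sharp.\<close>

lemma in_ap_of_atom:
  fixes V Y W :: "'p::prime_card mod_ring set"
  assumes t: "trio V Y W r" and v: "(7 / 200) * real (card Y) \<le> real (card V)" "real (card V) \<le> (21 / 100) * real (card Y)"
    and y: "100 * r + 300 \<le> int (card Y)" "2 * card Y \<le> CARD('p)"
  obtains d where "d \<noteq> 0" "in_ap d (int (card Y) + r) Y"
proof -
  have r1: "-1 \<le> r" by (rule trio_sum_bound(2)[OF t])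
  have yr: "100 * real_of_int r + 300 \<le> real (card Y)" using y(1) by linarith
  obtain a d I l where I: "d \<noteq> 0" "V = apmap a d ` I" "I \<subseteq> {0..l}" "0 \<in> I" "l \<in> I" "0 < l" "card I = card V"
    "l \<le> 2 * int (card V) - 4"
    and lb: "real_of_int l \<le> (251 / 200) * real (card V) - (147 / 20000) * real (card Y) + (111 / 50) * real_of_int r + (61 / 50)"
    by (rule atom_rectified[OF t v y])
  define m where "m = real (card V) + real_of_int r"
  \<comment> \<open>\<open>0.22 = 0.21 + 0.01\<close> from the bounds on \<open>|V|\<close> and
    \<open>r\<close>. As parameter of \<open>trio_petridis\<close> it gives the growth
    \<open>1 + 1.22 + 1.22^2 = 3.7084\<close>, and \<open>1 + 0.22 \<cdot> 3.7084\<close> is below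
    \<open>2\<close>, hence below \<open>p / |Y|\<close>.\<close>
  have mb: "m \<le> (11 / 50) * real (card Y)" using v yr by (simp add: m_def)
  have ne: "V \<noteq> {}" "Y \<noteq> {}" "W \<noteq> {}" using t by (auto simp: trio_def)
  obtain Y0 where Y0: "Y0 \<subseteq> Y" "Y0 \<noteq> {}"
    and y0a: "(11 / 50) * (real (card Y) - real (card Y0)) \<le> real_of_int r + 1"
    and VY0: "real (card (V + Y0)) \<le> real (card Y0) + m"
    and N: "\<And>j. real (card (nfold j V + Y0)) \<le> real (card Y0) + m * (\<Sum>i<j. (1 + (11 / 50)) ^ i)"
    by (rule trio_petridis[OF t m_def mb]) auto
  have y0: "(11 / 50) * real (card Y) - (11 / 50) * real (card Y0) \<le> real_of_int r + 1"
    using y0a unfolding right_diff_distrib .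
  have y0y: "real (card Y0) \<le> real (card Y)" using Y0 by (simp add: card_mono)
  have p: "2 * real (card Y) \<le> real CARD('p)" using y(2) by linarith
  have s: "(\<Sum>i<3. (1 + (11 / 50)) ^ i) = ((9271 / 2500) :: real)" by (simp add: numeral_3_eq_3)
  have "real (card (nfold 3 V + Y0)) \<le> real (card Y0) + m * (9271 / 2500)" using N[of 3] unfolding s .
  then have "real (card (nfold 3 V + Y0)) < real CARD('p)" using mb p y0y yr r1 by linarith
  then have "nfold 3 V + Y0 \<noteq> UNIV" by auto
  then obtain g where g: "g \<notin> nfold 3 V + Y0" by blast
  have "{l..2 * l} \<subseteq> nfold 3 I" unfolding nfold_3
    by (rule triple_sumset_interval[OF I(3,4,5,6)]) (unfold right_diff_distrib, use I(7,8) in linarith)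
  then have "apmap (of_nat 3 * a) d ` {l..2 * l} \<subseteq> nfold 3 V"
    unfolding I(2) nfold_apmap by (rule image_mono)
  from in_ap_of_missing_interval[OF I(1) this g] have Y0ap: "in_ap d (int CARD('p) - 2 - l) Y0"
    using I(6) by simp
  have "apmap a d ` I \<subseteq> apmap a d ` {0..l}" by (rule image_mono[OF I(3)])
  then have Vap: "in_ap d l V" unfolding in_ap_def I(2) by (rule exI)
  have dense: "l + 1 + r + 3 \<le> 2 * int (card V)" using lb v yr r1 by linarith
  have lY0: "2 * l + 2 \<le> int (card Y0)" using lb v yr r1 y0 by linarith
  have w: "int CARD('p) - int (card V) - int (card Y) - r \<le> int (card W)" using t by (simp add: trio_def)
  have lW: "2 * l + 2 \<le> int (card W)" using lb v yr r1 w p by linarith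
  have "int (card (V + Y0)) \<le> int (card V) + int (card Y0) + r" using VY0 m_def by linarith
  from in_ap_third[OF I(1) ne(1) Vap Y0(2) Y0ap _ this dense zero_sum_free_subset[OF trio_zero_sum_free[OF t] order_refl Y0(1) order_refl]]
  have Wap: "in_ap d (int CARD('p) - int (card Y0) + l + 1) W" using lY0 I(6) by simp
  have t2: "trio V W Y r" by (rule trio_rotate[OF trio_swap[OF t]])
  from in_ap_third[OF I(1) ne(1) Vap ne(3) Wap _ trio_card_plus(2)[OF t2] dense trio_zero_sum_free[OF t2]]
  have Yap: "in_ap d (int CARD('p) - int (card W) + l + 1) Y" using lY0 lW I(6) by simp
  have "in_ap d (int (card Y) + r) Y"
  proof (rule in_ap_tight[OF I(1) ne(1) Vap ne(2) Yap _ trio_card_plus(2)[OF t] dense])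
    show "l + (int CARD('p) - int (card W) + l + 1) < int CARD('p)" using lW by linarith
    show "l + 3 \<le> int (card Y) + int (card V)" using lb v yr r1 by linarith
  qed
  then show ?thesis using that I(1) by blast
qed

text \<open>The number \<open>k\<close>, which is \<open>0.035 |Y|\<close> rounded up, gives both
  the lower bound for \<open>|V|\<close> and the bound \<open>k - 1\<close> for the intersections of
  translates. The latter limits the energy and forces \<open>|V| < 0.21 |Y|\<close>.\<close>

lemma in_ap_of_large_trio:
  fixes X Y Z :: "'p::prime_card mod_ring set"
  assumes t: "trio X Y Z r" and x: "(7 / 200) * real (card Y) \<le> real (card X)" "card X \<le> card Z"
    and y: "100 * r + 300 \<le> int (card Y)" "2 * card Y \<le> CARD('p)"
  obtains d where "d \<noteq> 0" "in_ap d (int (card Y) + r) Y"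
proof -
  have r1: "-1 \<le> r" by (rule trio_sum_bound(2)[OF t])
  have yr: "100 * real_of_int r + 300 \<le> real (card Y)" using y(1) by linarith
  define k where "k = nat \<lceil>(7 / 200) * real (card Y)\<rceil>"
  have "0 \<le> \<lceil>(7 / 200) * real (card Y)\<rceil>" by simp
  then have "real k = real_of_int \<lceil>(7 / 200) * real (card Y)\<rceil>" unfolding k_def by simp
  then have kr: "(7 / 200) * real (card Y) \<le> real k" "real k < (7 / 200) * real (card Y) + 1"
    using ceiling_correct[of "(7 / 200) * real (card Y)"] by linarith+
  have "0 < real k" using kr yr r1 by linarith
  then have k1: "1 \<le> k" by simp
  have "int k \<le> int (card X)" unfolding k_def using x(1) by (simp add: ceiling_le_iff)
  then have kx: "k \<le> card X" by simp
  then have kz: "k \<le> card Z" using x(2) by simp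
  obtain V where V: "k \<le> card V" "card (V + Y) + k \<le> CARD('p)" "card (V + Y) + card X \<le> card (X + Y) + card V"
    and rep: "\<And>t. t \<noteq> 0 \<Longrightarrow> card (V \<inter> (+) t ` V) < k"
    using atom_exists[OF t k1 kx kz] by blast
  have VY: "int (card (V + Y)) \<le> int (card V) + int (card Y) + r" using V(3) trio_card_plus(2)[OF t] by linarith
  have ne: "V \<noteq> {}" "Y \<noteq> {}" using V(1) k1 t by (auto simp: trio_def)
  have nU: "V + Y \<noteq> UNIV"
  proof
    assume "V + Y = UNIV"
    then have "card (V + Y) = CARD('p)" by simp
    then show False using V(2) k1 by linarith
  qed
  note t' = trio_complement(1)[OF ne nU VY]
  have "real (card (V \<inter> (+) t ` V)) \<le> real k - 1" if "t \<noteq> 0" for t using rep[OF that] by linarith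
  note E = energy_bound[OF this]
  have "real (card V) < (21 / 100) * real (card Y)"
    by (rule atom_size_bound[OF E, where r = "real_of_int r"]) (use VY kr yr r1 k1 in linarith)+
  then show ?thesis using in_ap_of_atom[OF t' _ _ y] that V(1) kr by fastforce
qed

text \<open>The progression \<open>B\<close> around \<open>Y\<close> has at most
  \<open>r + 1\<close> holes. Removing from \<open>Z\<close> the points that form the missing sum
  \<open>g\<close> with such a hole leaves a \<open>Z1\<close> for which all of \<open>B\<close>
  misses \<open>g\<close>, hence a long gap. \<open>Y\<close> and \<open>Z1\<close> then confine
  \<open>X\<close>, and \<open>X\<close> and \<open>Y\<close> confine all of
  \<open>Z\<close>.\<close>

lemma in_ap_extend:
  fixes X Y Z :: "'p::prime_card mod_ring set"
  assumes t: "trio X Y Z r" and d: "d \<noteq> 0" and Y: "in_ap d (int (card Y) + r) Y"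
    and big: "100 * r + 300 \<le> int (card Y)" "100 * r + 300 \<le> int (card Z)" "3 * r + 9 \<le> int (card X)"
  shows "in_ap d (int (card X) + r) X" "in_ap d (int (card Z) + r) Z"
proof -
  note sb = trio_sum_bound[OF t]
  define L where "L = int (card Y) + r"
  have ne: "X \<noteq> {}" "Y \<noteq> {}" "Z \<noteq> {}" using t by (auto simp: trio_def)
  have x1: "1 \<le> card X" using ne(1) by (simp add: Suc_le_eq card_gt_0_iff)
  obtain b where b: "Y \<subseteq> apmap b d ` {0..L}" using Y by (auto simp: in_ap_def L_def)
  define B where "B = apmap b d ` {0..L}"
  have YB: "Y \<subseteq> B" using b by (simp add: B_def)
  have cB: "int (card B) \<le> L + 1" using card_image_le[of "{0..L}" "apmap b d"] sb big by (simp add: B_def L_def)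
  note t2 = trio_rotate[OF t]
  have "Y + Z \<noteq> UNIV" using trio_card_plus(3)[OF t2] by auto
  then obtain g where g: "g \<notin> Y + Z" by blast
  define Z1 where "Z1 = {z \<in> Z. g - z \<notin> B}"
  have Z1: "Z1 \<subseteq> Z" by (auto simp: Z1_def)
  have "Z - Z1 \<subseteq> (\<lambda>s. g - s) ` (B - Y)"
  proof
    fix z assume z: "z \<in> Z - Z1"
    have "g - z \<notin> Y"
    proof
      assume "g - z \<in> Y"
      then have "g - z + z \<in> Y + Z" using z by (intro set_plus_memI) auto
      then show False using g by simp
    qed
    then have "g - z \<in> B - Y" using z by (auto simp: Z1_def)
    then show "z \<in> (\<lambda>s. g - s) ` (B - Y)" by (intro image_eqI[of _ _ "g - z"]) simp_all
  qed
  then have "card (Z - Z1) \<le> card (B - Y)" by (rule surj_card_le[OF finite])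
  moreover have "card (Z - Z1) = card Z - card Z1" "card (B - Y) = card B - card Y"
    using Z1 YB by (auto intro: card_Diff_subset)
  moreover have "card Y \<le> card B" "card Z1 \<le> card Z" using Z1 YB by (auto intro: card_mono)
  ultimately have z1: "int (card Z) - (r + 1) \<le> int (card Z1)" using cB by (simp add: L_def)
  have z1': "card Z1 \<le> card Z" using Z1 by (simp add: card_mono)
  have Z1ne: "Z1 \<noteq> {}" using z1 big sb by auto
  have "g \<notin> B + Z1"
  proof
    assume "g \<in> B + Z1"
    then obtain s z where "s \<in> B" "z \<in> Z1" "g = s + z" by (rule set_plus_memE)
    then show False by (simp add: Z1_def)
  qed
  moreover have "0 \<le> L + 1" using sb big by (simp add: L_def)
  ultimately have "in_ap d (int CARD('p) - 2 - (L - 0)) Z1"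
    by (intro in_ap_of_missing_interval[OF d, of b _ _ B]) (simp_all add: B_def)
  then have Z1ap: "in_ap d (int CARD('p) - 2 - L) Z1" by simp
  have "card (Y + Z1) \<le> card (Y + Z)" using Z1 by (intro card_mono set_plus_mono2) auto
  then have N: "int (card (Y + Z1)) \<le> int (card Y) + int (card Z1) + (2 * r + 1)"
    using trio_card_plus(2)[OF t2] z1 by linarith
  have Z1t: "in_ap d (int (card Z1) + (2 * r + 1)) Z1"
    by (rule in_ap_tight[OF d ne(2) Y Z1ne Z1ap _ N]) (use sb big z1 in \<open>simp_all add: L_def\<close>)
  \<comment> \<open>The excess \<open>r\<close> and the up to \<open>r + 1\<close> removed points
    add up to \<open>2 r + 1\<close>; thus \<open>Z1\<close> lies in \<open>|Z1| + 2 r + 2\<close>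
    terms and has at most \<open>h\<close> holes.\<close>
  obtain h where h: "h = 2 * r + 2" by blast
  have Xap0: "in_ap d (int CARD('p) - int (card Y) - int (card Z1)) X"
  proof (rule in_ap_plus_interval[OF d ne(2) _ Z1ne, where h = h])
    show "in_ap d (int (card Y) - 1 + h) Y" by (rule in_ap_mono[OF Y]) (use sb h in simp)
    show "in_ap d (int (card Z1) - 1 + h) Z1" by (rule in_ap_mono[OF Z1t]) (use h in simp)
    show "zero_sum_free Y Z1 X"
      by (rule zero_sum_free_subset[OF trio_zero_sum_free[OF t2] order_refl Z1 order_refl])
  qed (use sb big z1 z1' x1 h in linarith)+
  show Xap: "in_ap d (int (card X) + r) X"
    by (rule in_ap_tight[OF d ne(2) Y ne(1) Xap0 _ trio_card_plus(2)[OF trio_swap[OF t]]])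
      (use sb big z1 in linarith)+
  have "in_ap d (int CARD('p) - int (card X) - int (card Y)) Z"
  proof -
    obtain h where h: "h = r + 1" by blast
    show ?thesis
    proof (rule in_ap_plus_interval[OF d ne(1) _ ne(2), where h = h])
      show "in_ap d (int (card X) - 1 + h) X" using Xap h by simp
      show "in_ap d (int (card Y) - 1 + h) Y" using Y h by simp
      show "zero_sum_free X Y Z" by (rule trio_zero_sum_free[OF t])
    qed (use sb big x1 h in linarith)+
  qed
  then show "in_ap d (int (card Z) + r) Z"
    by (rule in_ap_mono) (use t in \<open>simp add: trio_def\<close>)
qed

section \<open>Trios with a small member\<close>

text \<open>\<open>n\<close> stands for the points of \<open>X\<close> in an arc of length
  \<open>p / 4\<close>, and \<open>183 / 625\<close> is slightly below
  \<open>1 - cos (pi / 4)\<close>. The first conclusion yields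
  \<open>|nfold 4 X| <= 9 n - 13\<close>, and \<open>9 n - 13 = 3 (3 n - 3) - 4\<close> is the
  threshold for the 3k-4 theorem on a double sumset with at least \<open>3 n - 3\<close>
  elements.\<close>

lemma sparse_numeric:
  fixes x n m y r \<tau> :: real
  assumes m: "m = x + r" "m = \<tau> * y" and r: "-1 \<le> r" "r + 3 \<le> x" "100 * r + 300 \<le> y" and x: "x < (7 / 200) * y"
    and n: "n = x \<or> n \<le> x - 1" "(183 / 625) * x - (183 / 625) * n \<le> \<tau> * x"
  shows "m * (4 + 6 * \<tau> + 4 * \<tau>\<^sup>2 + \<tau> ^ 3) + 13 < 9 * n" "\<tau> < (9 / 200)" "0 < \<tau>"
proof -
  have y: "200 \<le> y" "0 < y" using r by linarith+
  have "\<tau> * y < (9 / 200) * y" using m r x by linarith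
  then show t1: "\<tau> < (9 / 200)" using y by simp
  have ty: "0 < \<tau> * y" using m r by linarith
  then show t0: "0 < \<tau>" using y by (simp add: zero_less_mult_iff)
  have mpos: "0 < m" using ty unfolding m(2) .
  define c where "c = 4 + 6 * \<tau> + 4 * \<tau>\<^sup>2 + \<tau> ^ 3"
  show "m * (4 + 6 * \<tau> + 4 * \<tau>\<^sup>2 + \<tau> ^ 3) + 13 < 9 * n"
  proof (cases "(1 / 50) \<le> \<tau>")
    case True
    have t2: "\<tau> * \<tau> \<le> (9 / 200) * \<tau>" using t0 t1 by (intro mult_right_mono) auto
    have "\<tau> * (\<tau> * \<tau>) \<le> (9 / 200) * (\<tau> * \<tau>)" using t0 t1 by (intro mult_right_mono) auto
    then have "\<tau> * \<tau> * \<tau> \<le> (9 / 200) * (\<tau> * \<tau>)" by (simp only: mult.assoc)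
    with t2 t0 have c: "c \<le> 4 + (619 / 100) * \<tau>" unfolding c_def power2_eq_square power3_eq_cube by linarith
    \<comment> \<open>The chord of the square function between \<open>1 / 50\<close> and
      \<open>9 / 200\<close>.\<close>
    have q: "\<tau> * \<tau> \<le> (13 / 200) * \<tau> - (9 / 10000)"
    proof -
      have "0 \<le> (\<tau> - (1 / 50)) * ((9 / 200) - \<tau>)" using True t1 by simp
      then show ?thesis by (simp add: algebra_simps diff_divide_distrib add_divide_distrib)
    qed
    have "\<tau> * c \<le> \<tau> * (4 + (619 / 100) * \<tau>)" using c t0 by (intro mult_left_mono) auto
    also have "\<dots> = 4 * \<tau> + (619 / 100) * (\<tau> * \<tau>)" by (simp add: algebra_simps)
    finally have tc: "\<tau> * c \<le> 4 * \<tau> + (619 / 100) * (\<tau> * \<tau>)" .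
    obtain P where P: "P = (\<tau> - 1 / 100) * (1 - (17077 / 5000) * \<tau>)" by blast
    have "P = (517077 / 500000) * \<tau> - 1 / 100 - (17077 / 5000) * (\<tau> * \<tau>)" unfolding P by (simp add: algebra_simps diff_divide_distrib add_divide_distrib)
    then have key: "\<tau> * c \<le> 9 * P" using tc q True by linarith
    have "\<tau> * y + 3 - y / 100 \<le> x" using m r by linarith
    then have x1: "(\<tau> - 1 / 100) * y + 3 \<le> x" by (simp add: algebra_simps)
    \<comment> \<open>\<open>17077 / 5000\<close> is slightly above \<open>625 / 183\<close>, the
      factor in the bound for the points lost.\<close>
    have "x - (17077 / 5000) * (\<tau> * x) \<le> n" using n by linarith
    then have "x * (1 - (17077 / 5000) * \<tau>) \<le> n" by (simp add: algebra_simps)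
    moreover have "((\<tau> - 1 / 100) * y + 3) * (1 - (17077 / 5000) * \<tau>) \<le> x * (1 - (17077 / 5000) * \<tau>)"
      using x1 t1 by (intro mult_right_mono) auto
    moreover have "((\<tau> - 1 / 100) * y + 3) * (1 - (17077 / 5000) * \<tau>) = P * y + 3 - (51231 / 5000) * \<tau>"
      unfolding P by (simp add: algebra_simps diff_divide_distrib add_divide_distrib)
    ultimately have "P * y + 3 - (51231 / 5000) * \<tau> \<le> n" by linarith
    moreover have "\<tau> * c * y \<le> 9 * P * y" using key y by (intro mult_right_mono) auto
    moreover have "m * c = \<tau> * c * y" unfolding m(2) by simp
    moreover have "9 * P * y = 9 * (P * y)" by simp
    ultimately show ?thesis using t1 unfolding c_def[symmetric] by linarith
  next
    case False
    then have "\<tau> * \<tau> \<le> (1 / 50) * (1 / 50)" "\<tau> * \<tau> * \<tau> \<le> (1 / 50) * (1 / 50) * (1 / 50)"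
      using t0 by (intro mult_mono; simp)+
    then have "c \<le> (41217 / 10000)" using False unfolding c_def power2_eq_square power3_eq_cube by linarith
    then have mc: "m * c \<le> m * (41217 / 10000)" using mpos by (intro mult_left_mono) auto
    have mx: "m + 3 \<le> 2 * x" using m r by linarith
    from n(1) show ?thesis
    proof
      assume "n = x"
      then show ?thesis using mc mx mpos unfolding c_def[symmetric] by linarith
    next
      assume nx: "n \<le> x - 1"
      have "\<tau> * x \<le> (1 / 50) * x" using False r by (intro mult_right_mono) auto
      then have b: "(183 / 625) * x - (183 / 625) * n \<le> (1 / 50) * x" using n(2) by linarith
      \<comment> \<open>A lost point costs more than \<open>0.29\<close>, but the total cost is at
        most \<open>x / 50\<close>. So any loss requires an \<open>x\<close> large enough to absorb
        the additive constants.\<close>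
      then have "14 \<le> x" using nx by linarith
      then show ?thesis using b mc mx m(1) r(1) unfolding c_def[symmetric] by linarith
    qed
  qed
qed

lemma nfold_bounded:
  assumes "I \<subseteq> {0..l :: int}"
  shows "nfold n I \<subseteq> {0..int n * l}"
proof (induction n)
  case (Suc n)
  show ?case
  proof
    fix k assume "k \<in> nfold (Suc n) I"
    then obtain i j where "i \<in> I" "j \<in> nfold n I" "k = i + j" unfolding nfold.simps by (rule set_plus_memE)
    then show "k \<in> {0..int (Suc n) * l}" using assms Suc by (fastforce simp: distrib_right)
  qed
qed simp

lemma mult_4_div_4_less: "4 * (CARD('p::prime_card) div 4) < CARD('p)"
proof -
  have "prime CARD('p)" by (rule prime_card)
  moreover have "\<not> prime (4 * k)" for k :: nat
  proof
    assume pk: "prime (4 * k)"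
    have "2 dvd 4 * k" by presburger
    then have "(2 :: nat) = 1 \<or> 2 = 4 * k"
      by (rule pk[unfolded prime_nat_iff, THEN conjunct2, rule_format])
    then show False by presburger
  qed
  ultimately have "4 * (CARD('p) div 4) \<noteq> CARD('p)" by (metis (no_types))
  then show ?thesis by linarith
qed

lemma two_neq_0_mod_ring: "(2 :: 'p::prime_card mod_ring) \<noteq> 0" if "CARD('p) > 2"
proof -
  have "(of_int 2 :: 'p mod_ring) \<noteq> of_int 0" unfolding of_int_mod_ring_eq_iff using that by simp
  then show ?thesis by simp
qed

lemma card_three_disjoint:
  assumes "finite S" "A \<union> B \<union> C \<subseteq> S" "A \<inter> B = {}" "A \<inter> C = {}" "B \<inter> C = {}"
  shows "card A + card B + card C \<le> card S"
proof -
  have fin: "finite A" "finite B" "finite C" using assms finite_subset by blast+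
  have "card (A \<union> B \<union> C) = card (A \<union> B) + card C" using fin assms by (intro card_Un_disjoint) auto
  also have "card (A \<union> B) = card A + card B" using fin assms by (intro card_Un_disjoint) auto
  finally show ?thesis using card_mono[OF assms(1,2)] by simp
qed

text \<open>The arc comes from the Fourier bound, its length from the 3k-4 theorem for
  \<open>I\<close> or \<open>I + I\<close>, and its maximality shows that it contains
  \<open>X\<close>. By the last conclusion \<open>I + I\<close> fills more than half of
  \<open>{0..2 * l}\<close>, the condition under which \<open>triple_sumset_interval\<close> applies
  to it.\<close>

lemma sparse_rectified:
  fixes X Y Z :: "'p::prime_card mod_ring set"
  assumes t: "trio X Y Z r" and x: "real (card X) < (7 / 200) * real (card Y)" "r + 3 \<le> int (card X)"
    and y: "100 * r + 300 \<le> int (card Y)" "2 * card Y \<le> CARD('p)"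
  obtains a d I l where "d \<noteq> 0" "X = apmap a d ` I" "I \<subseteq> {0..l}" "0 \<in> I" "l \<in> I" "0 < l" "card I = card X"
    "l \<le> 3 * int (card X) - 4" "l + 2 \<le> int (card (I + I))"
proof -
  have r1: "-1 \<le> r" by (rule trio_sum_bound(2)[OF t])
  have yr: "100 * real_of_int r + 300 \<le> real (card Y)" using y(1) by linarith
  have y200: "200 \<le> real (card Y)" using yr r1 by linarith
  have neY: "Y \<noteq> {}" using t by (simp add: trio_def)
  have p2: "CARD('p) > 2" using y(2) y200 by linarith
  define m where "m = nat (int (card X) + r)"
  have m: "real m = real (card X) + real_of_int r" using x(2) r1 by (simp add: m_def)
  have m0: "0 < real m" using m x(2) r1 by linarith
  have mle: "real m \<le> (9 / 200) * real (card Y)" using m x(1) yr by linarith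
  then have mY: "m \<le> card Y" using y200 by linarith
  define \<mu> where "\<mu> = real m / real (card Y)"
  have \<mu>: "real m = \<mu> * real (card Y)" "0 < \<mu>" using m0 neY by (simp_all add: \<mu>_def card_gt_0_iff)
  obtain a0 d0 where d0: "d0 \<noteq> 0"
    and n0: "(1 - cos (pi / real 4)) * (real (card X) - real (card {x \<in> X. \<exists>i. 0 \<le> i \<and> i \<le> int (CARD('p) div 4) \<and> x = a0 + of_int i * d0}))
        * real (card Y) \<le> real m * real (card X)"
    by (rule rectification_arc[OF t m mY y(2), of 4]) simp
  define N0 where "N0 = card {x \<in> X. \<exists>i. 0 \<le> i \<and> i \<le> int (CARD('p) div 4) \<and> x = a0 + of_int i * d0}"
  have N0x: "N0 \<le> card X" unfolding N0_def by (intro card_mono) auto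
  have "(183 / 625) * real (card X) - (183 / 625) * real N0 \<le> \<mu> * real (card X)"
  proof -
    obtain D where D: "D = real (card X) - real N0" by blast
    have D0: "0 \<le> D" using N0x D by simp
    have "sqrt 2 \<le> 14143 / 10000" by (rule real_le_lsqrt) (simp_all add: power2_eq_square)
    then have "183 / 625 \<le> 1 - cos (pi / real 4)" by (simp add: cos_45)
    then have "(183 / 625 * D) * real (card Y) \<le> ((1 - cos (pi / real 4)) * D) * real (card Y)"
      using D0 by (intro mult_right_mono) auto
    also have "\<dots> \<le> real m * real (card X)" using n0 unfolding N0_def[symmetric] D .
    also have "\<dots> = (\<mu> * real (card X)) * real (card Y)" unfolding \<mu>(1) by simp
    finally have "183 / 625 * D \<le> \<mu> * real (card X)" by (rule mult_right_le_imp_le) (use y200 in linarith)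
    then show ?thesis using D by (simp add: right_diff_distrib)
  qed
  moreover have "real N0 = real (card X) \<or> real N0 \<le> real (card X) - 1"
  proof -
    have "N0 = card X \<or> N0 + 1 \<le> card X" using N0x by linarith
    then show ?thesis by auto
  qed
  ultimately have num: "real m * (4 + 6 * \<mu> + 4 * \<mu>\<^sup>2 + \<mu> ^ 3) + 13 < 9 * real N0" and \<mu>b: "\<mu> < (9 / 200)"
    using sparse_numeric[OF m \<mu>(1), of "real N0"] r1 x yr by auto
  have c4: "(\<Sum>i<4. (1 + \<mu>) ^ i) = 4 + 6 * \<mu> + 4 * \<mu>\<^sup>2 + \<mu> ^ 3"
    by (simp add: eval_nat_numeral power2_eq_square power3_eq_cube algebra_simps)
  have X4: "real (card (nfold 4 X)) + 12 < 9 * real N0"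
  proof -
    have small: "real (card Y) + real m * (\<Sum>i<4. (1 + \<mu>) ^ i) < real CARD('p)"
      unfolding c4 using num N0x x(1) y(2) by linarith
    obtain Y0 where "\<And>j. real (card Y) + real m * (\<Sum>i<j. (1 + \<mu>) ^ i) < real CARD('p) \<Longrightarrow>
       real (card (nfold j X)) \<le> real m * (\<Sum>i<j. (1 + \<mu>) ^ i) + 1"
      by (rule trio_petridis[OF t m eq_refl[OF \<mu>(1)] \<mu>(2)]) blast
    from this[OF small] show ?thesis using num unfolding c4 by linarith
  qed
  have "0 < 9 * real N0 - 12" using X4 by linarith
  then have N02: "2 \<le> card {x \<in> X. \<exists>i. 0 \<le> i \<and> i \<le> int (CARD('p) div 4) \<and> x = a0 + of_int i * d0}"
    unfolding N0_def by linarith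
  have hp: "CARD('p) div 4 < CARD('p)" using p2 by simp
  obtain a d I l where I: "d \<noteq> 0" "I \<subseteq> {0..l}" "0 \<in> I" "l \<in> I" "0 < l" "l \<le> int (CARD('p) div 4)" "apmap a d ` I \<subseteq> X"
    "card {x \<in> X. \<exists>i. 0 \<le> i \<and> i \<le> int (CARD('p) div 4) \<and> x = a0 + of_int i * d0} \<le> card I"
    and Imax: "\<And>b e J u. e \<noteq> 0 \<Longrightarrow> J \<subseteq> {u..u + int (CARD('p) div 4)} \<Longrightarrow> apmap b e ` J \<subseteq> X \<Longrightarrow> card J \<le> card I"
    and Igcd: "\<And>g. g > 1 \<Longrightarrow> \<exists>i\<in>I. \<not> g dvd i"
    by (rule optimal_arc[OF d0 hp N02]) blast
  have finI: "finite I" using I(2) finite_subset by blast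
  define A where "A = apmap a d ` I"
  have AX: "A \<subseteq> X" using I(7) by (simp add: A_def)
  have "4 * l \<le> 4 * int (CARD('p) div 4)" using I(6) by simp
  also have "\<dots> < int CARD('p)" using mult_4_div_4_less[where 'p='p] by linarith
  finally have l4: "4 * l < int CARD('p)" .
  have cA: "card A = card I" unfolding A_def by (rule card_apmap[OF I(1,2)]) (use l4 I(5) in linarith)
  have cnA: "card (nfold j A) = card (nfold j I)" if "j \<le> 4" for j
    unfolding A_def nfold_apmap
  proof (rule card_apmap[OF I(1) nfold_bounded[OF I(2)]])
    have "int j * l \<le> 4 * l" using that I(5) by (intro mult_right_mono) auto
    then show "int j * l - 0 < int CARD('p)" using l4 by simp
  qed
  have nfI: "finite (nfold j I)" "nfold j I \<noteq> {}" for j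
    using finite_nfold[OF finI] nfold_nonempty[of I] I(3) by blast+
  have gr: "card I + card (nfold j I) \<le> card (nfold (Suc j) I) + 1" for j
    unfolding nfold.simps using card_plus_ge_int[of I "nfold j I"] finI nfI[of j] I(3) by force
  have c1: "card (nfold 1 I) = card I" by simp
  have c2: "2 * card I \<le> card (nfold 2 I) + 1" using gr[of 1] by (simp add: numeral_2_eq_2)
  have c3: "card I + card (nfold 2 I) \<le> card (nfold 3 I) + 1" using gr[of 2] by (simp add: numeral_2_eq_2 numeral_3_eq_3)
  have c4': "card I + card (nfold 3 I) \<le> card (nfold 4 I) + 1" using gr[of 3] by (simp add: eval_nat_numeral)
  have "card (nfold 4 A) \<le> card (nfold 4 X)" using nfold_mono[OF AX] by (intro card_mono) auto
  then have I4: "card (nfold 4 I) \<le> card (nfold 4 X)" using cnA[of 4] by simp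
  have n: "real N0 \<le> real (card I)" using I(8) by (simp add: N0_def)
  have X4n: "card (nfold 4 X) + 12 < 9 * card I" using X4 n by linarith
  have nx: "card I \<le> card X" using AX unfolding cA[symmetric] by (simp add: card_mono)
  have I2n: "2 \<le> int (card I)" using I(8) N02 by linarith
  have l1: "int (card I) \<le> l + 1" using card_mono[of "{0..l}" I] I(2,5) by simp
  \<comment> \<open>If the theorem does not apply to \<open>I\<close>, then
    \<open>|I + I| >= 3 |I| - 3\<close> and it applies to \<open>I + I\<close>. There it bounds
    \<open>2 l\<close> by \<open>|nfold 4 I| - |I + I|\<close>, which leaves a bound of only about
    \<open>3 |I|\<close> for \<open>l\<close>.\<close>
  have struct: "l \<le> 3 * int (card I) - 4 \<and> l + 2 \<le> int (card (I + I))"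
  proof (cases "int (card (I + I)) \<le> 3 * int (card I) - 4")
    case True
    then have "l + int (card I) \<le> int (card (I + I))" "l \<le> 2 * int (card I) - 4"
      using freiman_3k_minus_4[OF I(2,3,4,5) Igcd] by simp_all
    then show ?thesis using I2n by linarith
  next
    case False
    have I2: "I + I \<subseteq> {0..2 * l}" using nfold_bounded[OF I(2), of 2] unfolding nfold_2 by simp
    have z: "0 \<in> I + I" "2 * l \<in> I + I"
      using set_plus_memI[OF I(3,3)] set_plus_memI[OF I(4,4)] by simp_all
    have g: "\<exists>i\<in>I + I. \<not> g dvd i" if g: "g > 1" for g
    proof -
      obtain i where i: "i \<in> I" "\<not> g dvd i" using Igcd[OF g] by blast
      then have "0 + i \<in> I + I" using I(3) by (intro set_plus_memI)
      then show ?thesis using i by (intro bexI[of _ i]) simp_all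
    qed
    have "nfold (2 + 2) I = nfold 2 I + nfold 2 I" by (rule nfold_add)
    then have e: "nfold 4 I = (I + I) + (I + I)" unfolding nfold_2 by simp
    have s: "int (card ((I + I) + (I + I))) \<le> 3 * int (card (I + I)) - 4"
      using e X4n I4 False by simp
    have "0 < 2 * l" using I(5) by simp
    then have F: "2 * l + int (card (I + I)) \<le> int (card ((I + I) + (I + I)))" "2 * l \<le> 2 * int (card (I + I)) - 4"
      using freiman_3k_minus_4[OF I2 z _ g s] by simp_all
    have "int (card ((I + I) + (I + I))) \<le> 9 * int (card I) - 13" using e X4n I4 by simp
    then show ?thesis using F False by linarith
  qed
  have "A = X"
  proof (rule ccontr)
    assume "A \<noteq> X"
    then obtain \<alpha> where \<alpha>: "\<alpha> \<in> X" "\<alpha> \<notin> A" using AX by blast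
    \<comment> \<open>A relation may express \<open>\<alpha> + \<alpha>\<close> by the progression
      without giving \<open>\<alpha>\<close> an integral index. With difference \<open>d / 2\<close>
      and doubled indices, \<open>A\<close> and \<open>\<alpha>\<close> lie in one progression,
      still in a window of length \<open>4 l\<close>.\<close>
    define e where "e = d / 2"
    have two: "(2 :: 'p mod_ring) \<noteq> 0" by (rule two_neq_0_mod_ring[OF p2])
    have e: "e \<noteq> 0" "e * 2 = d" using I(1) two by (simp_all add: e_def)
    have half: "apmap b e (2 * i) = apmap b d i" for b i
      unfolding apmap_def e(2)[symmetric] by simp
    have lh: "4 * l \<le> int (CARD('p) div 4)"
    proof -
      have "real_of_int l \<le> 3 * real (card X)" using struct nx by linarith
      moreover have "real CARD('p) < 4 * real (CARD('p) div 4) + 4" by linarith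
      ultimately have "real_of_int (4 * l) \<le> real (CARD('p) div 4)" using x(1) y(2) y200 by linarith
      then show ?thesis by linarith
    qed
    have no: False if c: "c \<noteq> 0" "apmap a c ` I' = A" "card I' = card I" "finite I'"
      and s: "\<alpha> = apmap a c s" "insert s I' \<subseteq> {u..u + 4 * l}" for c I' s u
    proof -
      have "s \<notin> I'"
      proof
        assume "s \<in> I'"
        then have "\<alpha> \<in> A" unfolding c(2)[symmetric] s(1) by (rule imageI)
        then show False using \<alpha>(2) by simp
      qed
      then have cJ: "card (insert s I') = card I + 1" using c(3,4) by simp
      have "insert s I' \<subseteq> {u..u + int (CARD('p) div 4)}" using s(2) lh by auto
      moreover have "apmap a c ` insert s I' \<subseteq> X" unfolding image_insert c(2) using AX \<alpha>(1) s(1) by simp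
      ultimately have "card (insert s I') \<le> card I" by (rule Imax[OF c(1)])
      then show False using cJ by simp
    qed
    have im: "apmap a e ` (\<lambda>i. 2 * i) ` I = A" unfolding image_image half A_def ..
    have cim: "card ((\<lambda>i. 2 * i) ` I) = card I" by (intro card_image) (simp add: inj_on_def)
    \<comment> \<open>Fourfold sums with no, one or two copies of \<open>\<alpha>\<close>. Disjoint
      in \<open>nfold 4 X\<close>, they would have at least
      \<open>(4 n - 3) + (3 n - 2) + (2 n - 1) = 9 n - 6\<close> elements, where
      \<open>n = |I|\<close>. Each possible coincidence solves for \<open>\<alpha>\<close> or its
      double.\<close>
    have "\<not> ((+) \<alpha> ` nfold 3 A \<inter> nfold 4 A = {} \<and> (+) \<alpha> ` nfold 3 A \<inter> (+) (\<alpha> + \<alpha>) ` nfold 2 A = {}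
         \<and> nfold 4 A \<inter> (+) (\<alpha> + \<alpha>) ` nfold 2 A = {})"
    proof
      assume dis: "(+) \<alpha> ` nfold 3 A \<inter> nfold 4 A = {} \<and> (+) \<alpha> ` nfold 3 A \<inter> (+) (\<alpha> + \<alpha>) ` nfold 2 A = {}
         \<and> nfold 4 A \<inter> (+) (\<alpha> + \<alpha>) ` nfold 2 A = {}"
      have s3: "(+) \<alpha> ` nfold 3 A \<subseteq> nfold 4 X"
      proof
        fix s assume "s \<in> (+) \<alpha> ` nfold 3 A"
        then obtain w where "w \<in> nfold 3 X" "s = \<alpha> + w" using nfold_mono[OF AX] by blast
        then have "s \<in> X + nfold 3 X" using \<alpha>(1) by (auto intro: set_plus_memI)
        then show "s \<in> nfold 4 X" by (simp add: eval_nat_numeral)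
      qed
      have s2: "(+) (\<alpha> + \<alpha>) ` nfold 2 A \<subseteq> nfold 4 X"
      proof
        fix s assume "s \<in> (+) (\<alpha> + \<alpha>) ` nfold 2 A"
        then obtain w where w: "w \<in> nfold 2 X" "s = \<alpha> + (\<alpha> + w)" using nfold_mono[OF AX] by (auto simp: add.assoc)
        then have "s \<in> X + (X + nfold 2 X)" unfolding w(2) using \<alpha>(1) by (intro set_plus_memI)
        then show "s \<in> nfold 4 X" by (simp add: eval_nat_numeral)
      qed
      have "card ((+) \<alpha> ` nfold 3 A) + card (nfold 4 A) + card ((+) (\<alpha> + \<alpha>) ` nfold 2 A) \<le> card (nfold 4 X)"
        by (rule card_three_disjoint[OF finite Un_least[OF Un_least[OF s3 nfold_mono[OF AX]] s2]])
          (rule dis[THEN conjunct1] dis[THEN conjunct2, THEN conjunct1] dis[THEN conjunct2, THEN conjunct2])+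
      then have "card (nfold 3 I) + card (nfold 4 I) + card (nfold 2 I) \<le> card (nfold 4 X)"
        using cnA[of 2] cnA[of 3] cnA[of 4] by simp
      then show False using c2 c3 c4' X4n by linarith
    qed
    then consider s where "s \<in> (+) \<alpha> ` nfold 3 A" "s \<in> nfold 4 A"
      | s where "s \<in> (+) \<alpha> ` nfold 3 A" "s \<in> (+) (\<alpha> + \<alpha>) ` nfold 2 A"
      | s where "s \<in> nfold 4 A" "s \<in> (+) (\<alpha> + \<alpha>) ` nfold 2 A" by blast
    then show False
    proof cases
      case 1
      from 1(1) obtain i where i: "i \<in> nfold 3 I" "s = \<alpha> + apmap (of_nat 3 * a) d i" unfolding A_def nfold_apmap by blast
      from 1(2) obtain j where j: "j \<in> nfold 4 I" "s = apmap (of_nat 4 * a) d j" unfolding A_def nfold_apmap by blast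
      have "\<alpha> = apmap (of_nat 4 * a) d j - apmap (of_nat 3 * a) d i" using i(2) j(2) by (simp add: eq_diff_eq)
      also have "\<dots> = apmap a d (j - i)" by (simp add: apmap_def algebra_simps)
      finally have s: "\<alpha> = apmap a d (j - i)" .
      have "0 \<le> i" "i \<le> 3 * l" "0 \<le> j" "j \<le> 4 * l"
        using i(1) j(1) nfold_bounded[OF I(2), of 3] nfold_bounded[OF I(2), of 4] by auto
      then have "insert (j - i) I \<subseteq> {min 0 (j - i)..min 0 (j - i) + 4 * l}" using I(2,5) by (auto simp: min_def)
      then show False by (rule no[OF I(1) A_def[symmetric] refl finI s])
    next
      case 2
      from 2(1) obtain i where i: "i \<in> nfold 3 I" "s = \<alpha> + apmap (of_nat 3 * a) d i" unfolding A_def nfold_apmap by blast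
      from 2(2) obtain j where j: "j \<in> nfold 2 I" "s = \<alpha> + \<alpha> + apmap (of_nat 2 * a) d j" unfolding A_def nfold_apmap by blast
      have "\<alpha> + (apmap (of_nat 2 * a) d j) = apmap (of_nat 3 * a) d i" using i(2) j(2) by (simp add: add.assoc)
      then have "\<alpha> = apmap (of_nat 3 * a) d i - apmap (of_nat 2 * a) d j" by (simp add: eq_diff_eq)
      also have "\<dots> = apmap a d (i - j)" by (simp add: apmap_def algebra_simps)
      finally have s: "\<alpha> = apmap a d (i - j)" .
      have "0 \<le> i" "i \<le> 3 * l" "0 \<le> j" "j \<le> 2 * l"
        using i(1) j(1) nfold_bounded[OF I(2), of 3] nfold_bounded[OF I(2), of 2] by auto
      then have "insert (i - j) I \<subseteq> {min 0 (i - j)..min 0 (i - j) + 4 * l}" using I(2,5) by (auto simp: min_def)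
      then show False by (rule no[OF I(1) A_def[symmetric] refl finI s])
    next
      case 3
      from 3(1) obtain j where j: "j \<in> nfold 4 I" "s = apmap (of_nat 4 * a) d j" unfolding A_def nfold_apmap by blast
      from 3(2) obtain i where i: "i \<in> nfold 2 I" "s = \<alpha> + \<alpha> + apmap (of_nat 2 * a) d i" unfolding A_def nfold_apmap by blast
      have "\<alpha> + \<alpha> = apmap (of_nat 4 * a) d j - apmap (of_nat 2 * a) d i" using i(2) j(2) by (simp add: eq_diff_eq)
      also have "\<dots> = 2 * apmap a e (j - i)" unfolding e(2)[symmetric] apmap_def by (simp add: algebra_simps)
      finally have "2 * \<alpha> = 2 * apmap a e (j - i)" by simp
      then have s: "\<alpha> = apmap a e (j - i)" using two by simp
      have "0 \<le> i" "i \<le> 2 * l" "0 \<le> j" "j \<le> 4 * l"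
        using i(1) j(1) nfold_bounded[OF I(2), of 4] nfold_bounded[OF I(2), of 2] by auto
      then have "insert (j - i) ((\<lambda>i. 2 * i) ` I) \<subseteq> {min 0 (j - i)..min 0 (j - i) + 4 * l}"
        using I(2,5) by (auto simp: min_def)
      then show False by (rule no[OF e(1) im cim finite_imageI[OF finI] s])
    qed
  qed
  then have XA: "X = apmap a d ` I" by (simp add: A_def)
  have cI: "card I = card X" using cA \<open>A = X\<close> by simp
  show ?thesis by (rule that[OF I(1) XA I(2,3,4,5) cI]) (use struct cI in linarith)+
qed

lemma sparse_step:
  fixes X Y Z :: "'p::prime_card mod_ring set"
  assumes d: "d \<noteq> 0" and X: "X = apmap a d ` I"
    and I: "I \<subseteq> {0..l}" "0 \<in> I" "l \<in> I" "0 < l" "card I = card X" and lx: "l \<le> 2 * int (card X) - 3"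
    and Y: "Y \<noteq> {}" "in_ap d M Y" and lM: "l + M < int CARD('p)"
    and N: "int (card (X + Y)) \<le> int (card X) + int (card Y) + r" and r: "r + 3 \<le> int (card X)"
    and holes: "4 * M + 4 * int (card X) + l + 1 \<le> 5 * int (card Y)" and yl: "2 * l + 3 \<le> int (card Y)"
    and z: "zero_sum_free X Y Z"
  shows "in_ap d (int (card Y) + r) Y" "in_ap d (int CARD('p) - int (card Y) + 1 + l) Z"
proof -
  have Mp: "M < int CARD('p)" using lM I(4) by linarith
  obtain b J L where J: "Y = apmap b d ` J" "J \<subseteq> {0..L}" "0 \<in> J" "L \<in> J" "0 \<le> L" "L \<le> M"
      "card J = card Y" "int (card Y) \<le> L + 1"
    by (rule in_ap_hull[OF Y d Mp])
  define x1 where "x1 = int (card X) - 1"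
  have x1: "0 < x1" "l \<le> 2 * x1" using lx I(4) by (simp_all add: x1_def)
  define H where "H = L + 1 - int (card Y)"
  have H0: "0 \<le> H" using J(8) by (simp add: H_def)
  \<comment> \<open>The least number of blocks with \<open>x1 * q > H\<close>, where
    \<open>H\<close> counts the holes. Then \<open>2 q l <= 4 x1 q <= 4 (H + x1)\<close>, which
    \<open>holes\<close> keeps within \<open>L - l\<close>.\<close>
  define q where "q = nat (H div x1) + 1"
  have q: "int q = H div x1 + 1" using H0 x1(1) by (simp add: q_def pos_imp_zdiv_nonneg_iff)
  have dm: "x1 * (H div x1) + H mod x1 = H" by (rule mult_div_mod_eq)
  have md: "0 \<le> H mod x1" "H mod x1 < x1" using x1(1) by simp_all
  have xq: "x1 * int q = x1 * (H div x1) + x1" unfolding q by (simp add: algebra_simps)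
  have few: "L + 1 - int (card J) < (int (card I) - 1) * int q"
    using xq dm md unfolding J(7) I(5) H_def[symmetric] x1_def[symmetric] by linarith
  have "int q * l \<le> int q * (2 * x1)" using x1(2) by (intro mult_left_mono) auto
  also have "\<dots> = 2 * (x1 * int q)" by simp
  finally have ql: "2 * (int q * l) \<le> L - l"
    using xq dm md J(6,8) holes H_def x1_def by linarith
  have "card (X + Y) = card (I + J)" unfolding X J(1)
    by (rule card_apmap_plus[OF d I(1) J(2)]) (use lM J(6) in linarith)
  then have IJ: "int (card (I + J)) \<le> int (card I) + int (card J) + r" using N I(5) J(7) by simp
  then have IJ': "int (card (I + J)) \<le> int (card J) + 2 * int (card I) - 3" using r I(5) by linarith
  have int: "{l + 1..L - 1} \<subseteq> I + J"
  proof
    fix t assume "t \<in> {l + 1..L - 1}"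
    then have "l + 1 \<le> t" "t \<le> L - 1" by simp_all
    then show "t \<in> I + J"
      by (rule sumset_interval_of_few_holes[OF I(1-4) J(2-4) IJ' ql few])
  qed
  have Ll: "2 * l + 2 \<le> L" using yl J(8) by linarith
  have rI: "r + 3 \<le> int (card I)" using r I(5) by simp
  have "L \<le> int (card Y) + r" using tight_lengths(1)[OF I(1-4) J(2-4) IJ rI Ll int] unfolding J(7) .
  then have "J \<subseteq> {0..int (card Y) + r}" using J(2) by auto
  then have "apmap b d ` J \<subseteq> apmap b d ` {0..int (card Y) + r}" by (rule image_mono)
  then show "in_ap d (int (card Y) + r) Y" unfolding in_ap_def J(1)[symmetric] by (rule exI)
  have "apmap (a + b) d ` {l + 1..L - 1} \<subseteq> X + Y" unfolding X J(1) apmap_plus by (rule image_mono[OF int])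
  from in_ap_of_missing_interval[OF d this zero_sum_free_plus[OF z]]
  have "in_ap d (int CARD('p) - 2 - (L - 1 - (l + 1))) Z" using Ll I(4) by simp
  then show "in_ap d (int CARD('p) - int (card Y) + 1 + l) Z"
    by (rule in_ap_mono) (use J(8) in simp)
qed

text \<open>By \<open>no_long_gap\<close> the set \<open>J\<close> has no gap that the interval
  \<open>{k..2 * k}\<close> cannot bridge, so sliding this interval along \<open>J\<close> covers
  everything up to \<open>L + 2 * k\<close>. Against the growth bound of
  \<open>trio_petridis\<close> this limits \<open>L\<close>.\<close>

lemma nfold_gap_length:
  fixes a b d :: "'p::prime_card mod_ring"
  assumes d: "d \<noteq> 0" and I: "I \<subseteq> {0..l}" "0 \<in> I" and J: "J \<subseteq> {0..L}" "0 \<in> J" "L \<in> J"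
    and N: "int (card (I + J)) \<le> int (card J) + 2 * int (card I) - 3"
    and k: "l \<le> k" "0 \<le> k" "{k..2 * k} \<subseteq> nfold j I" and Lk: "L + k < int CARD('p)"
  shows "L + k + 1 \<le> int (card (nfold j (apmap a d ` I) + apmap b d ` J))"
proof -
  have L0: "0 \<le> L" using J by auto
  have "{k..L + 2 * k} \<subseteq> nfold j I + J"
  proof
    fix t assume t: "t \<in> {k..L + 2 * k}"
    then have "0 \<le> t - k" "t - k \<le> L + k" by simp_all
    from no_long_gap[OF I J N k(1) this] obtain s where s: "s \<in> J" "t - k - k \<le> s" "s \<le> t - k" by blast
    then have "t - s \<in> nfold j I" using k(3) by auto
    then have "t - s + s \<in> nfold j I + J" using s(1) by (rule set_plus_memI)
    then show "t \<in> nfold j I + J" by simp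
  qed
  then have "apmap (of_nat j * a + b) d ` {k..L + 2 * k} \<subseteq> nfold j (apmap a d ` I) + apmap b d ` J"
    unfolding nfold_apmap apmap_plus by (rule image_mono)
  then have "card (apmap (of_nat j * a + b) d ` {k..L + 2 * k}) \<le> card (nfold j (apmap a d ` I) + apmap b d ` J)"
    by (intro card_mono) auto
  moreover have "card (apmap (of_nat j * a + b) d ` {k..L + 2 * k}) = card {k..L + 2 * k}"
    by (rule card_apmap[OF d order_refl]) (use Lk in simp)
  ultimately show ?thesis using L0 k(2) by simp
qed

text \<open>With \<open>X1 = |X| - 1\<close> and \<open>H\<close> holes this ensures that enough
  blocks of length \<open>l\<close> fit into the interval. The square of \<open>l\<close> is removed
  by \<open>(l - 2 X1)^2 >= 0\<close>, the rest is increasing in \<open>l\<close> and is taken at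
  \<open>l = 3 X1\<close>; \<open>4931 / 200\<close> rounds up three times
  \<open>8.2183\<close>.\<close>

lemma hole_product_bound:
  fixes X1 l m H B :: real
  assumes "0 < X1" "0 \<le> l" "l \<le> 3 * X1" "X1 \<le> m" "H \<le> (82183 / 10000) * m - 2 * l" "(4931 / 200) * m - 13 * X1 \<le> B"
  shows "(H + X1) * l \<le> B * X1"
proof -
  have "(H + X1) * l \<le> ((82183 / 10000) * m - 2 * l + X1) * l" using assms by (intro mult_right_mono) auto
  also have "\<dots> \<le> ((82183 / 10000) * m - 7 * X1) * l + 8 * (X1 * X1)"
  proof -
    have "0 \<le> (l - 2 * X1) * (l - 2 * X1)" by simp
    then show ?thesis by (simp add: algebra_simps)
  qed
  also have "((82183 / 10000) * m - 7 * X1) * l \<le> ((82183 / 10000) * m - 7 * X1) * (3 * X1)" using assms by (intro mult_left_mono) auto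
  also have "((82183 / 10000) * m - 7 * X1) * (3 * X1) + 8 * (X1 * X1) = ((246549 / 10000) * m - 13 * X1) * X1" by (simp add: algebra_simps)
  also have "\<dots> \<le> B * X1" using assms by (intro mult_right_mono) auto
  finally show ?thesis by simp
qed

text \<open>At first only \<open>l <= 3 |X| - 4\<close> is known, so an interval is found in
  \<open>nfold 6 X\<close>, the threefold sum of \<open>X + X\<close>. It gives \<open>Y0\<close> a
  gap and bounds its holes, and a count modulo \<open>l\<close> improves the length to
  \<open>l <= |X| + r\<close>. Now \<open>nfold 3 X\<close> contains an interval too, the bound on
  the holes improves, and \<open>sparse_step\<close> leads from \<open>Y0\<close> to
  \<open>Z\<close> and from \<open>Z\<close> to \<open>Y\<close>.\<close>

lemma in_ap_of_sparse_trio: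
  fixes X Y Z :: "'p::prime_card mod_ring set"
  assumes t: "trio X Y Z r" and x: "real (card X) < (7 / 200) * real (card Y)" "r + 3 \<le> int (card X)"
    and y: "100 * r + 300 \<le> int (card Y)" "2 * card Y \<le> CARD('p)" and yz: "card Y \<le> card Z"
  obtains d where "d \<noteq> 0" "in_ap d (int (card X) + r) X" "in_ap d (int (card Y) + r) Y" "in_ap d (int (card Z) + r) Z"
proof -
  have r1: "-1 \<le> r" by (rule trio_sum_bound(2)[OF t])
  have yr: "100 * real_of_int r + 300 \<le> real (card Y)" using y(1) by linarith
  obtain a d I l where I: "d \<noteq> 0" "X = apmap a d ` I" "I \<subseteq> {0..l}" "0 \<in> I" "l \<in> I" "0 < l" "card I = card X"
    "l \<le> 3 * int (card X) - 4" and I2: "l + 2 \<le> int (card (I + I))"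
    by (rule sparse_rectified[OF t x y])
  have ne: "X \<noteq> {}" "Y \<noteq> {}" "Z \<noteq> {}" using t by (auto simp: trio_def)
  define m where "m = real (card X) + real_of_int r"
  have mb: "m \<le> (9 / 200) * real (card Y) - 3" using x(1) yr by (simp add: m_def)
  \<comment> \<open>\<open>1 / 8\<close> is well above \<open>m / |Y|\<close>: this way
    \<open>Y0\<close> lacks at most \<open>8 (r + 1)\<close> points of \<open>Y\<close>, while the
    sixfold growth \<open>269297 / 32768\<close> is still only about \<open>8.22\<close>.\<close>
  then have m8: "m \<le> 1 / 8 * real (card Y)" by linarith
  have m0: "0 \<le> m" using x(2) r1 by (simp add: m_def)
  obtain Y0 where Y0: "Y0 \<subseteq> Y" "Y0 \<noteq> {}"
    and y0: "1 / 8 * (real (card Y) - real (card Y0)) \<le> real_of_int r + 1"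
    and XY0: "real (card (X + Y0)) \<le> real (card Y0) + m"
    and N: "\<And>j. real (card (nfold j X + Y0)) \<le> real (card Y0) + m * (\<Sum>i<j. (1 + 1 / 8) ^ i)"
    by (rule trio_petridis[OF t m_def m8]) auto
  have y0': "real (card Y) - 8 * real_of_int r - 8 \<le> real (card Y0)" using y0 by (simp add: field_simps)
  have y0y: "real (card Y0) \<le> real (card Y)" using Y0 by (simp add: card_mono)
  have p: "2 * real (card Y) \<le> real CARD('p)" using y(2) by linarith
  have c6: "(\<Sum>i<6. (1 + 1 / 8) ^ i) = (269297 / 32768 :: real)" by (simp add: eval_nat_numeral)
  have c3: "(\<Sum>i<3. (1 + 1 / 8) ^ i) = (217 / 64 :: real)" by (simp add: eval_nat_numeral)
  have "m * (269297 / 32768) \<le> m * (82183 / 10000)" using m0 by (intro mult_left_mono) auto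
  then have N6: "real (card (nfold 6 X + Y0)) \<le> real (card Y0) + (82183 / 10000) * m" using N[of 6] unfolding c6 by linarith
  have N3: "real (card (nfold 3 X + Y0)) \<le> real (card Y0) + 217 / 64 * m" using N[of 3] unfolding c3 by linarith
  have finI: "finite I" using I(3) finite_subset by blast
  have six: "{2 * l..2 * (2 * l)} \<subseteq> nfold 6 I"
  proof -
    have 1: "I + I \<subseteq> {0..2 * l}" using nfold_bounded[OF I(3), of 2] unfolding nfold_2 by simp
    have 2: "0 \<in> I + I" "2 * l \<in> I + I" using set_plus_memI[OF I(4,4)] set_plus_memI[OF I(5,5)] by simp_all
    have "nfold (2 + (2 + 2)) I = nfold 2 I + (nfold 2 I + nfold 2 I)" unfolding nfold_add ..
    then have e: "nfold 6 I = (I + I) + ((I + I) + (I + I))" unfolding nfold_2 by simp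
    show ?thesis unfolding e
    proof (rule triple_sumset_interval[OF 1 2])
      show "0 < 2 * l" using I(6) by simp
      show "2 * l < 2 * (int (card (I + I)) - 1)" unfolding right_diff_distrib using I2 by linarith
    qed
  qed
  have "real (card (nfold 6 X + Y0)) < real CARD('p)" using N6 mb y0y p yr r1 by linarith
  then have "nfold 6 X + Y0 \<noteq> UNIV" by auto
  then obtain g where g: "g \<notin> nfold 6 X + Y0" by blast
  have "apmap (of_nat 6 * a) d ` {2 * l..2 * (2 * l)} \<subseteq> nfold 6 X"
    unfolding I(2) nfold_apmap by (rule image_mono[OF six])
  from in_ap_of_missing_interval[OF I(1) this g] have Y0ap: "in_ap d (int CARD('p) - 2 - 2 * l) Y0" using I(6) by simp
  have "int CARD('p) - 2 - 2 * l < int CARD('p)" using I(6) by simp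
  from in_ap_hull[OF Y0(2) Y0ap I(1) this] obtain b J L where J: "Y0 = apmap b d ` J" "J \<subseteq> {0..L}" "0 \<in> J" "L \<in> J" "0 \<le> L"
      "L \<le> int CARD('p) - 2 - 2 * l" "card J = card Y0" "int (card Y0) \<le> L + 1" by blast
  have finJ: "finite J" using J(2) finite_subset by blast
  have cIJ: "card (X + Y0) = card (I + J)" unfolding I(2) J(1)
    by (rule card_apmap_plus[OF I(1,3) J(2)]) (use J(6) I(6) in linarith)
  have IJr: "int (card (I + J)) \<le> int (card J) + int (card X) + r" using cIJ XY0 J(7) m_def by linarith
  then have IJ: "int (card (I + J)) \<le> int (card J) + 2 * int (card I) - 3" using x(2) I(7) by linarith
  have gap6: "L + 2 * l + 1 \<le> int (card (nfold 6 X + Y0))" unfolding I(2) J(1)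
    by (rule nfold_gap_length[OF I(1,3,4) J(2,3,4) IJ _ _ six]) (use I(6) J(6) in linarith)+
  \<comment> \<open>Once \<open>q\<close> blocks of length \<open>l\<close> fit,
    \<open>I + J\<close> meets all classes modulo \<open>l\<close>, so
    \<open>l + |J| <= |I + J|\<close>, and the bound on \<open>|I + J|\<close> gives the sharp
    length of \<open>X\<close>.\<close>
  have lxr: "l \<le> int (card X) + r"
  proof -
    define x1 where "x1 = int (card X) - 1"
    have x1: "0 < x1" "l \<le> 3 * x1" using I(6,8) by (simp_all add: x1_def)
    define H where "H = L + 1 - int (card Y0)"
    have H0: "0 \<le> H" using J(8) by (simp add: H_def)
    define q where "q = nat (H div x1) + 1"
    have q: "int q = H div x1 + 1" using H0 x1(1) by (simp add: q_def pos_imp_zdiv_nonneg_iff)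
    have dm: "x1 * (H div x1) + H mod x1 = H" by (rule mult_div_mod_eq)
    have md: "0 \<le> H mod x1" "H mod x1 < x1" using x1(1) by simp_all
    have xq: "x1 * int q = x1 * (H div x1) + x1" unfolding q by (simp add: algebra_simps)
    have few: "L + 1 - int (card J) < (int (card I) - 1) * int q"
      using xq dm md unfolding J(7) I(7) H_def[symmetric] x1_def[symmetric] by linarith
    have Hb: "real_of_int H \<le> (82183 / 10000) * m - 2 * real_of_int l" using gap6 N6 H_def by linarith
    have x1m: "real_of_int x1 \<le> m" using x1_def m_def r1 by linarith
    have B: "(4931 / 200) * m - 13 * real_of_int x1 \<le> real_of_int (L + 1)"
      using J(8) y0' yr x(1) m_def x1_def r1 by linarith
    have "0 < real_of_int x1" "0 \<le> real_of_int l" "real_of_int l \<le> 3 * real_of_int x1" using x1 I(6) by linarith+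
    from hole_product_bound[OF this x1m Hb B]
    have "(real_of_int H + real_of_int x1) * real_of_int l \<le> real_of_int (L + 1) * real_of_int x1" .
    then have "real_of_int ((H + x1) * l) \<le> real_of_int ((L + 1) * x1)" by simp
    then have "(H + x1) * l \<le> (L + 1) * x1" by (simp only: of_int_le_iff)
    moreover have "(x1 * int q) * l \<le> (H + x1) * l"
      using xq dm md I(6) by (intro mult_right_mono) linarith+
    moreover have "(int q * l) * x1 = (x1 * int q) * l" by (simp only: ac_simps)
    ultimately have "(int q * l) * x1 \<le> (L + 1) * x1" by linarith
    then have ql: "int q * l \<le> L + 1" using x1(1) by simp
    have JL: "J \<subseteq> {0..<0 + (L + 1)}" using J(2) by auto
    have "{0..<l} \<subseteq> residues_of l (I + J)"
      by (rule full_residues_of_few_holes[OF I(3-6) JL ql few])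
    from card_plus_ge_full_residues[OF I(6) finI finJ I(4,5) this] show ?thesis using IJr by linarith
  qed
  have l2: "l \<le> 2 * int (card X) - 3" using lxr x(2) by linarith
  have lm: "real_of_int l \<le> m" using lxr m_def by linarith
  have three: "{l..2 * l} \<subseteq> nfold 3 I" unfolding nfold_3
    by (rule triple_sumset_interval[OF I(3-6)]) (unfold right_diff_distrib, use l2 I(7) in linarith)
  have gap3: "L + l + 1 \<le> int (card (nfold 3 X + Y0))" unfolding I(2) J(1)
    by (rule nfold_gap_length[OF I(1,3,4) J(2,3,4) IJ _ _ three]) (use I(6) J(6) in linarith)+
  have "I \<subseteq> {0..int (card X) + r}" using I(3) lxr by auto
  then have "apmap a d ` I \<subseteq> apmap a d ` {0..int (card X) + r}" by (rule image_mono)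
  then have Xap: "in_ap d (int (card X) + r) X" unfolding in_ap_def I(2)[symmetric] by (rule exI)
  have "apmap b d ` J \<subseteq> apmap b d ` {0..L}" by (rule image_mono[OF J(2)])
  then have Y0L: "in_ap d L Y0" unfolding in_ap_def J(1) by (rule exI)
  have l0: "real_of_int l + 1 \<le> (9 / 200) * real (card Y)" using lm mb by linarith
  note zf = trio_zero_sum_free[OF t]
  have Zap0: "in_ap d (int CARD('p) - int (card Y0) + 1 + l) Z"
  proof (rule sparse_step(2)[OF I(1-7) l2 Y0(2) Y0L _ _ x(2)])
    show "l + L < int CARD('p)" using J(6) I(6) by linarith
    show "int (card (X + Y0)) \<le> int (card X) + int (card Y0) + r" using XY0 m_def by linarith
    show "4 * L + 4 * int (card X) + l + 1 \<le> 5 * int (card Y0)"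
      using gap3 N3 mb l0 y0' yr x(1) r1 I(6) by linarith
    show "2 * l + 3 \<le> int (card Y0)" using l0 y0' yr r1 by linarith
    show "zero_sum_free X Y0 Z" by (rule zero_sum_free_subset[OF zf order_refl Y0(1) order_refl])
  qed
  note t2 = trio_rotate[OF trio_swap[OF t]]
  have pb: "int CARD('p) \<le> int (card X) + int (card Y) + int (card Z) + r" using t by (simp add: trio_def)
  have zy: "real (card Y) \<le> real (card Z)" using yz by simp
  obtain M1 where M1: "M1 = int CARD('p) - int (card Y0) + 1 + l" by blast
  have Zap: "in_ap d M1 Z" using Zap0 M1 by simp
  have Zb: "4 * M1 + 4 * int (card X) + l + 1 \<le> 5 * int (card Z)"
    using M1 pb lm mb y0' yr x(1) r1 zy m_def by linarith
  have Zl: "2 * l + 3 \<le> int (card Z)" using l0 zy yr r1 by linarith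
  have lY0: "2 * l + 3 \<le> int (card Y0)" using l0 y0' yr r1 by linarith
  have lp: "l + M1 < int CARD('p)" using lY0 M1 by linarith
  note S2 = sparse_step[OF I(1-7) l2 ne(3) Zap lp trio_card_plus(2)[OF t2] x(2) Zb Zl trio_zero_sum_free[OF t2]]
  obtain M2 where M2: "M2 = int CARD('p) - int (card Z) + 1 + l" by blast
  have Yap: "in_ap d M2 Y" using S2(2) M2 by simp
  have Yb: "4 * M2 + 4 * int (card X) + l + 1 \<le> 5 * int (card Y)"
    using M2 pb lm mb yr x(1) r1 m_def by linarith
  have Yl: "2 * l + 3 \<le> int (card Y)" using l0 yr r1 by linarith
  have lp': "l + M2 < int CARD('p)" using Zl M2 by linarith
  have "in_ap d (int (card Y) + r) Y"
    by (rule sparse_step(1)[OF I(1-7) l2 ne(2) Yap lp' trio_card_plus(2)[OF t] x(2) Yb Yl zf])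
  then show ?thesis using that I(1) Xap S2(1) by blast
qed

section \<open>Combination of the two cases\<close>

lemma in_ap_of_trio:
  fixes X Y Z :: "'p::prime_card mod_ring set"
  assumes t: "trio X Y Z r" and o: "card X \<le> card Y" "card Y \<le> card Z"
    and x: "r + 3 \<le> int (card X)" and y: "100 * r + 300 \<le> int (card Y)"
  shows "\<exists>d. in_ap d (int (card X) + r) X \<and> in_ap d (int (card Y) + r) Y \<and> in_ap d (int (card Z) + r) Z"
proof -
  have "card X \<ge> 1" using t by (simp add: trio_def Suc_le_eq card_gt_0_iff)
  then have p: "2 * card Y \<le> CARD('p)" using trio_sum_bound(1)[OF t] o by linarith
  have xz: "card X \<le> card Z" using o by simp
  show ?thesis
  proof (cases "real (card X) < (7 / 200) * real (card Y)")
    case True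
    obtain d where "in_ap d (int (card X) + r) X" "in_ap d (int (card Y) + r) Y" "in_ap d (int (card Z) + r) Z"
      by (rule in_ap_of_sparse_trio[OF t True x y p o(2)])
    then show ?thesis by blast
  next
    case False
    then have big: "(7 / 200) * real (card Y) \<le> real (card X)" by simp
    obtain d where d: "d \<noteq> 0" "in_ap d (int (card Y) + r) Y"
      by (rule in_ap_of_large_trio[OF t big xz y p])
    have z: "100 * r + 300 \<le> int (card Z)" using y o by linarith
    have x3: "3 * r + 9 \<le> int (card X)" using big y trio_sum_bound(2)[OF t] by linarith
    show ?thesis using in_ap_extend[OF t d y z x3] d(2) by blast
  qed
qed

lemma arith_prog_of_in_ap:
  fixes X :: "'p::prime_card mod_ring set"
  assumes "in_ap d L X" "X \<noteq> {}"
  shows "\<exists>P. arith_prog d P \<and> X \<subseteq> P \<and> int (card P) \<le> L + 1"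
proof -
  obtain a where a: "X \<subseteq> apmap a d ` {0..L}" using assms(1) by (auto simp: in_ap_def)
  then have L: "0 \<le> L" using assms(2) by auto
  define P where "P = (\<lambda>k. a + of_nat k * d) ` {..<nat (L + 1)}"
  have "X \<subseteq> P"
  proof
    fix x assume "x \<in> X"
    then have "x \<in> apmap a d ` {0..L}" using a by blast
    then obtain i where "i \<in> {0..L}" "x = apmap a d i" by blast
    then have i: "0 \<le> i" "i \<le> L" "x = a + of_int i * d" by (simp_all add: apmap_def)
    then have "x = a + of_nat (nat i) * d" "nat i < nat (L + 1)" by simp_all
    then show "x \<in> P" unfolding P_def by (intro image_eqI[of _ _ "nat i"]) simp_all
  qed
  moreover have "arith_prog d P"
    unfolding arith_prog_def P_def using L by (intro exI[of _ a] exI[of _ "nat (L + 1)"]) simp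
  moreover have "card P \<le> nat (L + 1)" unfolding P_def using card_image_le[of "{..<nat (L + 1)}"] by simp
  ultimately show ?thesis using L by (intro exI[of _ P]) simp
qed

theorem theorem1p4:
  fixes A B C :: "'p::prime_card mod_ring set" and p :: nat and r :: int
  assumes "p = CARD('p)"
    and "A \<noteq> {}" and "B \<noteq> {}" and "A + B \<noteq> UNIV"
    and "C = uminus ` (UNIV - (A + B))"
    and "card A \<ge> card B"
    and "int (card (A + B)) = int (card A) + int (card B) + r"
    and "real (card (A + B)) \<le>
           min (real (card A) + 1.01 * real (card B) - 3) (real p - real_of_int r - 3)"
  shows "\<exists>d P\<^sub>A P\<^sub>B P\<^sub>C.
           arith_prog d P\<^sub>A \<and> arith_prog d P\<^sub>B \<and> arith_prog d P\<^sub>C \<and>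
           A \<subseteq> P\<^sub>A \<and> int (card P\<^sub>A) \<le> int (card A) + r + 1 \<and>
           B \<subseteq> P\<^sub>B \<and> int (card P\<^sub>B) \<le> int (card B) + r + 1 \<and>
           C \<subseteq> P\<^sub>C \<and> int (card P\<^sub>C) \<le> int (card C) + r + 1"
proof -
  have le: "int (card (A + B)) \<le> int (card A) + int (card B) + r" using assms(7) by simp
  have t: "trio A B C r" unfolding assms(5) by (rule trio_complement(1)[OF assms(2-4) le])
  have cC: "card C = p - card (A + B)" unfolding assms(1,5) by (rule trio_complement(2)[OF assms(2-4) le])
  have pAB: "card (A + B) \<le> p" unfolding assms(1) by (rule card_mod_ring_le)
  have "real_of_int (int (card (A + B))) = real_of_int (int (card A) + int (card B) + r)" using assms(7) by simp
  then have cr: "real (card (A + B)) = real (card A) + real (card B) + real_of_int r" by simp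
  have "real (card (A + B)) \<le> real (card A) + (101 / 100) * real (card B) - 3" using assms(8) by simp
  then have "100 * real_of_int r + 300 \<le> real (card B)" using cr by linarith
  then have b: "100 * r + 300 \<le> int (card B)" by linarith
  have "real (card (A + B)) + real_of_int r + 3 \<le> real p" using assms(8) by simp
  then have c: "r + 3 \<le> int (card C)" using cC pAB by linarith
  have r1: "-1 \<le> r" by (rule trio_sum_bound(2)[OF t])
  have tBA: "trio B A C r" by (rule trio_swap[OF t])
  have "\<exists>d. in_ap d (int (card A) + r) A \<and> in_ap d (int (card B) + r) B \<and> in_ap d (int (card C) + r) C"
  proof -
    \<comment> \<open>The smallest set must have \<open>r + 3\<close> elements and the middle one
      \<open>100 r + 300\<close>. \<open>B\<close> and every set at least as large satisfy both, as
      \<open>r >= -1\<close>; the bound for \<open>C\<close> enters when \<open>C\<close> is the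
      smallest.\<close>
    consider "card C \<le> card B" | "card B \<le> card C" "card C \<le> card A" | "card A \<le> card C" by linarith
    then show ?thesis
    proof cases
      case 1
      have "trio C B A r" by (rule trio_swap[OF trio_rotate[OF t]])
      from in_ap_of_trio[OF this 1 assms(6) c b] show ?thesis by blast
    next
      case 2
      have t': "trio B C A r" by (rule trio_rotate[OF t])
      have "\<exists>d. in_ap d (int (card B) + r) B \<and> in_ap d (int (card C) + r) C \<and> in_ap d (int (card A) + r) A"
        by (rule in_ap_of_trio[OF t' 2]) (use b 2 r1 in linarith)+
      then show ?thesis by blast
    next
      case 3
      have "\<exists>d. in_ap d (int (card B) + r) B \<and> in_ap d (int (card A) + r) A \<and> in_ap d (int (card C) + r) C"
        by (rule in_ap_of_trio[OF tBA assms(6) 3]) (use b assms(6) r1 in linarith)+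
      then show ?thesis by blast
    qed
  qed
  then obtain d where d: "in_ap d (int (card A) + r) A" "in_ap d (int (card B) + r) B" "in_ap d (int (card C) + r) C"
    by blast
  have "C \<noteq> {}" using t by (simp add: trio_def)
  obtain P\<^sub>A where "arith_prog d P\<^sub>A" "A \<subseteq> P\<^sub>A" "int (card P\<^sub>A) \<le> int (card A) + r + 1"
    using arith_prog_of_in_ap[OF d(1) assms(2)] by blast
  moreover obtain P\<^sub>B where "arith_prog d P\<^sub>B" "B \<subseteq> P\<^sub>B" "int (card P\<^sub>B) \<le> int (card B) + r + 1"
    using arith_prog_of_in_ap[OF d(2) assms(3)] by blast
  moreover obtain P\<^sub>C where "arith_prog d P\<^sub>C" "C \<subseteq> P\<^sub>C" "int (card P\<^sub>C) \<le> int (card C) + r + 1"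
    using arith_prog_of_in_ap[OF d(3) \<open>C \<noteq> {}\<close>] by blast
  ultimately show ?thesis by blast
qed

end
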